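(* Let $\mathbf{k}$ be a field, $\Sigma$ a finite set, and $\alpha=(\alpha_I,\alpha_\circ)$ a rational evaluation. Let $\mathcal{K}$ be the kernel of the action of the algebra $A(+-)$ on $A(+)$, with unit element $1_{\mathcal{K}}=1-\sum_{i=1}^k v^i\otimes v_i$, and let $\mathrm{tr}:\mathcal{K}\to\mathbf{k}$ be the trace map given by circular closure and evaluation via $\alpha$. Then $\mathrm{tr}$ turns $\mathcal{K}$ into a symmetric Frobenius algebra with the unit element $1_{\mathcal{K}}$; that is, $\mathrm{tr}(xy)=\mathrm{tr}(yx)$ for all $x,y\in\mathcal{K}$ and the bilinear form $(x,y)\mapsto \mathrm{tr}(xy)$ on the finite-dimensional unital algebra $\mathcal{K}$ is nondegenerate.
   Context: Evaluations. $\Sigma^*$ is the free monoid of words in $\Sigma$ (including the empty word $\emptyset$) and $\Sigma^*_\circ$ is the set of words up to cyclic equivalence $\omega_1\omega_2\sim\omega_2\omega_1$. An evaluation is a pair $\alpha=(\alpha_I,\alpha_\circ)$ of functions $\alpha_I:\Sigma^*\to\mathbf{k}$, $\alpha_\circ:\Sigma^*_\circ\to\mathbf{k}$. Cobordisms. A finite sign sequence $\varepsilon$ is viewed as an oriented $0$-manifold. A cobordism from $\varepsilon$ to $\varepsilon'$ is a compact oriented $1$-manifold with finitely many interior dots labelled by elements of $\Sigma$, some of whose boundary points ("outer" ones) are identified with the points of $\varepsilon$ (at the bottom) and $\varepsilon'$ (at the top), the strand being oriented upward at a $+$ and downward at a $-$; the remaining boundary points are called inner. Cobordisms are taken up to structure-preserving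 diffeomorphism rel outer boundary. Components are outer arcs (two outer endpoints), half-intervals (one outer and one inner endpoint), floating intervals (two inner endpoints) and circles; each carries a word read from head to tail (against the orientation), up to cyclic rotation for a circle. Composition $yx$ is stacking $y$ on top of $x$; the tensor product is juxtaposition. A closed cobordism (no outer boundary) evaluates to the product over its components of $\alpha_I(\omega)$ for an interval with word $\omega$ and $\alpha_\circ(\omega)$ for a circle with word $\omega$. The category $\mathcal{C}_\alpha$ has finite sign sequences as objects; $\mathrm{Hom}(\varepsilon,\varepsilon')$ is spanned over $\mathbf{k}$ by cobordisms from $\varepsilon$ to $\varepsilon'$ modulo the linear combinations $x$ such that, for every cobordism $y$ from $\varepsilon'$ to $\varepsilon$, the closure of $yx$ (joining the $i$-th bottom point with the $i$-th top point by an undecorated arc for every $i$) evaluates to $0$. It is a rigid symmetric monoidal $\mathbf{k}$-linear category; its unit object is the empty sequence $\emptyset_0$. Put $A(\varepsilon)=\mathrm{Hom}_{\mathcal{C}_\alpha}(\emptyset_0,\varepsilon)$. The evaluation $\alpha$ is rational if $A(+-)$ is finite-dimensional (equivalently, all hom spaces of $\mathcal{C}_\alpha$ are finite-dimensional). State spaces. $A(+)$ is spanned by the half-intervals $|\omega\rangle$ with word $\omega$, and $A(-)$ by the half-intervals $\langle\omega|$; the pairing $A(-)\otimes A(+)\to\mathbf{k}$, $(\langle\omega_1|,|\omega_2\rangle)=\alpha_I(\omega_1\omega_2)$, is perfect. Let $k=\dim A(+)$ and fix a basis $v^1,\dots,v^k$ of $A(+)$ and the dual basis $v_1,\dots,v_k$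 of $A(-)$, $(v_j,v^i)=\delta_{i,j}$. The algebra $A(+-)$. Bending the $-$ endpoint down identifies $A(+-)$ with $\mathrm{End}_{\mathcal{C}_\alpha}(+)$, and $A(+-)$ is given the algebra structure transported from composition in $\mathrm{End}_{\mathcal{C}_\alpha}(+)$; its unit $1$ is the undecorated arc, and it acts on $A(+)=\mathrm{Hom}(\emptyset_0,+)$ on the left by composition. $A(+-)$ is spanned by arcs decorated by words and by pairs of half-intervals $|\omega_1\rangle\otimes\langle\omega_2|$; the latter span a two-sided ideal $\mathcal{I}\cong A(+)\otimes A(-)\cong\mathrm{End}_{\mathbf{k}}(A(+))$, which is an algebra with unit $\sum_i v^i\otimes v_i$. There is a direct product decomposition $A(+-)\cong\mathcal{I}\times\mathcal{K}$, with $\mathcal{K}$ the kernel of the action of $A(+-)$ on $A(+)$. Trace. For $x\in A(+-)$ the circular closure joins the $+$ and $-$ endpoints by an undecorated arc and evaluates the result via $\alpha$: an arc with word $\omega$ is sent to $\alpha_\circ(\omega)$, and $|\omega_1\rangle\otimes\langle\omega_2|$ is sent to $\alpha_I(\omega_2\omega_1)$. The map $\mathrm{tr}:\mathcal{K}\to\mathbf{k}$ is the restriction of this linear map to $\mathcal{K}$. *)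

theory Defs
  imports "HOL-Library.Poly_Mapping" "HOL-Library.Multiset" "HOL-Algebra.Module"
begin

section \<open>Cyclic words and evaluations\<close>

definition cyc_eq :: "'s list \<Rightarrow> 's list \<Rightarrow> bool" where
  "cyc_eq u v \<longleftrightarrow> (\<exists>a b. u = a @ b \<and> v = b @ a)"

lemma cyc_eq_rotate: "cyc_eq u v \<longleftrightarrow> (\<exists>n. v = rotate n u)"
proof
  assume "cyc_eq u v"
  then show "\<exists>n. v = rotate n u"
    unfolding cyc_eq_def by (metis rotate_append)
next
  assume "\<exists>n. v = rotate n u"
  then obtain n where "v = rotate n u" ..
  then have "u = take (n mod length u) u @ drop (n mod length u) u"
    "v = drop (n mod length u) u @ take (n mod length u) u"
    by (simp_all add: rotate_drop_take)
  then show "cyc_eq u v"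
    unfolding cyc_eq_def by blast
qed

quotient_type 's cyc_word = "'s list" / cyc_eq
proof (rule equivpI)
  show "reflp cyc_eq"
    by (rule reflpI) (metis append_Nil append_Nil2 cyc_eq_def)
  show "symp cyc_eq"
    by (rule sympI) (metis cyc_eq_def)
  show "transp cyc_eq"
    by (rule transpI) (metis cyc_eq_rotate rotate_rotate)
qed

text \<open>An evaluation is a pair \<open>(\<alpha>\<^sub>I, \<alpha>\<^sub>\<circ>)\<close>. The alphabet is a set \<open>\<Sigma>\<close> (possibly empty) in a
  type \<open>'s\<close>; values on words that use letters outside \<open>\<Sigma>\<close> play no role below.\<close>

type_synonym ('s, 'k) evaluation = "('s list \<Rightarrow> 'k) \<times> ('s cyc_word \<Rightarrow> 'k)"


section \<open>Cobordisms\<close>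

datatype sign = Plus | Minus

text \<open>\<open>Bot i\<close> and \<open>Top j\<close> are outer boundary points, numbered from 0 from left to right; \<open>Mid i\<close>
  labels points that are about to be glued and does not occur in a cobordism.\<close>

datatype point = Bot nat | Mid nat | Top nat

text \<open>In \<open>Ival t w h\<close> the strand runs from the tail \<open>t\<close> to the head \<open>h\<close>, where \<open>None\<close> is an inner
  end point, and \<open>w\<close> is the word read from head to tail. A compact oriented 1-manifold with
  labelled dots is determined, up to diffeomorphism rel outer boundary, by the multiset of its
  components.\<close>

datatype 's component = Ival "point option" "'s list" "point option" | Circ "'s cyc_word"

type_synonym 's cob = "'s component multiset"

fun tail_of :: "'s component \<Rightarrow> point option" where
  "tail_of (Ival t w h) = t"
| "tail_of (Circ c) = None"

fun head_of :: "'s component \<Rightarrow> point option" where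
  "head_of (Ival t w h) = h"
| "head_of (Circ c) = None"

fun labelled_in :: "'s set \<Rightarrow> 's component \<Rightarrow> bool" where
  "labelled_in \<Sigma> (Ival t w h) \<longleftrightarrow> w \<in> lists \<Sigma>"
| "labelled_in \<Sigma> (Circ c) \<longleftrightarrow> c \<in> abs_cyc_word ` lists \<Sigma>"

text \<open>Strands point upward at \<open>+\<close> and downward at \<open>-\<close>, so a strand starts at a bottom \<open>+\<close> or a
  top \<open>-\<close>, and it ends at a bottom \<open>-\<close> or a top \<open>+\<close>.\<close>

definition start_points :: "sign list \<Rightarrow> sign list \<Rightarrow> point set" where
  "start_points \<epsilon> \<epsilon>' = {Bot i |i. i < length \<epsilon> \<and> \<epsilon> ! i = Plus} \<union>
                       {Top j |j. j < length \<epsilon>' \<and> \<epsilon>' ! j = Minus}"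

definition end_points :: "sign list \<Rightarrow> sign list \<Rightarrow> point set" where
  "end_points \<epsilon> \<epsilon>' = {Bot i |i. i < length \<epsilon> \<and> \<epsilon> ! i = Minus} \<union>
                     {Top j |j. j < length \<epsilon>' \<and> \<epsilon>' ! j = Plus}"

definition cobordism :: "'s set \<Rightarrow> sign list \<Rightarrow> sign list \<Rightarrow> 's cob \<Rightarrow> bool" where
  "cobordism \<Sigma> \<epsilon> \<epsilon>' c \<longleftrightarrow>
     (\<forall>s \<in># c. labelled_in \<Sigma> s) \<and>
     {#t \<in># image_mset tail_of c. t \<noteq> None#} = mset_set (Some ` start_points \<epsilon> \<epsilon>') \<and>
     {#h \<in># image_mset head_of c. h \<noteq> None#} = mset_set (Some ` end_points \<epsilon> \<epsilon>')"

fun relabel_component :: "(point \<Rightarrow> point) \<Rightarrow> 's component \<Rightarrow> 's component" where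
  "relabel_component f (Ival t w h) = Ival (map_option f t) w (map_option f h)"
| "relabel_component f (Circ c) = Circ c"

definition relabel :: "(point \<Rightarrow> point) \<Rightarrow> 's cob \<Rightarrow> 's cob" where
  "relabel f = image_mset (relabel_component f)"

text \<open>\<open>join p s s'\<close> joins the head of \<open>s\<close> and the tail of \<open>s'\<close>, both at \<open>p\<close>. If the tail of \<open>s\<close> is
  at \<open>p\<close> as well, then \<open>s\<close> and \<open>s'\<close> are one and the same interval, which closes up to a circle.\<close>

fun join :: "point \<Rightarrow> 's component \<Rightarrow> 's component \<Rightarrow> 's component" where
  "join p (Ival t w h) (Ival t' w' h') =
     (if t = Some p then Circ (abs_cyc_word w) else Ival t (w' @ w) h')"
| "join p s s' = s"

text \<open>\<open>glue p c\<close> is meant for \<open>c\<close> in which exactly one strand ends and one strand starts at \<open>p\<close>.\<close>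

definition glue :: "point \<Rightarrow> 's cob \<Rightarrow> 's cob" where
  "glue p c =
     {#s \<in># c. head_of s \<noteq> Some p \<and> tail_of s \<noteq> Some p#} +
     (\<Sum>s \<in># {#s \<in># c. head_of s = Some p#}. \<Sum>s' \<in># {#s' \<in># c. tail_of s' = Some p#}.
        {#join p s s'#})"

definition glue_mid :: "nat \<Rightarrow> 's cob \<Rightarrow> 's cob" where
  "glue_mid n c = fold (\<lambda>i. glue (Mid i)) [0..<n] c"

fun top_to_mid :: "point \<Rightarrow> point" where
  "top_to_mid (Top j) = Mid j"
| "top_to_mid p = p"

fun bot_to_mid :: "point \<Rightarrow> point" where
  "bot_to_mid (Bot i) = Mid i"
| "bot_to_mid p = p"

text \<open>\<open>stack n d c\<close> stacks \<open>d\<close> on top of \<open>c\<close> along \<open>n\<close> points.\<close>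

definition stack :: "nat \<Rightarrow> 's cob \<Rightarrow> 's cob \<Rightarrow> 's cob" where
  "stack n d c = glue_mid n (relabel top_to_mid c + relabel bot_to_mid d)"

definition cob_closure :: "nat \<Rightarrow> 's cob \<Rightarrow> 's cob" where
  "cob_closure n c = glue_mid n (relabel (top_to_mid \<circ> bot_to_mid) c)"

text \<open>\<open>tensor m n c d\<close> puts \<open>d\<close> to the right of \<open>c\<close>, where \<open>c\<close> has \<open>m\<close> bottom and \<open>n\<close> top points.\<close>

fun shift_point :: "nat \<Rightarrow> nat \<Rightarrow> point \<Rightarrow> point" where
  "shift_point m n (Bot i) = Bot (m + i)"
| "shift_point m n (Top j) = Top (n + j)"
| "shift_point m n (Mid i) = Mid i"

definition tensor :: "nat \<Rightarrow> nat \<Rightarrow> 's cob \<Rightarrow> 's cob \<Rightarrow> 's cob" where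
  "tensor m n c d = c + relabel (shift_point m n) d"

fun eval_component :: "('s, 'k) evaluation \<Rightarrow> 's component \<Rightarrow> 'k" where
  "eval_component \<alpha> (Ival t w h) = fst \<alpha> w"
| "eval_component \<alpha> (Circ c) = snd \<alpha> c"

text \<open>Only meaningful for closed cobordisms.\<close>

definition eval_cob :: "('s, 'k::field) evaluation \<Rightarrow> 's cob \<Rightarrow> 'k" where
  "eval_cob \<alpha> c = (\<Prod>s \<in># c. eval_component \<alpha> s)"


section \<open>Linear combinations of cobordisms\<close>

type_synonym ('s, 'k) lincob = "'s cob \<Rightarrow>\<^sub>0 'k"

definition scale :: "'k::field \<Rightarrow> ('s, 'k) lincob \<Rightarrow> ('s, 'k) lincob" where
  "scale a x = Poly_Mapping.map (\<lambda>b. a * b) x"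

definition linform :: "('s cob \<Rightarrow> 'k) \<Rightarrow> ('s, 'k::field) lincob \<Rightarrow> 'k" where
  "linform f x = (\<Sum>c \<in> Poly_Mapping.keys x. Poly_Mapping.lookup x c * f c)"

definition linmap :: "('s cob \<Rightarrow> 's cob) \<Rightarrow> ('s, 'k::field) lincob \<Rightarrow> ('s, 'k) lincob" where
  "linmap f x = (\<Sum>c \<in> Poly_Mapping.keys x. Poly_Mapping.single (f c) (Poly_Mapping.lookup x c))"

definition bilinmap ::
    "('s cob \<Rightarrow> 's cob \<Rightarrow> 's cob) \<Rightarrow> ('s, 'k::field) lincob \<Rightarrow> ('s, 'k) lincob \<Rightarrow> ('s, 'k) lincob" where
  "bilinmap f x y =
     (\<Sum>c \<in> Poly_Mapping.keys x. \<Sum>d \<in> Poly_Mapping.keys y. Poly_Mapping.single (f c d) (Poly_Mapping.lookup x c * Poly_Mapping.lookup y d))"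

definition lincobs :: "'s set \<Rightarrow> sign list \<Rightarrow> sign list \<Rightarrow> ('s, 'k::field) lincob set" where
  "lincobs \<Sigma> \<epsilon> \<epsilon>' = {x. \<forall>c \<in> Poly_Mapping.keys x. cobordism \<Sigma> \<epsilon> \<epsilon>' c}"

definition negligible ::
    "'s set \<Rightarrow> ('s, 'k::field) evaluation \<Rightarrow> sign list \<Rightarrow> sign list \<Rightarrow> ('s, 'k) lincob set" where
  "negligible \<Sigma> \<alpha> \<epsilon> \<epsilon>' =
     {x \<in> lincobs \<Sigma> \<epsilon> \<epsilon>'. \<forall>d. cobordism \<Sigma> \<epsilon>' \<epsilon> d \<longrightarrow>
        linform (\<lambda>c. eval_cob \<alpha> (cob_closure (length \<epsilon>) (stack (length \<epsilon>') d c))) x = 0}"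


section \<open>The category \<open>\<C>\<^sub>\<alpha>\<close>\<close>

text \<open>Morphisms are cosets of the negligible linear combinations. As for quotient groups and rings
  in HOL-Algebra, an operation is carried over to cosets by taking the union of the cosets of all
  results on representatives; this union is a single coset when the operation is well defined.\<close>

definition hom_coset ::
    "'s set \<Rightarrow> ('s, 'k::field) evaluation \<Rightarrow> sign list \<Rightarrow> sign list \<Rightarrow>
     ('s, 'k) lincob \<Rightarrow> ('s, 'k) lincob set" where
  "hom_coset \<Sigma> \<alpha> \<epsilon> \<epsilon>' x = {x + n |n. n \<in> negligible \<Sigma> \<alpha> \<epsilon> \<epsilon>'}"

text \<open>The hom space is only a vector space; the fields for multiplication and unit are not used.\<close>

definition Hom ::
    "'s set \<Rightarrow> ('s, 'k::field) evaluation \<Rightarrow> sign list \<Rightarrow> sign list \<Rightarrow>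
     ('k, ('s, 'k) lincob set) module" where
  "Hom \<Sigma> \<alpha> \<epsilon> \<epsilon>' =
     \<lparr> carrier = hom_coset \<Sigma> \<alpha> \<epsilon> \<epsilon>' ` lincobs \<Sigma> \<epsilon> \<epsilon>',
       mult = undefined,
       one = undefined,
       zero = hom_coset \<Sigma> \<alpha> \<epsilon> \<epsilon>' 0,
       add = (\<lambda>F G. \<Union>x\<in>F. \<Union>y\<in>G. hom_coset \<Sigma> \<alpha> \<epsilon> \<epsilon>' (x + y)),
       smult = (\<lambda>a F. \<Union>x\<in>F. hom_coset \<Sigma> \<alpha> \<epsilon> \<epsilon>' (scale a x)) \<rparr>"

text \<open>\<open>hom_comp \<Sigma> \<alpha> \<epsilon> \<epsilon>' \<epsilon>'' G F\<close> is the composite of \<open>F : \<epsilon> \<rightarrow> \<epsilon>'\<close> and \<open>G : \<epsilon>' \<rightarrow> \<epsilon>''\<close>.\<close>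

definition hom_comp ::
    "'s set \<Rightarrow> ('s, 'k::field) evaluation \<Rightarrow> sign list \<Rightarrow> sign list \<Rightarrow> sign list \<Rightarrow>
     ('s, 'k) lincob set \<Rightarrow> ('s, 'k) lincob set \<Rightarrow> ('s, 'k) lincob set" where
  "hom_comp \<Sigma> \<alpha> \<epsilon> \<epsilon>' \<epsilon>'' G F =
     (\<Union>y\<in>G. \<Union>x\<in>F. hom_coset \<Sigma> \<alpha> \<epsilon> \<epsilon>'' (bilinmap (stack (length \<epsilon>')) y x))"

abbreviation A_plus :: "'s set \<Rightarrow> ('s, 'k::field) evaluation \<Rightarrow> ('k, ('s, 'k) lincob set) module" where
  "A_plus \<Sigma> \<alpha> \<equiv> Hom \<Sigma> \<alpha> [] [Plus]"

abbreviation A_minus :: "'s set \<Rightarrow> ('s, 'k::field) evaluation \<Rightarrow> ('k, ('s, 'k) lincob set) module" where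
  "A_minus \<Sigma> \<alpha> \<equiv> Hom \<Sigma> \<alpha> [] [Minus]"


section \<open>The algebra \<open>A(+-)\<close>\<close>

text \<open>Bending the \<open>-\<close> end point of a cobordism \<open>\<emptyset> \<rightarrow> +-\<close> down turns that point, \<open>Top 1\<close>, into the
  bottom point of a cobordism \<open>+ \<rightarrow> +\<close>.\<close>

definition bend_down ::
    "'s set \<Rightarrow> ('s, 'k::field) evaluation \<Rightarrow> ('s, 'k) lincob set \<Rightarrow> ('s, 'k) lincob set" where
  "bend_down \<Sigma> \<alpha> F =
     (\<Union>x\<in>F. hom_coset \<Sigma> \<alpha> [Plus] [Plus] (linmap (relabel (id (Top 1 := Bot 0))) x))"

definition bend_up ::
    "'s set \<Rightarrow> ('s, 'k::field) evaluation \<Rightarrow> ('s, 'k) lincob set \<Rightarrow> ('s, 'k) lincob set" where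
  "bend_up \<Sigma> \<alpha> F =
     (\<Union>x\<in>F. hom_coset \<Sigma> \<alpha> [] [Plus, Minus] (linmap (relabel (id (Bot 0 := Top 1))) x))"

definition A_pm :: "'s set \<Rightarrow> ('s, 'k::field) evaluation \<Rightarrow> ('k, ('s, 'k) lincob set) module" where
  "A_pm \<Sigma> \<alpha> = (Hom \<Sigma> \<alpha> [] [Plus, Minus])
     \<lparr> mult := (\<lambda>F G. bend_up \<Sigma> \<alpha>
                 (hom_comp \<Sigma> \<alpha> [Plus] [Plus] [Plus] (bend_down \<Sigma> \<alpha> F) (bend_down \<Sigma> \<alpha> G))),
       one := hom_coset \<Sigma> \<alpha> [] [Plus, Minus]
                (Poly_Mapping.single {#Ival (Some (Top 1)) [] (Some (Top 0))#} 1) \<rparr>"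

definition act ::
    "'s set \<Rightarrow> ('s, 'k::field) evaluation \<Rightarrow>
     ('s, 'k) lincob set \<Rightarrow> ('s, 'k) lincob set \<Rightarrow> ('s, 'k) lincob set" where
  "act \<Sigma> \<alpha> F V = hom_comp \<Sigma> \<alpha> [] [Plus] [Plus] (bend_down \<Sigma> \<alpha> F) V"

definition ker_act :: "'s set \<Rightarrow> ('s, 'k::field) evaluation \<Rightarrow> ('s, 'k) lincob set set" where
  "ker_act \<Sigma> \<alpha> = {F \<in> carrier (A_pm \<Sigma> \<alpha>).
     \<forall>V \<in> carrier (A_plus \<Sigma> \<alpha>). act \<Sigma> \<alpha> F V = \<zero>\<^bsub>A_plus \<Sigma> \<alpha>\<^esub>}"

text \<open>\<open>V \<otimes> W \<in> A(+-)\<close> for \<open>V \<in> A(+)\<close> and \<open>W \<in> A(-)\<close>.\<close>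

definition tens ::
    "'s set \<Rightarrow> ('s, 'k::field) evaluation \<Rightarrow>
     ('s, 'k) lincob set \<Rightarrow> ('s, 'k) lincob set \<Rightarrow> ('s, 'k) lincob set" where
  "tens \<Sigma> \<alpha> V W = (\<Union>v\<in>V. \<Union>w\<in>W. hom_coset \<Sigma> \<alpha> [] [Plus, Minus] (bilinmap (tensor 0 1) v w))"

text \<open>The pairing of \<open>W \<in> A(-)\<close> and \<open>V \<in> A(+)\<close> joins their end points; on half-intervals this gives
  \<open>(\<langle>\<omega>\<^sub>1|, |\<omega>\<^sub>2\<rangle>) = \<alpha>\<^sub>I(\<omega>\<^sub>1\<omega>\<^sub>2)\<close>. It does not depend on representatives, as is the case for
  \<open>circ_tr\<close>.\<close>

definition pairing ::
    "('s, 'k::field) evaluation \<Rightarrow> ('s, 'k) lincob set \<Rightarrow> ('s, 'k) lincob set \<Rightarrow> 'k" where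
  "pairing \<alpha> W V = the_elem (\<Union>w\<in>W. \<Union>v\<in>V.
     {linform (eval_cob \<alpha>) (bilinmap (\<lambda>d c. glue_mid 1 (relabel top_to_mid (d + c))) w v)})"

text \<open>The circular closure joins the points \<open>Top 0\<close> and \<open>Top 1\<close> of a cobordism \<open>\<emptyset> \<rightarrow> +-\<close>.\<close>

definition circ_tr :: "('s, 'k::field) evaluation \<Rightarrow> ('s, 'k) lincob set \<Rightarrow> 'k" where
  "circ_tr \<alpha> F = the_elem
     ((\<lambda>x. linform (\<lambda>c. eval_cob \<alpha> (glue_mid 1 (relabel (\<lambda>p. Mid 0) c))) x) ` F)"


section \<open>Linear algebra on carriers\<close>

definition scalars :: "'k::field ring" where
  "scalars = \<lparr> carrier = UNIV, mult = (*), one = 1, zero = 0, add = (+) \<rparr>"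

definition fin_dim :: "('k, 'b, 'm) module_scheme \<Rightarrow> bool" where
  "fin_dim V \<longleftrightarrow> (\<exists>B. finite B \<and> B \<subseteq> carrier V \<and>
     (\<forall>x \<in> carrier V. \<exists>a. x = (\<Oplus>\<^bsub>V\<^esub>b\<in>B. a b \<odot>\<^bsub>V\<^esub> b)))"

definition basis :: "('k::field, 'b, 'm) module_scheme \<Rightarrow> nat \<Rightarrow> (nat \<Rightarrow> 'b) \<Rightarrow> bool" where
  "basis V k v \<longleftrightarrow>
     (\<forall>i<k. v i \<in> carrier V) \<and>
     (\<forall>x \<in> carrier V. \<exists>a. x = (\<Oplus>\<^bsub>V\<^esub>i\<in>{..<k}. a i \<odot>\<^bsub>V\<^esub> v i)) \<and>
     (\<forall>a. (\<Oplus>\<^bsub>V\<^esub>i\<in>{..<k}. a i \<odot>\<^bsub>V\<^esub> v i) = \<zero>\<^bsub>V\<^esub> \<longrightarrow> (\<forall>i<k. a i = 0))"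

definition rational :: "'s set \<Rightarrow> ('s, 'k::field) evaluation \<Rightarrow> bool" where
  "rational \<Sigma> \<alpha> \<longleftrightarrow> fin_dim (Hom \<Sigma> \<alpha> [] [Plus, Minus])"

text \<open>The locale \<^locale>\<open>algebra\<close> is for commutative algebras, hence the following.\<close>

definition unital_algebra :: "('k::field, 'b, 'm) module_scheme \<Rightarrow> bool" where
  "unital_algebra A \<longleftrightarrow>
     ring A \<and> Module.module (scalars :: 'k ring) A \<and>
     (\<forall>a. \<forall>x \<in> carrier A. \<forall>y \<in> carrier A.
        (a \<odot>\<^bsub>A\<^esub> x) \<otimes>\<^bsub>A\<^esub> y = a \<odot>\<^bsub>A\<^esub> (x \<otimes>\<^bsub>A\<^esub> y) \<and>
        x \<otimes>\<^bsub>A\<^esub> (a \<odot>\<^bsub>A\<^esub> y) = a \<odot>\<^bsub>A\<^esub> (x \<otimes>\<^bsub>A\<^esub> y))"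

definition linear_form :: "('k::field, 'b, 'm) module_scheme \<Rightarrow> ('b \<Rightarrow> 'k) \<Rightarrow> bool" where
  "linear_form V t \<longleftrightarrow>
     (\<forall>x \<in> carrier V. \<forall>y \<in> carrier V. t (x \<oplus>\<^bsub>V\<^esub> y) = t x + t y) \<and>
     (\<forall>a. \<forall>x \<in> carrier V. t (a \<odot>\<^bsub>V\<^esub> x) = a * t x)"

definition nondegenerate ::
    "('k::field, 'b, 'm) module_scheme \<Rightarrow> ('b \<Rightarrow> 'b \<Rightarrow> 'k) \<Rightarrow> bool" where
  "nondegenerate V f \<longleftrightarrow>
     (\<forall>x \<in> carrier V. (\<forall>y \<in> carrier V. f x y = 0) \<longrightarrow> x = \<zero>\<^bsub>V\<^esub>) \<and>
     (\<forall>y \<in> carrier V. (\<forall>x \<in> carrier V. f x y = 0) \<longrightarrow> y = \<zero>\<^bsub>V\<^esub>)"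

definition symmetric_frobenius_algebra ::
    "('k::field, 'b, 'm) module_scheme \<Rightarrow> ('b \<Rightarrow> 'k) \<Rightarrow> bool" where
  "symmetric_frobenius_algebra A t \<longleftrightarrow>
     unital_algebra A \<and> fin_dim A \<and> linear_form A t \<and>
     (\<forall>x \<in> carrier A. \<forall>y \<in> carrier A. t (x \<otimes>\<^bsub>A\<^esub> y) = t (y \<otimes>\<^bsub>A\<^esub> x)) \<and>
     nondegenerate A (\<lambda>x y. t (x \<otimes>\<^bsub>A\<^esub> y))"

end

theory Submission
  imports Defs
begin

text \<open>A cobordism from the empty sequence to \<open>+-\<close> is a strand, whole or cut in two, together
  with closed components. Such cobordisms form a monoid, and closing up gives a trace on it with
  \<open>tr(xy) = tr(yx)\<close>. The negligible combinations are the radical of the trace form, so \<open>A(+-)\<close> is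
  a symmetric Frobenius algebra. Put \<open>e = \<Sum>\<^sub>i v\<^sup>i \<otimes> v\<^sub>i\<close>. It acts as the identity on \<open>A(+)\<close>, and
  \<open>y(v \<otimes> w) = (yv) \<otimes> w\<close>; hence \<open>eye = ye\<close> for all \<open>y\<close>, and \<open>\<K> = {x. xe = 0}\<close>. For \<open>x \<in> \<K>\<close>,
  \<open>tr(exy) = tr(xye) = tr(xeye) = 0\<close> for all \<open>y\<close>, so \<open>ex = 0\<close> and \<open>1 - e\<close> is a unit of \<open>\<K>\<close>. Since
  \<open>tr(xz) = tr(x(z - ze))\<close> with \<open>z - ze \<in> \<K>\<close>, the form stays nondegenerate on \<open>\<K>\<close>.\<close>

section \<open>Linear combinations\<close>

text \<open>The obstacle is that composing cobordisms leaves debris. When two cut strands meet, a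
  floating interval splits off, and it turns into a number only after evaluation. Hence the product
  of cobordisms is a product of strands twisted by a cocycle with values in closed cobordisms, and
  every law has to hold for the strands as well as for the parts split off. On normal forms this is
  a finite case distinction between whole and cut strands. Morphisms are cosets and operations are
  unions over all representatives, so well-definedness is a separate task. It amounts to the
  absorption of negligible combinations, and each absorption is a rearrangement that moves the other
  factor into the test cobordism: cyclicity of the trace for the product, tr(v \<otimes> w) = (w, v)
  for the action and the tensor product. The kernel is treated as a right annihilator and not as a
  factor of A(+-), because e(ye) = ye can be read off from the action, whereas ex = 0 on the kernel
  cannot. The latter is where nondegeneracy of the trace form on the whole of A(+-) enters.\<close>

lemma linform_superset:
  assumes "finite S" "Poly_Mapping.keys x \<subseteq> S"
  shows "linform f x = (\<Sum>c\<in>S. Poly_Mapping.lookup x c * f c)"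
  unfolding linform_def
  by (rule sum.mono_neutral_left) (use assms in \<open>auto simp: in_keys_iff\<close>)

lemma linform_0 [simp]: "linform f 0 = 0"
  by (simp add: linform_def)

lemma linform_add [simp]: "linform f (x + y) = linform f x + linform f y"
proof -
  let ?S = "Poly_Mapping.keys x \<union> Poly_Mapping.keys y"
  have "linform f (x + y) = (\<Sum>c\<in>?S. Poly_Mapping.lookup (x + y) c * f c)"
    by (rule linform_superset) (use Poly_Mapping.keys_add[of x y] in auto)
  then show ?thesis
    by (simp add: linform_superset[of ?S] lookup_add distrib_right sum.distrib)
qed

lemma lookup_scale [simp]: "Poly_Mapping.lookup (scale a x) c = a * Poly_Mapping.lookup x c"
  unfolding scale_def by (simp add: Poly_Mapping.map.rep_eq when_def)

lemma keys_scale: "Poly_Mapping.keys (scale a x) \<subseteq> Poly_Mapping.keys x"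
  by (auto simp: in_keys_iff)

lemma linform_scale [simp]: "linform f (scale a x) = a * linform f x"
  by (simp add: linform_superset[OF _ keys_scale] linform_superset[of "Poly_Mapping.keys x" x]
      sum_distrib_left mult.assoc)

lemma scale_minus_one: "scale (- 1) x = - x"
  by (rule poly_mapping_eqI) simp

lemma linform_uminus [simp]: "linform f (- x) = - linform f x"
  using linform_scale[of f "- 1" x] by (simp add: scale_minus_one)

lemma linform_diff [simp]: "linform f (x - y) = linform f x - linform f y"
  using linform_add[of f x "- y"] by (simp del: linform_add)

lemma linform_single [simp]: "linform f (Poly_Mapping.single c a) = a * f c"
  by (simp add: linform_superset[of "{c}"])

lemma linform_sum [simp]: "linform f (\<Sum>i\<in>I. g i) = (\<Sum>i\<in>I. linform f (g i))"
  by (induction I rule: infinite_finite_induct) auto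

lemma linform_linmap [simp]: "linform g (linmap f x) = linform (\<lambda>c. g (f c)) x"
  unfolding linmap_def by (simp add: linform_def[of _ x])

lemma linform_bilinmap [simp]:
  "linform g (bilinmap f x y) = linform (\<lambda>c. linform (\<lambda>d. g (f c d)) y) x"
  unfolding bilinmap_def by (simp add: linform_def[of _ x] linform_def[of _ y] sum_distrib_left mult.assoc)

lemma linform_cong:
  "(\<And>c. c \<in> Poly_Mapping.keys x \<Longrightarrow> f c = g c) \<Longrightarrow> linform f x = linform g x"
  unfolding linform_def by (rule sum.cong) auto

lemma linform_eq_0: "(\<And>c. c \<in> Poly_Mapping.keys x \<Longrightarrow> f c = 0) \<Longrightarrow> linform f x = 0"
  unfolding linform_def by (rule sum.neutral) auto

lemma linform_mult_left: "linform (\<lambda>c. a * f c) x = a * linform f x"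
  unfolding linform_def by (simp add: sum_distrib_left mult.left_commute)

lemma linform_mult_right: "linform (\<lambda>c. f c * a) x = linform f x * a"
  unfolding linform_def by (simp add: sum_distrib_right mult.assoc)

lemma linform_add_fun: "linform (\<lambda>c. f c + g c) x = linform f x + linform g x"
  unfolding linform_def by (simp add: distrib_left sum.distrib)

text \<open>\<open>bilinmap\<close> sums over its left argument outside. The interchange makes it
  possible to use that a left argument is negligible while the right one is held fixed.\<close>

lemma linform_swap:
  "linform (\<lambda>c. linform (\<lambda>d. h c d) y) x = linform (\<lambda>d. linform (\<lambda>c. h c d) x) y"
  unfolding linform_def sum_distrib_left
  by (subst sum.swap) (simp add: mult.left_commute)

text \<open>The indicator function of a cobordism reads off its coefficient, so linear forms
  separate linear combinations. Comparing forms instead of coefficients avoids any bookkeeping of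
  distinct cobordisms with the same image under \<open>linmap\<close> or
  \<open>bilinmap\<close>.\<close>

lemma lincob_eqI:
  assumes "\<And>g. linform g x = linform g y"
  shows "x = y"
proof (rule poly_mapping_eqI)
  fix c
  have "linform (\<lambda>d. if d = c then 1 else 0) z = Poly_Mapping.lookup z c" for z :: "('a, 'b) lincob"
    by (simp add: linform_def in_keys_iff if_distrib[of "(*) _"] cong: if_cong)
  with assms show "Poly_Mapping.lookup x c = Poly_Mapping.lookup y c"
    by metis
qed

lemma linmap_add: "linmap f (x + y) = linmap f x + linmap f y"
  and bilinmap_add_left: "bilinmap h (x + y) z = bilinmap h x z + bilinmap h y z"
  and bilinmap_add_right: "bilinmap h z (x + y) = bilinmap h z x + bilinmap h z y"
  and bilinmap_scale_left: "bilinmap h (scale a x) z = scale a (bilinmap h x z)"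
  and bilinmap_scale_right: "bilinmap h z (scale a x) = scale a (bilinmap h z x)"
  by (rule lincob_eqI; simp add: linform_add_fun linform_mult_left)+

lemma keys_linmap: "Poly_Mapping.keys (linmap f x) \<subseteq> f ` Poly_Mapping.keys x"
  unfolding linmap_def
  by (rule subset_trans[OF Poly_Mapping.keys_sum]) (auto split: if_splits)

lemma keys_bilinmap:
  "Poly_Mapping.keys (bilinmap f x y)
    \<subseteq> (\<lambda>(c, d). f c d) ` (Poly_Mapping.keys x \<times> Poly_Mapping.keys y)"
proof
  fix b assume b: "b \<in> Poly_Mapping.keys (bilinmap f x y)"
  show "b \<in> (\<lambda>(c, d). f c d) ` (Poly_Mapping.keys x \<times> Poly_Mapping.keys y)"
  proof (rule ccontr)
    assume "\<not> ?thesis"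
    \<comment> \<open>The indicator form of \<open>b\<close> gives the coefficient at
      \<open>b\<close>; it vanishes on a \<open>bilinmap\<close> none of whose terms is
      \<open>b\<close>.\<close>
    then have "linform (\<lambda>d. if d = b then 1 else 0) (bilinmap f x y) = 0"
      by (auto intro!: linform_eq_0)
    then show False
      using b by (simp add: linform_def[of _ "bilinmap f x y"] in_keys_iff if_distrib[of "(*) _"] cong: if_cong del: linform_bilinmap)
  qed
qed

lemma add_diff_add_eq: "(a + b) - (c + d) = (a - c) + (b - d)" for a :: "'a::ab_group_add"
  by simp

section \<open>Hom spaces\<close>

lemma lincobs_0 [simp]: "0 \<in> lincobs \<Sigma> \<epsilon> \<epsilon>'"
  by (simp add: lincobs_def)

lemma lincobs_add: "x \<in> lincobs \<Sigma> \<epsilon> \<epsilon>' \<Longrightarrow> y \<in> lincobs \<Sigma> \<epsilon> \<epsilon>' \<Longrightarrow> x + y \<in> lincobs \<Sigma> \<epsilon> \<epsilon>'"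
  using Poly_Mapping.keys_add[of x y] by (auto simp: lincobs_def)

lemma lincobs_scale: "x \<in> lincobs \<Sigma> \<epsilon> \<epsilon>' \<Longrightarrow> scale a x \<in> lincobs \<Sigma> \<epsilon> \<epsilon>'"
  using keys_scale[of a x] by (auto simp: lincobs_def)

lemma lincobs_uminus: "x \<in> lincobs \<Sigma> \<epsilon> \<epsilon>' \<Longrightarrow> - x \<in> lincobs \<Sigma> \<epsilon> \<epsilon>'"
  unfolding lincobs_def by (simp add: keys_minus)

lemma lincobs_single: "cobordism \<Sigma> \<epsilon> \<epsilon>' c \<Longrightarrow> Poly_Mapping.single c a \<in> lincobs \<Sigma> \<epsilon> \<epsilon>'"
  unfolding lincobs_def by simp

lemma lincobs_linmap:
  assumes "x \<in> lincobs \<Sigma> \<epsilon> \<epsilon>'"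
    and "\<And>c. cobordism \<Sigma> \<epsilon> \<epsilon>' c \<Longrightarrow> cobordism \<Sigma> \<delta> \<delta>' (f c)"
  shows "linmap f x \<in> lincobs \<Sigma> \<delta> \<delta>'"
  using assms keys_linmap[of f x] by (auto simp: lincobs_def)

lemma lincobs_bilinmap:
  assumes "x \<in> lincobs \<Sigma> \<epsilon> \<epsilon>'" "y \<in> lincobs \<Sigma> \<eta> \<eta>'"
    and "\<And>c d. cobordism \<Sigma> \<epsilon> \<epsilon>' c \<Longrightarrow> cobordism \<Sigma> \<eta> \<eta>' d \<Longrightarrow> cobordism \<Sigma> \<delta> \<delta>' (f c d)"
  shows "bilinmap f x y \<in> lincobs \<Sigma> \<delta> \<delta>'"
  using assms keys_bilinmap[of f x y] by (fastforce simp: lincobs_def)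

text \<open>The laws of gluing hold only for genuine cobordisms, not for arbitrary multisets of
  components. This lemma carries such laws over to linear combinations.\<close>

lemma lincobs_cong:
  assumes "x \<in> lincobs \<Sigma> \<epsilon> \<epsilon>'" "\<And>c. cobordism \<Sigma> \<epsilon> \<epsilon>' c \<Longrightarrow> f c = g c"
  shows "linform f x = linform g x"
  using assms by (intro linform_cong) (simp add: lincobs_def)

lemma negligible_lincobs: "x \<in> negligible \<Sigma> \<alpha> \<epsilon> \<epsilon>' \<Longrightarrow> x \<in> lincobs \<Sigma> \<epsilon> \<epsilon>'"
  by (simp add: negligible_def)

lemma negligible_0 [simp]: "0 \<in> negligible \<Sigma> \<alpha> \<epsilon> \<epsilon>'"
  by (simp add: negligible_def)

lemma negligible_add:
  "x \<in> negligible \<Sigma> \<alpha> \<epsilon> \<epsilon>' \<Longrightarrow> y \<in> negligible \<Sigma> \<alpha> \<epsilon> \<epsilon>' \<Longrightarrow> x + y \<in> negligible \<Sigma> \<alpha> \<epsilon> \<epsilon>'"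
  by (simp add: negligible_def lincobs_add)

lemma negligible_scale: "x \<in> negligible \<Sigma> \<alpha> \<epsilon> \<epsilon>' \<Longrightarrow> scale a x \<in> negligible \<Sigma> \<alpha> \<epsilon> \<epsilon>'"
  by (simp add: negligible_def lincobs_scale)

lemma negligible_uminus: "x \<in> negligible \<Sigma> \<alpha> \<epsilon> \<epsilon>' \<Longrightarrow> - x \<in> negligible \<Sigma> \<alpha> \<epsilon> \<epsilon>'"
  by (simp add: negligible_def lincobs_uminus)

lemma negligible_diff:
  "x \<in> negligible \<Sigma> \<alpha> \<epsilon> \<epsilon>' \<Longrightarrow> y \<in> negligible \<Sigma> \<alpha> \<epsilon> \<epsilon>' \<Longrightarrow> x - y \<in> negligible \<Sigma> \<alpha> \<epsilon> \<epsilon>'"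
  using negligible_add[OF _ negligible_uminus] by fastforce

lemma hom_coset_self: "x \<in> hom_coset \<Sigma> \<alpha> \<epsilon> \<epsilon>' x"
  unfolding hom_coset_def by (force intro: exI[of _ 0])

lemma hom_coset_iff: "y \<in> hom_coset \<Sigma> \<alpha> \<epsilon> \<epsilon>' x \<longleftrightarrow> y - x \<in> negligible \<Sigma> \<alpha> \<epsilon> \<epsilon>'"
  unfolding hom_coset_def by (auto intro: exI[of _ "y - x"])

lemma hom_coset_eq_iff:
  "hom_coset \<Sigma> \<alpha> \<epsilon> \<epsilon>' x = hom_coset \<Sigma> \<alpha> \<epsilon> \<epsilon>' y \<longleftrightarrow> x - y \<in> negligible \<Sigma> \<alpha> \<epsilon> \<epsilon>'"
proof
  assume "hom_coset \<Sigma> \<alpha> \<epsilon> \<epsilon>' x = hom_coset \<Sigma> \<alpha> \<epsilon> \<epsilon>' y"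
  then show "x - y \<in> negligible \<Sigma> \<alpha> \<epsilon> \<epsilon>'"
    using hom_coset_self hom_coset_iff by blast
next
  assume xy: "x - y \<in> negligible \<Sigma> \<alpha> \<epsilon> \<epsilon>'"
  have "z - x \<in> negligible \<Sigma> \<alpha> \<epsilon> \<epsilon>' \<longleftrightarrow> z - y \<in> negligible \<Sigma> \<alpha> \<epsilon> \<epsilon>'" for z
    using negligible_add[OF xy, of "z - x"] negligible_diff[OF _ xy, of "z - y"] by auto
  then show "hom_coset \<Sigma> \<alpha> \<epsilon> \<epsilon>' x = hom_coset \<Sigma> \<alpha> \<epsilon> \<epsilon>' y"
    by (auto simp: hom_coset_iff)
qed

text \<open>A coset is nonempty, so the union of a family that is constant on it is that constant.
  Every operation on cosets is evaluated through this, at the price of proving constancy.\<close>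

lemma hom_coset_UN:
  assumes "\<And>y. y - x \<in> negligible \<Sigma> \<alpha> \<epsilon> \<epsilon>' \<Longrightarrow> f y = C"
  shows "(\<Union>y\<in>hom_coset \<Sigma> \<alpha> \<epsilon> \<epsilon>' x. f y) = C"
proof -
  have "(\<Union>y\<in>hom_coset \<Sigma> \<alpha> \<epsilon> \<epsilon>' x. f y) = (\<Union>y\<in>hom_coset \<Sigma> \<alpha> \<epsilon> \<epsilon>' x. C)"
    by (rule SUP_cong) (simp_all add: assms hom_coset_iff)
  moreover have "hom_coset \<Sigma> \<alpha> \<epsilon> \<epsilon>' x \<noteq> {}"
    using hom_coset_self by (metis empty_iff)
  ultimately show ?thesis
    by simp
qed

lemma Hom_add:
  "hom_coset \<Sigma> \<alpha> \<epsilon> \<epsilon>' x \<oplus>\<^bsub>Hom \<Sigma> \<alpha> \<epsilon> \<epsilon>'\<^esub> hom_coset \<Sigma> \<alpha> \<epsilon> \<epsilon>' y = hom_coset \<Sigma> \<alpha> \<epsilon> \<epsilon>' (x + y)"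
  unfolding Hom_def
  by (simp, intro hom_coset_UN)
     (simp only: hom_coset_eq_iff add_diff_add_eq negligible_add)

lemma Hom_smult:
  "a \<odot>\<^bsub>Hom \<Sigma> \<alpha> \<epsilon> \<epsilon>'\<^esub> hom_coset \<Sigma> \<alpha> \<epsilon> \<epsilon>' x = hom_coset \<Sigma> \<alpha> \<epsilon> \<epsilon>' (scale a x)"
proof -
  have "scale a y - scale a x = scale a (y - x)" for y
    by (rule lincob_eqI) (simp add: algebra_simps)
  then show ?thesis
    unfolding Hom_def
    by (simp, intro hom_coset_UN) (simp only: hom_coset_eq_iff negligible_scale)
qed

lemma Hom_zero: "\<zero>\<^bsub>Hom \<Sigma> \<alpha> \<epsilon> \<epsilon>'\<^esub> = hom_coset \<Sigma> \<alpha> \<epsilon> \<epsilon>' 0"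
  and Hom_carrier: "carrier (Hom \<Sigma> \<alpha> \<epsilon> \<epsilon>') = hom_coset \<Sigma> \<alpha> \<epsilon> \<epsilon>' ` lincobs \<Sigma> \<epsilon> \<epsilon>'"
  by (simp_all add: Hom_def)

lemma cring_scalars: "cring (scalars :: 'k::field ring)"
proof -
  have "\<exists>y. x + y = 0" for x :: 'k
    by (rule exI[of _ "- x"]) simp
  then have "abelian_group (scalars :: 'k ring)"
    unfolding scalars_def by (intro abelian_groupI) (auto simp: ac_simps)
  moreover have "Group.comm_monoid (scalars :: 'k ring)"
    by (rule comm_monoidI) (simp_all add: scalars_def ac_simps)
  ultimately show ?thesis
    by (rule cringI) (simp_all add: scalars_def distrib_right)
qed

lemma scale_assoc: "scale (a * b) x = scale a (scale b x)"
  and scale_add_left: "scale (a + b) x = scale a x + scale b x"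
  and scale_add_right: "scale a (x + y) = scale a x + scale a y"
  and scale_one: "scale 1 x = x"
  by (rule lincob_eqI; simp add: distrib_right distrib_left mult.assoc)+

lemma module_Hom: "Module.module scalars (Hom \<Sigma> \<alpha> \<epsilon> \<epsilon>')"
proof (rule module.intro[OF cring_scalars])
  show "abelian_group (Hom \<Sigma> \<alpha> \<epsilon> \<epsilon>')"
  proof (rule abelian_groupI)
    fix x assume "x \<in> carrier (Hom \<Sigma> \<alpha> \<epsilon> \<epsilon>')"
    then obtain y where "y \<in> lincobs \<Sigma> \<epsilon> \<epsilon>'" "x = hom_coset \<Sigma> \<alpha> \<epsilon> \<epsilon>' y"
      by (auto simp: Hom_carrier)
    then show "\<exists>y\<in>carrier (Hom \<Sigma> \<alpha> \<epsilon> \<epsilon>'). y \<oplus>\<^bsub>Hom \<Sigma> \<alpha> \<epsilon> \<epsilon>'\<^esub> x = \<zero>\<^bsub>Hom \<Sigma> \<alpha> \<epsilon> \<epsilon>'\<^esub>"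
      by (intro bexI[of _ "hom_coset \<Sigma> \<alpha> \<epsilon> \<epsilon>' (- y)"])
         (auto simp: Hom_add Hom_zero Hom_carrier lincobs_uminus)
  qed (auto simp: Hom_carrier Hom_add Hom_zero ac_simps intro!: imageI lincobs_add)
  show "module_axioms scalars (Hom \<Sigma> \<alpha> \<epsilon> \<epsilon>')"
    by unfold_locales
       (auto simp: Hom_carrier Hom_add Hom_smult scalars_def lincobs_scale
        scale_assoc scale_add_left scale_add_right scale_one)
qed

section \<open>Normal forms of cobordisms\<close>

text \<open>The part of a cobordism that touches one start point \<open>s\<close> and one end point \<open>e\<close>: either a
  strand from \<open>s\<close> to \<open>e\<close>, or the strand has been cut and leaves two half-intervals.\<close>

datatype 's strand = Arc "'s list" | Cut "'s list" "'s list"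

fun strand_cob :: "point \<Rightarrow> point \<Rightarrow> 's strand \<Rightarrow> 's cob" where
  "strand_cob s e (Arc w) = {#Ival (Some s) w (Some e)#}"
| "strand_cob s e (Cut u v) = {#Ival None u (Some e), Ival (Some s) v None#}"

fun strand_in :: "'s set \<Rightarrow> 's strand \<Rightarrow> bool" where
  "strand_in \<Sigma> (Arc w) \<longleftrightarrow> w \<in> lists \<Sigma>"
| "strand_in \<Sigma> (Cut u v) \<longleftrightarrow> u \<in> lists \<Sigma> \<and> v \<in> lists \<Sigma>"

text \<open>The left factor lies on top. Words are read from head to tail, against the orientation,
  so the word of the upper strand comes in front. With two cuts the inner halves form a floating
  interval, which \<open>strand_float\<close> records.\<close>

fun strand_mult :: "'s strand \<Rightarrow> 's strand \<Rightarrow> 's strand" where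
  "strand_mult (Arc w) (Arc w') = Arc (w @ w')"
| "strand_mult (Arc w) (Cut u v) = Cut (w @ u) v"
| "strand_mult (Cut u v) (Arc w) = Cut u (v @ w)"
| "strand_mult (Cut u v) (Cut u' v') = Cut u v'"

text \<open>The floating intervals that are split off by the operations on strands.\<close>

fun strand_float :: "'s strand \<Rightarrow> 's strand \<Rightarrow> 's cob" where
  "strand_float (Cut u v) (Cut u' v') = {#Ival None (v @ u') None#}"
| "strand_float _ _ = {#}"

fun strand_act :: "'s strand \<Rightarrow> 's list \<Rightarrow> 's list" where
  "strand_act (Arc w) u = w @ u"
| "strand_act (Cut a b) u = a"

fun act_float :: "'s strand \<Rightarrow> 's list \<Rightarrow> 's cob" where
  "act_float (Arc w) u = {#}"
| "act_float (Cut a b) u = {#Ival None (b @ u) None#}"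

text \<open>The right action on half-intervals in A(-). It is adjoint to \<open>strand_act\<close>
  under the pairing once the split-off intervals are counted on both sides.\<close>

fun strand_ract :: "'s list \<Rightarrow> 's strand \<Rightarrow> 's list" where
  "strand_ract v (Arc w) = v @ w"
| "strand_ract v (Cut a b) = b"

fun ract_float :: "'s list \<Rightarrow> 's strand \<Rightarrow> 's cob" where
  "ract_float v (Arc w) = {#}"
| "ract_float v (Cut a b) = {#Ival None (v @ a) None#}"

fun strand_close :: "'s strand \<Rightarrow> 's cob" where
  "strand_close (Arc w) = {#Circ (abs_cyc_word w)#}"
| "strand_close (Cut u v) = {#Ival None (v @ u) None#}"

definition closed_cob :: "'s set \<Rightarrow> 's cob \<Rightarrow> bool" where
  "closed_cob \<Sigma> F \<longleftrightarrow> (\<forall>s\<in>#F. labelled_in \<Sigma> s \<and> tail_of s = None \<and> head_of s = None)"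

text \<open>The filters that define a cobordism are stated with \<open>\<noteq> None\<close>; the
  conditions must keep this form for equations between filtered multisets to apply.\<close>

declare not_None_eq [simp del]

section \<open>Splitting a cobordism into its strand and its closed components\<close>

lemma image_mset_eq_single: "image_mset f M = {#y#} \<Longrightarrow> \<exists>x. M = {#x#} \<and> f x = y"
  by (cases M) (auto simp: add_mset_eq_single)

lemma filter_mset_split: "{#s \<in># c. P s#} = A \<Longrightarrow> c = A + {#s \<in># c. \<not> P s#}"
  using multiset_partition[of c P] by simp

lemma tails_filter:
  "{#t \<in># image_mset f c. t \<noteq> None#} = image_mset f {#s \<in># c. f s \<noteq> None#}"
  by (induction c) auto

lemma tails_empty: "{#t \<in># image_mset f c. t \<noteq> None#} = {#} \<longleftrightarrow> (\<forall>s\<in>#c. f s = None)"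
  by (induction c) auto

lemma cobordism_alt:
  "cobordism \<Sigma> \<epsilon> \<epsilon>' c \<longleftrightarrow>
     (\<forall>s \<in># c. labelled_in \<Sigma> s) \<and>
     image_mset tail_of {#s \<in># c. tail_of s \<noteq> None#} = mset_set (Some ` start_points \<epsilon> \<epsilon>') \<and>
     image_mset head_of {#s \<in># c. head_of s \<noteq> None#} = mset_set (Some ` end_points \<epsilon> \<epsilon>')"
  unfolding cobordism_def tails_filter ..

lemma start_points_simps [simp]:
  "start_points [] [] = {}" "end_points [] [] = {}"
  "start_points [] [Plus] = {}" "end_points [] [Plus] = {Top 0}"
  "start_points [] [Minus] = {Top 0}" "end_points [] [Minus] = {}"
  "start_points [Plus] [] = {Bot 0}" "end_points [Plus] [] = {}"
  "start_points [Minus] [] = {}" "end_points [Minus] [] = {Bot 0}"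
  "start_points [Plus] [Plus] = {Bot 0}" "end_points [Plus] [Plus] = {Top 0}"
  "start_points [] [Plus, Minus] = {Top 1}" "end_points [] [Plus, Minus] = {Top 0}"
  "start_points [Plus, Minus] [] = {Bot 0}" "end_points [Plus, Minus] [] = {Bot 1}"
  by (auto simp: start_points_def end_points_def less_Suc_eq nth_Cons' split: if_splits)

lemma closed_cob_add [simp]: "closed_cob \<Sigma> (F + G) \<longleftrightarrow> closed_cob \<Sigma> F \<and> closed_cob \<Sigma> G"
  by (auto simp: closed_cob_def)

lemma closed_cob_empty [simp]: "closed_cob \<Sigma> {#}"
  by (simp add: closed_cob_def)

text \<open>Exactly one component has an outer tail and exactly one has an outer head. They coincide
  or they are two half-intervals, and the rest is closed. The points are left open because
  cobordisms into \<open>+-\<close>, out of \<open>+-\<close> and from \<open>+\<close> to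
  \<open>+\<close> all have this shape.\<close>

lemma cobordism_strand:
  assumes S: "start_points \<epsilon> \<epsilon>' = {s}" and E: "end_points \<epsilon> \<epsilon>' = {e}"
  shows "cobordism \<Sigma> \<epsilon> \<epsilon>' c \<longleftrightarrow>
    (\<exists>K F. c = strand_cob s e K + F \<and> strand_in \<Sigma> K \<and> closed_cob \<Sigma> F)"
proof
  assume "cobordism \<Sigma> \<epsilon> \<epsilon>' c"
  then have lab: "\<forall>s\<in>#c. labelled_in \<Sigma> s"
    and t: "image_mset tail_of {#s \<in># c. tail_of s \<noteq> None#} = {#Some s#}"
    and h: "image_mset head_of {#s \<in># c. head_of s \<noteq> None#} = {#Some e#}"
    by (simp_all add: cobordism_alt S E)
  from t obtain a where a: "{#s \<in># c. tail_of s \<noteq> None#} = {#a#}" "tail_of a = Some s"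
    by (auto dest!: image_mset_eq_single)
  from h obtain b where b: "{#s \<in># c. head_of s \<noteq> None#} = {#b#}" "head_of b = Some e"
    by (auto dest!: image_mset_eq_single)
  have ac: "a \<in># c" and bc: "b \<in># c"
    using arg_cong[OF a(1), of "\<lambda>M. a \<in># M"] arg_cong[OF b(1), of "\<lambda>M. b \<in># M"] by simp_all
  define F where "F = {#s \<in># c. tail_of s = None \<and> head_of s = None#}"
  have F: "closed_cob \<Sigma> F"
    using lab by (auto simp: F_def closed_cob_def)
  have c: "c = {#a#} + {#s \<in># c. tail_of s = None#}"
    using filter_mset_split[OF a(1)] by (simp only: not_not)
  show "\<exists>K F. c = strand_cob s e K + F \<and> strand_in \<Sigma> K \<and> closed_cob \<Sigma> F"
  \<comment> \<open>The component starting at \<open>s\<close> either ends at an outer point, and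
    then it is also the component \<open>b\<close> ending at \<open>e\<close>, or it ends inside,
    and then \<open>b\<close> is a second component.\<close>
  proof (cases "head_of a = None")
    case False
    then have "a \<in># {#s \<in># c. head_of s \<noteq> None#}" using ac by simp
    then have ab: "a = b" using b by simp
    have "head_of s' = None" if "s' \<in># {#s \<in># c. tail_of s = None#}" for s'
    proof (rule ccontr)
      assume "head_of s' \<noteq> None"
      then have "s' \<in># {#s \<in># c. head_of s \<noteq> None#}" using that by simp
      then show False using that b ab a by simp
    qed
    then have "{#s \<in># c. tail_of s = None#} = F"
      unfolding F_def by (intro filter_mset_cong) auto
    moreover obtain w where "a = Ival (Some s) w (Some e)"
      using a b ab by (cases a) auto
    ultimately have "c = strand_cob s e (Arc w) + F" "strand_in \<Sigma> (Arc w)"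
      using c lab ac by auto
    then show ?thesis using F by blast
  next
    case True
    \<comment> \<open>As \<open>a\<close> has an inner head, removing it does not affect the
      components with an outer head, so \<open>b\<close> can be split off from the
      remainder.\<close>
    have "{#s \<in># c. head_of s \<noteq> None#} = {#s \<in># {#s \<in># c. tail_of s = None#}. head_of s \<noteq> None#}"
      using True by (subst c) simp
    then have "{#s \<in># {#s \<in># c. tail_of s = None#}. head_of s \<noteq> None#} = {#b#}"
      using b(1) by (simp only:)
    from filter_mset_split[OF this] have "{#s \<in># c. tail_of s = None#} = {#b#} + F"
      by (simp only: F_def filter_filter_mset not_not conj_commute)
    with c have cb: "c = {#a, b#} + F" by (simp only:) simp
    obtain v where av: "a = Ival (Some s) v None"
      using a True by (cases a) auto
    have "b \<in># {#s \<in># c. tail_of s = None#}"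
      using \<open>{#s \<in># c. tail_of s = None#} = {#b#} + F\<close> by simp
    then obtain u where bu: "b = Ival None u (Some e)"
      using b by (cases b) auto
    have "c = strand_cob s e (Cut u v) + F" "strand_in \<Sigma> (Cut u v)"
      using cb av bu lab ac bc by auto
    then show ?thesis using F by blast
  qed
next
  assume "\<exists>K F. c = strand_cob s e K + F \<and> strand_in \<Sigma> K \<and> closed_cob \<Sigma> F"
  then obtain K F where c: "c = strand_cob s e K + F" "strand_in \<Sigma> K" and F: "closed_cob \<Sigma> F"
    by blast
  from F have "{#t \<in># image_mset tail_of F. t \<noteq> None#} = {#}" "{#t \<in># image_mset head_of F. t \<noteq> None#} = {#}"
    by (simp_all only: tails_empty closed_cob_def) auto
  then show "cobordism \<Sigma> \<epsilon> \<epsilon>' c"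
    using c F by (cases K) (auto simp: cobordism_def S E closed_cob_def)
qed

text \<open>Without outer tails the component at \<open>e\<close> must begin inside. This covers
  A(+) as well as the cobordisms from \<open>-\<close> to the empty sequence that test A(-).\<close>

lemma cobordism_head:
  assumes S: "start_points \<epsilon> \<epsilon>' = {}" and E: "end_points \<epsilon> \<epsilon>' = {e}"
  shows "cobordism \<Sigma> \<epsilon> \<epsilon>' c \<longleftrightarrow>
    (\<exists>u F. c = {#Ival None u (Some e)#} + F \<and> u \<in> lists \<Sigma> \<and> closed_cob \<Sigma> F)"
proof
  assume "cobordism \<Sigma> \<epsilon> \<epsilon>' c"
  then have lab: "\<forall>s\<in>#c. labelled_in \<Sigma> s" and t: "\<forall>s\<in>#c. tail_of s = None"
    and h: "image_mset head_of {#s \<in># c. head_of s \<noteq> None#} = {#Some e#}"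
    by (auto simp: cobordism_alt S E)
  from h obtain b where b: "{#s \<in># c. head_of s \<noteq> None#} = {#b#}" "head_of b = Some e"
    by (auto dest!: image_mset_eq_single)
  define F where "F = {#s \<in># c. head_of s = None#}"
  have c: "c = {#b#} + F"
    using filter_mset_split[OF b(1)] by (simp only: F_def not_not)
  then have "b \<in># c" by simp
  then obtain u where "b = Ival None u (Some e)" "u \<in> lists \<Sigma>"
    using b bspec[OF t \<open>b \<in># c\<close>] bspec[OF lab \<open>b \<in># c\<close>] by (cases b) auto
  moreover have "closed_cob \<Sigma> F"
    using lab t by (auto simp: F_def closed_cob_def)
  ultimately show "\<exists>u F. c = {#Ival None u (Some e)#} + F \<and> u \<in> lists \<Sigma> \<and> closed_cob \<Sigma> F"
    using c by blast
next
  assume "\<exists>u F. c = {#Ival None u (Some e)#} + F \<and> u \<in> lists \<Sigma> \<and> closed_cob \<Sigma> F"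
  then obtain u F where c: "c = {#Ival None u (Some e)#} + F" "u \<in> lists \<Sigma>" and F: "closed_cob \<Sigma> F"
    by blast
  from F have "{#t \<in># image_mset tail_of F. t \<noteq> None#} = {#}" "{#t \<in># image_mset head_of F. t \<noteq> None#} = {#}"
    by (simp_all only: tails_empty closed_cob_def) auto
  then show "cobordism \<Sigma> \<epsilon> \<epsilon>' c"
    using c F by (auto simp: cobordism_def S E closed_cob_def)
qed

text \<open>The mirror image, for A(-) and for the cobordisms from \<open>+\<close> to the empty
  sequence that test A(+).\<close>

lemma cobordism_tail:
  assumes S: "start_points \<epsilon> \<epsilon>' = {s}" and E: "end_points \<epsilon> \<epsilon>' = {}"
  shows "cobordism \<Sigma> \<epsilon> \<epsilon>' c \<longleftrightarrow>
    (\<exists>v F. c = {#Ival (Some s) v None#} + F \<and> v \<in> lists \<Sigma> \<and> closed_cob \<Sigma> F)"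
proof
  assume "cobordism \<Sigma> \<epsilon> \<epsilon>' c"
  then have lab: "\<forall>s\<in>#c. labelled_in \<Sigma> s" and h: "\<forall>s\<in>#c. head_of s = None"
    and t: "image_mset tail_of {#s \<in># c. tail_of s \<noteq> None#} = {#Some s#}"
    by (auto simp: cobordism_alt S E)
  from t obtain b where b: "{#s \<in># c. tail_of s \<noteq> None#} = {#b#}" "tail_of b = Some s"
    by (auto dest!: image_mset_eq_single)
  define F where "F = {#s \<in># c. tail_of s = None#}"
  have c: "c = {#b#} + F"
    using filter_mset_split[OF b(1)] by (simp only: F_def not_not)
  then have "b \<in># c" by simp
  then obtain v where "b = Ival (Some s) v None" "v \<in> lists \<Sigma>"
    using b bspec[OF h \<open>b \<in># c\<close>] bspec[OF lab \<open>b \<in># c\<close>] by (cases b) auto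
  moreover have "closed_cob \<Sigma> F"
    using lab h by (auto simp: F_def closed_cob_def)
  ultimately show "\<exists>v F. c = {#Ival (Some s) v None#} + F \<and> v \<in> lists \<Sigma> \<and> closed_cob \<Sigma> F"
    using c by blast
next
  assume "\<exists>v F. c = {#Ival (Some s) v None#} + F \<and> v \<in> lists \<Sigma> \<and> closed_cob \<Sigma> F"
  then obtain v F where c: "c = {#Ival (Some s) v None#} + F" "v \<in> lists \<Sigma>" and F: "closed_cob \<Sigma> F"
    by blast
  from F have "{#t \<in># image_mset tail_of F. t \<noteq> None#} = {#}" "{#t \<in># image_mset head_of F. t \<noteq> None#} = {#}"
    by (simp_all only: tails_empty closed_cob_def) auto
  then show "cobordism \<Sigma> \<epsilon> \<epsilon>' c"
    using c F by (auto simp: cobordism_def S E closed_cob_def)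
qed

section \<open>Relabelling and gluing of normal forms\<close>

lemma relabel_closed [simp]: "closed_cob \<Sigma> F \<Longrightarrow> relabel f F = F"
  unfolding relabel_def closed_cob_def
proof (induction F)
  case (add s F)
  then show ?case by (cases s) auto
qed simp

lemma relabel_add [simp]: "relabel f (c + d) = relabel f c + relabel f d"
  and relabel_add_mset [simp]: "relabel f (add_mset s c) = add_mset (relabel_component f s) (relabel f c)"
  and relabel_empty [simp]: "relabel f {#} = {#}"
  by (simp_all add: relabel_def)

lemma relabel_strand_cob [simp]: "relabel f (strand_cob s e K) = strand_cob (f s) (f e) K"
  by (cases K) auto

text \<open>Closed components have no end at \<open>p\<close>, so all of them survive the filter and
  none takes part in a joined pair.\<close>

lemma glue_add_closed: "closed_cob \<Sigma> F \<Longrightarrow> glue p (c + F) = glue p c + F"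
proof -
  assume F: "closed_cob \<Sigma> F"
  then have "{#s \<in># F. head_of s \<noteq> Some p \<and> tail_of s \<noteq> Some p#} = F"
    by (subst filter_mset_eq_conv) (auto simp: closed_cob_def)
  moreover have "{#s \<in># F. head_of s = Some p#} = {#}" "{#s \<in># F. tail_of s = Some p#} = {#}"
    using F by (auto simp: closed_cob_def)
  ultimately show ?thesis
    unfolding glue_def filter_union_mset by (simp only: add_0_right) (simp only: ac_simps)
qed

text \<open>\<open>K\<close> starts at \<open>p\<close> and \<open>K'\<close> ends there. The
  hypotheses on \<open>s\<close> and \<open>e\<close> exclude the branch of \<open>join\<close> that
  creates a circle; that branch is the subject of \<open>glue_strand_close\<close>.\<close>

lemma glue_strands:
  "s \<noteq> p \<Longrightarrow> e \<noteq> p \<Longrightarrow> glue p (strand_cob p e K + strand_cob s p K') =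
     strand_cob s e (strand_mult K K') + strand_float K K'"
  by (cases K; cases K') (auto simp: glue_def)

lemma glue_strand_close: "glue p (strand_cob p p K) = strand_close K"
  by (cases K) (auto simp: glue_def)

lemma glue_act:
  "e \<noteq> p \<Longrightarrow> glue p (strand_cob p e K + {#Ival None u (Some p)#}) =
     {#Ival None (strand_act K u) (Some e)#} + act_float K u"
  by (cases K) (auto simp: glue_def)

lemma glue_pair: "glue p {#Ival (Some p) v None, Ival None u (Some p)#} = {#Ival None (v @ u) None#}"
  by (auto simp: glue_def)

lemma closed_floats [simp]:
  "strand_in \<Sigma> K \<Longrightarrow> strand_in \<Sigma> K' \<Longrightarrow> closed_cob \<Sigma> (strand_float K K')"
  "strand_in \<Sigma> K \<Longrightarrow> u \<in> lists \<Sigma> \<Longrightarrow> closed_cob \<Sigma> (act_float K u)"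
  "strand_in \<Sigma> K \<Longrightarrow> v \<in> lists \<Sigma> \<Longrightarrow> closed_cob \<Sigma> (ract_float v K)"
  "strand_in \<Sigma> K \<Longrightarrow> closed_cob \<Sigma> (strand_close K)"
  by (cases K; cases K'; auto simp: closed_cob_def)+

lemma strand_in_simps [simp]:
  "strand_in \<Sigma> K \<Longrightarrow> strand_in \<Sigma> K' \<Longrightarrow> strand_in \<Sigma> (strand_mult K K')"
  "strand_in \<Sigma> K \<Longrightarrow> u \<in> lists \<Sigma> \<Longrightarrow> strand_act K u \<in> lists \<Sigma>"
  "strand_in \<Sigma> K \<Longrightarrow> v \<in> lists \<Sigma> \<Longrightarrow> strand_ract v K \<in> lists \<Sigma>"
  by (cases K; cases K'; auto)+

lemmas cobordism_plus = cobordism_head[OF start_points_simps(3,4)]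
  and cobordism_minus = cobordism_tail[OF start_points_simps(5,6)]
  and cobordism_plus_dual = cobordism_tail[OF start_points_simps(7,8)]
  and cobordism_minus_dual = cobordism_head[OF start_points_simps(9,10)]
  and cobordism_plus_plus = cobordism_strand[OF start_points_simps(11,12)]
  and cobordism_pm = cobordism_strand[OF start_points_simps(13,14)]
  and cobordism_pm_dual = cobordism_strand[OF start_points_simps(15,16)]

text \<open>Labels such as \<open>Top 1\<close> and counts such as \<open>glue_mid 1\<close> are
  matched literally from here on.\<close>

declare One_nat_def [simp del]

text \<open>The property of circle words that makes the trace of a product of two uncut strands
  symmetric.\<close>

lemma abs_cyc_word_append: "abs_cyc_word (u @ v) = abs_cyc_word (v @ u)"
  by (rule Quotient3_rel_abs[OF Quotient3_cyc_word]) (auto simp: cyc_eq_def)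

section \<open>Operations on cobordisms into \<open>+-\<close>\<close>

abbreviation bend :: "point \<Rightarrow> point" where
  "bend \<equiv> id (Top 1 := Bot 0)"

abbreviation unbend :: "point \<Rightarrow> point" where
  "unbend \<equiv> id (Bot 0 := Top 1)"

text \<open>The product of \<open>A_pm\<close> before any passage to cosets. At this level
  associativity and the unit laws are equations between multisets of components, independent of
  \<alpha>.\<close>

definition pm_mult :: "'s cob \<Rightarrow> 's cob \<Rightarrow> 's cob" where
  "pm_mult c d = relabel unbend (stack 1 (relabel bend c) (relabel bend d))"

definition pm_act :: "'s cob \<Rightarrow> 's cob \<Rightarrow> 's cob" where
  "pm_act c v = stack 1 (relabel bend c) v"

text \<open>Sending every outer point to \<open>Mid 0\<close> places the head at
  \<open>Top 0\<close> and the tail at \<open>Top 1\<close> on the two sides of a single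
  gluing.\<close>

definition pm_trace :: "('s, 'k::field) evaluation \<Rightarrow> 's cob \<Rightarrow> 'k" where
  "pm_trace \<alpha> c = eval_cob \<alpha> (glue_mid 1 (relabel (\<lambda>p. Mid 0) c))"

text \<open>Both half-intervals touch \<open>Top 0\<close>, one with its tail and the other with its
  head, so their plain sum is ready to be glued without a shift.\<close>

definition cob_pairing :: "('s, 'k::field) evaluation \<Rightarrow> 's cob \<Rightarrow> 's cob \<Rightarrow> 'k" where
  "cob_pairing \<alpha> w v = eval_cob \<alpha> (glue_mid 1 (relabel top_to_mid (w + v)))"

abbreviation pm_strand :: "'s strand \<Rightarrow> 's cob" where
  "pm_strand \<equiv> strand_cob (Top 1) (Top 0)"

abbreviation head_cob :: "'s list \<Rightarrow> 's cob" where
  "head_cob u \<equiv> {#Ival None u (Some (Top 0))#}"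

abbreviation tail_cob :: "'s list \<Rightarrow> 's cob" where
  "tail_cob v \<equiv> {#Ival (Some (Top 0)) v None#}"

lemma pm_cobE:
  assumes "cobordism \<Sigma> [] [Plus, Minus] c"
  obtains K F where "c = pm_strand K + F" "strand_in \<Sigma> K" "closed_cob \<Sigma> F"
  using assms unfolding cobordism_pm by blast

lemma plus_cobE:
  assumes "cobordism \<Sigma> [] [Plus] c"
  obtains u F where "c = head_cob u + F" "u \<in> lists \<Sigma>" "closed_cob \<Sigma> F"
  using assms unfolding cobordism_plus by blast

lemma minus_cobE:
  assumes "cobordism \<Sigma> [] [Minus] c"
  obtains v F where "c = tail_cob v + F" "v \<in> lists \<Sigma>" "closed_cob \<Sigma> F"
  using assms unfolding cobordism_minus by blast

lemma cobordism_pm_strand [intro]: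
  "strand_in \<Sigma> K \<Longrightarrow> closed_cob \<Sigma> F \<Longrightarrow> cobordism \<Sigma> [] [Plus, Minus] (pm_strand K + F)"
  unfolding cobordism_pm by blast

lemma cobordism_head_cob [intro]:
  "u \<in> lists \<Sigma> \<Longrightarrow> closed_cob \<Sigma> F \<Longrightarrow> cobordism \<Sigma> [] [Plus] (head_cob u + F)"
  unfolding cobordism_plus by blast

lemma cobordism_tail_cob [intro]:
  "v \<in> lists \<Sigma> \<Longrightarrow> closed_cob \<Sigma> F \<Longrightarrow> cobordism \<Sigma> [] [Minus] (tail_cob v + F)"
  unfolding cobordism_minus by blast

lemma eval_cob_add [simp]: "eval_cob \<alpha> (c + d) = eval_cob \<alpha> c * eval_cob \<alpha> d"
  and eval_cob_empty [simp]: "eval_cob \<alpha> {#} = 1"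
  by (simp_all add: eval_cob_def)

lemma eval_cob_single [simp]:
  "eval_cob \<alpha> {#Ival t w h#} = fst \<alpha> w" "eval_cob \<alpha> {#Circ z#} = snd \<alpha> z"
  by (simp_all add: eval_cob_def)

lemma eval_cob_add_mset [simp]: "eval_cob \<alpha> (add_mset s c) = eval_component \<alpha> s * eval_cob \<alpha> c"
  by (simp add: eval_cob_def)

lemma glue_mid_simps [simp]:
  "glue_mid 0 c = c"
  "glue_mid 1 c = glue (Mid 0) c"
  "glue_mid 2 c = glue (Mid 1) (glue (Mid 0) c)"
  by (simp_all add: glue_mid_def numeral_2_eq_2 One_nat_def)

lemma glue_strands_closed:
  assumes "closed_cob \<Sigma> F" "closed_cob \<Sigma> F'" "s \<noteq> p" "e \<noteq> p"
  shows "glue p (strand_cob s p K' + F' + (strand_cob p e K + F)) =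
    strand_cob s e (strand_mult K K') + (strand_float K K' + F + F')"
proof -
  have "glue p (strand_cob s p K' + F' + (strand_cob p e K + F)) =
      glue p (strand_cob p e K + strand_cob s p K' + (F + F'))"
    by (simp only: ac_simps)
  also have "\<dots> = glue p (strand_cob p e K + strand_cob s p K') + (F + F')"
    by (rule glue_add_closed) (use assms in simp)
  finally show ?thesis
    by (simp only: glue_strands[OF assms(3,4)] ac_simps)
qed

lemma glue_strand_close_closed:
  "closed_cob \<Sigma> F \<Longrightarrow> glue p (strand_cob p p K + F) = strand_close K + F"
  by (simp only: glue_add_closed glue_strand_close)

lemma glue_act_closed:
  assumes "closed_cob \<Sigma> F" "closed_cob \<Sigma> F'" "e \<noteq> p"
  shows "glue p ({#Ival None u (Some p)#} + F' + (strand_cob p e K + F)) =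
    {#Ival None (strand_act K u) (Some e)#} + (act_float K u + F + F')"
proof -
  have "glue p ({#Ival None u (Some p)#} + F' + (strand_cob p e K + F)) =
      glue p (strand_cob p e K + {#Ival None u (Some p)#} + (F + F'))"
    by (simp only: ac_simps)
  also have "\<dots> = glue p (strand_cob p e K + {#Ival None u (Some p)#}) + (F + F')"
    by (rule glue_add_closed) (use assms in simp)
  finally show ?thesis
    by (simp only: glue_act[OF assms(3)] ac_simps)
qed

lemma glue_pair_closed:
  assumes "closed_cob \<Sigma> F" "closed_cob \<Sigma> F'"
  shows "glue p ({#Ival (Some p) v None#} + F + ({#Ival None u (Some p)#} + F')) =
      {#Ival None (v @ u) None#} + (F + F')"
    (is "?a = _")
    and "glue p ({#Ival None u (Some p)#} + F' + ({#Ival (Some p) v None#} + F)) =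
      {#Ival None (v @ u) None#} + (F + F')"
    (is "?b = _")
proof -
  have "?a = glue p ({#Ival (Some p) v None, Ival None u (Some p)#} + (F + F'))"
    by (rule arg_cong[where f = "glue p"]) simp
  also have "\<dots> = glue p {#Ival (Some p) v None, Ival None u (Some p)#} + (F + F')"
    by (rule glue_add_closed) (use assms in simp)
  finally show "?a = {#Ival None (v @ u) None#} + (F + F')"
    by (simp only: glue_pair)
  then show "?b = {#Ival None (v @ u) None#} + (F + F')"
    by (simp only: ac_simps)
qed

context
  fixes \<Sigma> :: "'s set" and F F' :: "'s cob"
  assumes F: "closed_cob \<Sigma> F" and F': "closed_cob \<Sigma> F'"
begin

lemma relabel_float: "relabel f (strand_float K K') = strand_float K K'"
  by (cases K; cases K') auto

lemma relabel_strand_close: "relabel f (strand_close K) = strand_close K"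
  by (cases K) auto

lemma relabel_single: "relabel f {#s#} = {#relabel_component f s#}"
  by simp

text \<open>Used with \<open>simp only\<close>: full simplification would turn the sums into nested
  \<open>add_mset\<close> and destroy the shape, strand plus closed part, on which the gluing lemmas
  match.\<close>

lemmas relabel_rules = relabel_add relabel_single relabel_component.simps option.map
  relabel_strand_cob relabel_closed[OF F] relabel_closed[OF F'] relabel_float relabel_strand_close
  top_to_mid.simps bot_to_mid.simps id_apply fun_upd_apply point.simps if_True if_False o_apply
  zero_neq_one one_neq_zero glue_mid_simps simp_thms

lemma pm_mult_strand:
  "pm_mult (pm_strand K + F) (pm_strand K' + F') =
     pm_strand (strand_mult K K') + (strand_float K K' + F + F')"
  unfolding pm_mult_def stack_def
  by (simp only: relabel_rules glue_strands_closed[OF F F'])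

lemma stack_plus_plus:
  "stack 1 (strand_cob (Bot 0) (Top 0) K + F) (strand_cob (Bot 0) (Top 0) K' + F') =
     strand_cob (Bot 0) (Top 0) (strand_mult K K') + (strand_float K K' + F + F')"
  unfolding stack_def
  by (simp only: relabel_rules glue_strands_closed[OF F F'])

lemma pm_act_strand:
  "pm_act (pm_strand K + F) (head_cob u + F') = head_cob (strand_act K u) + (act_float K u + F + F')"
  unfolding pm_act_def stack_def
  by (simp only: relabel_rules glue_act_closed[OF F F'])

lemma tensor_strand:
  "tensor 0 1 (head_cob u + F) (tail_cob v + F') = pm_strand (Cut u v) + (F + F')"
  unfolding tensor_def
  by (simp only: relabel_rules shift_point.simps strand_cob.simps) simp

lemma cob_pairing_strand:
  "cob_pairing \<alpha> (tail_cob v + F) (head_cob u + F') = fst \<alpha> (v @ u) * eval_cob \<alpha> (F + F')"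
  unfolding cob_pairing_def
  by (simp only: relabel_rules glue_pair_closed(1)[OF F F'] eval_cob_add eval_cob_single)

lemma pm_trace_strand:
  "pm_trace \<alpha> (pm_strand K + F) = eval_cob \<alpha> (strand_close K + F)"
  unfolding pm_trace_def
  by (simp only: relabel_rules glue_strand_close_closed[OF F])

text \<open>The value agrees with that of \<open>cob_pairing_strand\<close>: a test of A(+) is the
  pairing with the half-interval obtained by moving the end point of the test to the top.\<close>

lemma test_plus:
  "eval_cob \<alpha> (cob_closure 0 (stack 1 ({#Ival (Some (Bot 0)) v None#} + F) (head_cob u + F'))) =
     fst \<alpha> (v @ u) * eval_cob \<alpha> (F + F')"
  unfolding cob_closure_def stack_def
  by (simp only: relabel_rules glue_pair_closed(2)[OF F F'] eval_cob_add eval_cob_single)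

lemma test_minus:
  "eval_cob \<alpha> (cob_closure 0 (stack 1 ({#Ival None u (Some (Bot 0))#} + F') (tail_cob v + F))) =
     fst \<alpha> (v @ u) * eval_cob \<alpha> (F + F')"
  unfolding cob_closure_def stack_def
  by (simp only: relabel_rules glue_pair_closed(1)[OF F F'] eval_cob_add eval_cob_single)

context
  fixes K K' :: "'s strand"
  assumes K: "strand_in \<Sigma> K" and K': "strand_in \<Sigma> K'"
begin

lemma closed_float: "closed_cob \<Sigma> (strand_float K K' + F + F')"
  using K K' F F' by simp

text \<open>Gluing at \<open>Mid 0\<close> composes the two strands and leaves both ends of the
  result at \<open>Mid 1\<close>, where the second gluing closes it up. So a test on A(+-) computes
  the trace of a product.\<close>

lemma test_pm:
  "eval_cob \<alpha> (cob_closure 0 (stack 2 (strand_cob (Bot 0) (Bot 1) K + F) (pm_strand K' + F'))) =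
     eval_cob \<alpha> (strand_close (strand_mult K K') + (strand_float K K' + F + F'))"
  unfolding cob_closure_def stack_def
  by (simp only: relabel_rules glue_strands_closed[OF F F'] glue_strand_close_closed[OF closed_float]
      relabel_closed[OF closed_float])

lemma test_plus_plus:
  "eval_cob \<alpha> (cob_closure 1 (stack 1 (strand_cob (Bot 0) (Top 0) K + F) (strand_cob (Bot 0) (Top 0) K' + F'))) =
     eval_cob \<alpha> (strand_close (strand_mult K K') + (strand_float K K' + F + F'))"
  unfolding cob_closure_def stack_def
  by (simp only: relabel_rules glue_strands_closed[OF F F'] glue_strand_close_closed[OF closed_float]
      relabel_closed[OF closed_float])

end

end

text \<open>The second identity is the cocycle condition for \<open>strand_float\<close>: both
  bracketings split off the same floating intervals. Together the two identities give associativity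
  of \<open>pm_mult\<close>.\<close>

lemma strand_mult_assoc:
  "strand_mult (strand_mult K K') K'' = strand_mult K (strand_mult K' K'')"
  "strand_float (strand_mult K K') K'' + strand_float K K' =
     strand_float K (strand_mult K' K'') + strand_float K' K''"
  by (cases K; cases K'; cases K''; simp)+

lemma strand_act_mult:
  "strand_act (strand_mult K K') u = strand_act K (strand_act K' u)"
  "act_float (strand_mult K K') u + strand_float K K' =
     act_float K (strand_act K' u) + act_float K' u"
  by (cases K; cases K'; simp)+

text \<open>The lower half of a cut strand never meets a factor stacked on top, so left
  multiplication affects only the upper half.\<close>

lemma strand_mult_cut:
  "strand_mult K (Cut u v) = Cut (strand_act K u) v" "strand_float K (Cut u v) = act_float K u"
  by (cases K; simp)+

section \<open>Product, action, trace and pairing of cobordisms\<close>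

lemma pm_mult_closed:
  assumes "cobordism \<Sigma> [] [Plus, Minus] c" "cobordism \<Sigma> [] [Plus, Minus] d"
  shows "cobordism \<Sigma> [] [Plus, Minus] (pm_mult c d)"
proof -
  obtain K F where c: "c = pm_strand K + F" and K: "strand_in \<Sigma> K" and F: "closed_cob \<Sigma> F"
    using assms(1) by (rule pm_cobE)
  obtain K' F' where d: "d = pm_strand K' + F'" and K': "strand_in \<Sigma> K'" and F': "closed_cob \<Sigma> F'"
    using assms(2) by (rule pm_cobE)
  show ?thesis
    unfolding c d pm_mult_strand[OF F F'] using K K' F F'
    by (intro cobordism_pm_strand) simp_all
qed

lemma pm_act_closed:
  assumes "cobordism \<Sigma> [] [Plus, Minus] c" "cobordism \<Sigma> [] [Plus] d"
  shows "cobordism \<Sigma> [] [Plus] (pm_act c d)"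
proof -
  obtain K F where c: "c = pm_strand K + F" and K: "strand_in \<Sigma> K" and F: "closed_cob \<Sigma> F"
    using assms(1) by (rule pm_cobE)
  obtain u F' where d: "d = head_cob u + F'" and u: "u \<in> lists \<Sigma>" and F': "closed_cob \<Sigma> F'"
    using assms(2) by (rule plus_cobE)
  show ?thesis
    unfolding c d pm_act_strand[OF F F'] using K F F' strand_in_simps(2)[OF K u] closed_floats(2)[OF K u]
    by (intro cobordism_head_cob) simp_all
qed

lemma tensor_closed:
  assumes "cobordism \<Sigma> [] [Plus] c" "cobordism \<Sigma> [] [Minus] d"
  shows "cobordism \<Sigma> [] [Plus, Minus] (tensor 0 1 c d)"
proof -
  obtain u F where c: "c = head_cob u + F" and u: "u \<in> lists \<Sigma>" and F: "closed_cob \<Sigma> F"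
    using assms(1) by (rule plus_cobE)
  obtain v F' where d: "d = tail_cob v + F'" and v: "v \<in> lists \<Sigma>" and F': "closed_cob \<Sigma> F'"
    using assms(2) by (rule minus_cobE)
  show ?thesis
    unfolding c d tensor_strand[OF F F'] using u v F F'
    by (intro cobordism_pm_strand) simp_all
qed

lemma pm_mult_assoc:
  assumes "cobordism \<Sigma> [] [Plus, Minus] c" "cobordism \<Sigma> [] [Plus, Minus] d"
    "cobordism \<Sigma> [] [Plus, Minus] e"
  shows "pm_mult (pm_mult c d) e = pm_mult c (pm_mult d e)"
proof -
  obtain K F where c: "c = pm_strand K + F" and K: "strand_in \<Sigma> K" and F: "closed_cob \<Sigma> F"
    using assms(1) by (rule pm_cobE)
  obtain K' F' where d: "d = pm_strand K' + F'" and K': "strand_in \<Sigma> K'" and F': "closed_cob \<Sigma> F'"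
    using assms(2) by (rule pm_cobE)
  obtain K'' F'' where e: "e = pm_strand K'' + F''" and K'': "strand_in \<Sigma> K''" and F'': "closed_cob \<Sigma> F''"
    using assms(3) by (rule pm_cobE)
  have G: "closed_cob \<Sigma> (strand_float K K' + F + F')" "closed_cob \<Sigma> (strand_float K' K'' + F' + F'')"
    using K K' K'' F F' F'' by simp_all
  have "strand_float (strand_mult K K') K'' + (strand_float K K' + F + F') + F'' =
      (strand_float (strand_mult K K') K'' + strand_float K K') + (F + F' + F'')"
    by (simp only: ac_simps)
  also have "\<dots> = strand_float K (strand_mult K' K'') + F + (strand_float K' K'' + F' + F'')"
    unfolding strand_mult_assoc by (simp only: ac_simps)
  finally show ?thesis
    unfolding c d e by (simp only: pm_mult_strand[OF F F'] pm_mult_strand[OF F' F'']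
        pm_mult_strand[OF G(1) F''] pm_mult_strand[OF F G(2)] strand_mult_assoc(1))
qed

lemma pm_act_mult:
  assumes "cobordism \<Sigma> [] [Plus, Minus] c" "cobordism \<Sigma> [] [Plus, Minus] d" "cobordism \<Sigma> [] [Plus] e"
  shows "pm_act (pm_mult c d) e = pm_act c (pm_act d e)"
proof -
  obtain K F where c: "c = pm_strand K + F" and K: "strand_in \<Sigma> K" and F: "closed_cob \<Sigma> F"
    using assms(1) by (rule pm_cobE)
  obtain K' F' where d: "d = pm_strand K' + F'" and K': "strand_in \<Sigma> K'" and F': "closed_cob \<Sigma> F'"
    using assms(2) by (rule pm_cobE)
  obtain u F'' where e: "e = head_cob u + F''" and u: "u \<in> lists \<Sigma>" and F'': "closed_cob \<Sigma> F''"
    using assms(3) by (rule plus_cobE)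
  have G: "closed_cob \<Sigma> (strand_float K K' + F + F')" "closed_cob \<Sigma> (act_float K' u + F' + F'')"
    using K K' u F F' F'' by simp_all
  have "act_float (strand_mult K K') u + (strand_float K K' + F + F') + F'' =
      (act_float (strand_mult K K') u + strand_float K K') + (F + F' + F'')"
    by (simp only: ac_simps)
  also have "\<dots> = act_float K (strand_act K' u) + F + (act_float K' u + F' + F'')"
    unfolding strand_act_mult by (simp only: ac_simps)
  finally show ?thesis
    unfolding c d e by (simp only: pm_mult_strand[OF F F'] pm_act_strand[OF F' F'']
        pm_act_strand[OF G(1) F''] pm_act_strand[OF F G(2)] strand_act_mult(1))
qed

lemma pm_mult_tensor:
  assumes "cobordism \<Sigma> [] [Plus, Minus] c" "cobordism \<Sigma> [] [Plus] d" "cobordism \<Sigma> [] [Minus] e"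
  shows "pm_mult c (tensor 0 1 d e) = tensor 0 1 (pm_act c d) e"
proof -
  obtain K F where c: "c = pm_strand K + F" and K: "strand_in \<Sigma> K" and F: "closed_cob \<Sigma> F"
    using assms(1) by (rule pm_cobE)
  obtain u F' where d: "d = head_cob u + F'" and u: "u \<in> lists \<Sigma>" and F': "closed_cob \<Sigma> F'"
    using assms(2) by (rule plus_cobE)
  obtain v F'' where e: "e = tail_cob v + F''" and v: "v \<in> lists \<Sigma>" and F'': "closed_cob \<Sigma> F''"
    using assms(3) by (rule minus_cobE)
  have G: "closed_cob \<Sigma> (F' + F'')" "closed_cob \<Sigma> (act_float K u + F + F')"
    using K u F F' F'' by simp_all
  show ?thesis
    unfolding c d e by (simp only: tensor_strand[OF F' F''] pm_act_strand[OF F F']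
        pm_mult_strand[OF F G(1)] tensor_strand[OF G(2) F''] strand_mult_cut) (simp only: add.assoc)
qed

lemma pm_mult_one_left:
  assumes "cobordism \<Sigma> [] [Plus, Minus] c"
  shows "pm_mult (pm_strand (Arc [])) c = c"
  using assms
proof (rule pm_cobE)
  fix K F assume "c = pm_strand K + F" "strand_in \<Sigma> K" "closed_cob \<Sigma> F"
  then show ?thesis
    using pm_mult_strand[of \<Sigma> "{#}" F "Arc []" K] by (cases K) (simp_all del: strand_cob.simps)
qed

lemma pm_mult_one_right:
  assumes "cobordism \<Sigma> [] [Plus, Minus] c"
  shows "pm_mult c (pm_strand (Arc [])) = c"
  using assms
proof (rule pm_cobE)
  fix K F assume "c = pm_strand K + F" "strand_in \<Sigma> K" "closed_cob \<Sigma> F"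
  then show ?thesis
    using pm_mult_strand[of \<Sigma> F "{#}" K "Arc []"] by (cases K) (simp_all del: strand_cob.simps)
qed

lemma pm_trace_mult:
  assumes "closed_cob \<Sigma> F" "closed_cob \<Sigma> F'" "strand_in \<Sigma> K" "strand_in \<Sigma> K'"
  shows "pm_trace \<alpha> (pm_mult (pm_strand K + F) (pm_strand K' + F')) =
     eval_cob \<alpha> (strand_close (strand_mult K K') + (strand_float K K' + F + F'))"
proof -
  have "closed_cob \<Sigma> (strand_float K K' + F + F')"
    using assms by simp
  then show ?thesis
    by (simp only: pm_mult_strand[OF assms(1,2)] pm_trace_strand)
qed

lemma pm_trace_commute:
  assumes "cobordism \<Sigma> [] [Plus, Minus] c" "cobordism \<Sigma> [] [Plus, Minus] d"
  shows "pm_trace \<alpha> (pm_mult c d) = pm_trace \<alpha> (pm_mult d c)"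
proof -
  obtain K F where c: "c = pm_strand K + F" and K: "strand_in \<Sigma> K" and F: "closed_cob \<Sigma> F"
    using assms(1) by (rule pm_cobE)
  obtain K' F' where d: "d = pm_strand K' + F'" and K': "strand_in \<Sigma> K'" and F': "closed_cob \<Sigma> F'"
    using assms(2) by (rule pm_cobE)
  \<comment> \<open>For two arcs the circle words are rotations of each other. For an arc and a cut
    both orders close up to the same interval. For two cuts the interval split off and the interval
    closed up change places.\<close>
  have "eval_cob \<alpha> (strand_close (strand_mult K K')) * eval_cob \<alpha> (strand_float K K') =
      eval_cob \<alpha> (strand_close (strand_mult K' K)) * eval_cob \<alpha> (strand_float K' K)"
    by (cases K; cases K') (auto simp: abs_cyc_word_append)
  then show ?thesis
    unfolding c d pm_trace_mult[OF F F' K K'] pm_trace_mult[OF F' F K' K] by simp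
qed

text \<open>Closing up a cut strand joins its two halves. This is the link between negligibility in
  A(+-), which is tested by traces, and negligibility in A(+) and A(-), which is tested by the
  pairing.\<close>

lemma pm_trace_tensor:
  assumes "cobordism \<Sigma> [] [Plus] c" "cobordism \<Sigma> [] [Minus] d"
  shows "pm_trace \<alpha> (tensor 0 1 c d) = cob_pairing \<alpha> d c"
proof -
  obtain u F where c: "c = head_cob u + F" and F: "closed_cob \<Sigma> F"
    using assms(1) by (rule plus_cobE)
  obtain v F' where d: "d = tail_cob v + F'" and F': "closed_cob \<Sigma> F'"
    using assms(2) by (rule minus_cobE)
  have "closed_cob \<Sigma> (F + F')"
    using F F' by simp
  then show ?thesis
    unfolding c d tensor_strand[OF F F'] cob_pairing_strand[OF F' F]
    by (simp only: pm_trace_strand) simp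
qed

text \<open>The action has an adjoint: acting on \<open>v\<close> and pairing with \<open>w\<close>
  is a single test of \<open>v\<close>. Therefore the action preserves negligibility.\<close>

lemma cob_pairing_pm_act:
  assumes "cobordism \<Sigma> [] [Plus, Minus] c" "cobordism \<Sigma> [] [Minus] w"
  shows "\<exists>w'. cobordism \<Sigma> [] [Minus] w' \<and>
    (\<forall>v. cobordism \<Sigma> [] [Plus] v \<longrightarrow> cob_pairing \<alpha> w (pm_act c v) = cob_pairing \<alpha> w' v)"
proof -
  obtain K F where c: "c = pm_strand K + F" and K: "strand_in \<Sigma> K" and F: "closed_cob \<Sigma> F"
    using assms(1) by (rule pm_cobE)
  obtain a F' where w: "w = tail_cob a + F'" and a: "a \<in> lists \<Sigma>" and F': "closed_cob \<Sigma> F'"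
    using assms(2) by (rule minus_cobE)
  \<comment> \<open>The product of \<open>w\<close> with \<open>c\<close> from the right; the
    intervals that split off are kept as closed components of the new test.\<close>
  define w' where "w' = tail_cob (strand_ract a K) + (ract_float a K + F + F')"
  have G: "closed_cob \<Sigma> (ract_float a K + F + F')"
    using K a F F' by simp
  have "cob_pairing \<alpha> w (pm_act c v) = cob_pairing \<alpha> w' v" if "cobordism \<Sigma> [] [Plus] v" for v
  proof -
    obtain u F'' where v: "v = head_cob u + F''" and u: "u \<in> lists \<Sigma>" and F'': "closed_cob \<Sigma> F''"
      using \<open>cobordism \<Sigma> [] [Plus] v\<close> by (rule plus_cobE)
    have G': "closed_cob \<Sigma> (act_float K u + F + F'')"
      using K u F F'' by simp
    \<comment> \<open>For a cut strand both sides contain the same two intervals: the one that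
      floats on one side is the one formed by the pairing on the other.\<close>
    have "fst \<alpha> (a @ strand_act K u) * eval_cob \<alpha> (act_float K u) =
        fst \<alpha> (strand_ract a K @ u) * eval_cob \<alpha> (ract_float a K)"
      by (cases K) auto
    then show ?thesis
      unfolding v c w w'_def pm_act_strand[OF F F''] cob_pairing_strand[OF F' G']
        cob_pairing_strand[OF G F'']
      by simp
  qed
  moreover have "cobordism \<Sigma> [] [Minus] w'"
    unfolding w'_def using K a G by (intro cobordism_tail_cob) simp_all
  ultimately show ?thesis
    by blast
qed

text \<open>The rank one formula (v \<otimes> w) v' = (w, v') v, seen through an arbitrary test
  \<open>w'\<close>. The factor (w, v') is the value of the floating interval.\<close>

lemma cob_pairing_tensor_act:
  assumes "cobordism \<Sigma> [] [Plus] v" "cobordism \<Sigma> [] [Minus] w" "cobordism \<Sigma> [] [Plus] v'"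
    "cobordism \<Sigma> [] [Minus] w'"
  shows "cob_pairing \<alpha> w' (pm_act (tensor 0 1 v w) v') = cob_pairing \<alpha> w v' * cob_pairing \<alpha> w' v"
proof -
  obtain a F where v: "v = head_cob a + F" and a: "a \<in> lists \<Sigma>" and F: "closed_cob \<Sigma> F"
    using assms(1) by (rule plus_cobE)
  obtain b G where w: "w = tail_cob b + G" and b: "b \<in> lists \<Sigma>" and G: "closed_cob \<Sigma> G"
    using assms(2) by (rule minus_cobE)
  obtain a' F' where v': "v' = head_cob a' + F'" and a': "a' \<in> lists \<Sigma>" and F': "closed_cob \<Sigma> F'"
    using assms(3) by (rule plus_cobE)
  obtain b' G' where w': "w' = tail_cob b' + G'" and b': "b' \<in> lists \<Sigma>" and G': "closed_cob \<Sigma> G'"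
    using assms(4) by (rule minus_cobE)
  have FG: "closed_cob \<Sigma> (F + G)"
    using F G by simp
  have H: "closed_cob \<Sigma> (act_float (Cut a b) a' + (F + G) + F')"
    using closed_floats(2)[of \<Sigma> "Cut a b" a'] a b a' FG F' by (simp del: act_float.simps)
  show ?thesis
    unfolding v w v' w' tensor_strand[OF F G] pm_act_strand[OF FG F'] cob_pairing_strand[OF G' H]
      cob_pairing_strand[OF G F'] cob_pairing_strand[OF G' F]
    by simp
qed

section \<open>Negligible combinations in terms of trace and pairing\<close>

text \<open>As maps on points \<open>bend\<close> and \<open>unbend\<close> are not injective, since
  each sends both \<open>Bot 0\<close> and \<open>Top 1\<close> to one point. They are inverse to
  each other on the outer points that actually occur here.\<close>

lemma relabel_unbend_cob:
  assumes "cobordism \<Sigma> [Plus] [Plus] c"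
  shows "cobordism \<Sigma> [] [Plus, Minus] (relabel unbend c)" "relabel bend (relabel unbend c) = c"
proof -
  obtain K F where c: "c = strand_cob (Bot 0) (Top 0) K + F" "strand_in \<Sigma> K" "closed_cob \<Sigma> F"
    using assms unfolding cobordism_plus_plus by blast
  then have "relabel unbend c = pm_strand K + F"
    by simp
  with c show "cobordism \<Sigma> [] [Plus, Minus] (relabel unbend c)" "relabel bend (relabel unbend c) = c"
    by auto
qed

lemma relabel_bend_cob:
  assumes "cobordism \<Sigma> [] [Plus, Minus] c"
  shows "cobordism \<Sigma> [Plus] [Plus] (relabel bend c)" "relabel unbend (relabel bend c) = c"
proof -
  obtain K F where c: "c = pm_strand K + F" "strand_in \<Sigma> K" "closed_cob \<Sigma> F"
    using assms by (rule pm_cobE)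
  then have "relabel bend c = strand_cob (Bot 0) (Top 0) K + F"
    by simp
  with c show "cobordism \<Sigma> [Plus] [Plus] (relabel bend c)" "relabel unbend (relabel bend c) = c"
    by (auto simp: cobordism_plus_plus)
qed

text \<open>Quantifying over the data of the normal form, rather than over cobordisms, allows
  comparison with tests in other hom spaces: these have the same data attached to other
  points.\<close>

lemma all_pm_cob:
  "(\<forall>d. cobordism \<Sigma> [] [Plus, Minus] d \<longrightarrow> P d) \<longleftrightarrow>
    (\<forall>K F. strand_in \<Sigma> K \<longrightarrow> closed_cob \<Sigma> F \<longrightarrow> P (pm_strand K + F))" (is "_ \<longleftrightarrow> ?R")
proof (intro iffI allI impI)
  fix d assume "?R" "cobordism \<Sigma> [] [Plus, Minus] d"
  from this(2) show "P d"
    by (rule pm_cobE) (simp only: \<open>?R\<close>)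
qed (simp add: cobordism_pm_strand del: union_mset_add_mset_left)

lemma all_plus_cob:
  "(\<forall>d. cobordism \<Sigma> [] [Plus] d \<longrightarrow> P d) \<longleftrightarrow>
    (\<forall>u F. u \<in> lists \<Sigma> \<longrightarrow> closed_cob \<Sigma> F \<longrightarrow> P (head_cob u + F))" (is "_ \<longleftrightarrow> ?R")
proof (intro iffI allI impI)
  fix d assume "?R" "cobordism \<Sigma> [] [Plus] d"
  from this(2) show "P d"
    by (rule plus_cobE) (simp only: \<open>?R\<close>)
qed (simp add: cobordism_head_cob del: union_mset_add_mset_left)

lemma all_minus_cob:
  "(\<forall>d. cobordism \<Sigma> [] [Minus] d \<longrightarrow> P d) \<longleftrightarrow>
    (\<forall>v F. v \<in> lists \<Sigma> \<longrightarrow> closed_cob \<Sigma> F \<longrightarrow> P (tail_cob v + F))" (is "_ \<longleftrightarrow> ?R")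
proof (intro iffI allI impI)
  fix d assume "?R" "cobordism \<Sigma> [] [Minus] d"
  from this(2) show "P d"
    by (rule minus_cobE) (simp only: \<open>?R\<close>)
qed (simp add: cobordism_tail_cob del: union_mset_add_mset_left)

text \<open>A cobordism from \<open>+-\<close> to the empty sequence has the same normal form as one
  in the other direction, with its end points moved. By \<open>test_pm\<close>, testing with the
  former is multiplying by the latter and taking the trace.\<close>

lemma negligible_pm_iff:
  "x \<in> negligible \<Sigma> \<alpha> [] [Plus, Minus] \<longleftrightarrow> x \<in> lincobs \<Sigma> [] [Plus, Minus] \<and>
    (\<forall>d. cobordism \<Sigma> [] [Plus, Minus] d \<longrightarrow> linform (\<lambda>c. pm_trace \<alpha> (pm_mult d c)) x = 0)"
  (is "_ \<longleftrightarrow> ?x \<and> ?P")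
proof -
  have test: "eval_cob \<alpha> (cob_closure 0 (stack 2 (strand_cob (Bot 0) (Bot 1) K + F) c)) =
      pm_trace \<alpha> (pm_mult (pm_strand K + F) c)"
    if "cobordism \<Sigma> [] [Plus, Minus] c" "strand_in \<Sigma> K" "closed_cob \<Sigma> F" for c K F
    using that(1)
  proof (rule pm_cobE)
    fix K' F' assume c: "c = pm_strand K' + F'" and K': "strand_in \<Sigma> K'" and F': "closed_cob \<Sigma> F'"
    show ?thesis
      unfolding c test_pm[OF that(3) F' that(2) K'] pm_trace_mult[OF that(3) F' that(2) K'] ..
  qed
  have form: "linform (\<lambda>c. eval_cob \<alpha> (cob_closure 0 (stack 2 (strand_cob (Bot 0) (Bot 1) K + F) c))) x =
      linform (\<lambda>c. pm_trace \<alpha> (pm_mult (pm_strand K + F) c)) x"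
    if ?x "strand_in \<Sigma> K" "closed_cob \<Sigma> F" for K F
    using that(1) by (rule lincobs_cong) (rule test[OF _ that(2,3)])
  have "x \<in> negligible \<Sigma> \<alpha> [] [Plus, Minus] \<longleftrightarrow> ?x \<and>
    (\<forall>K F. strand_in \<Sigma> K \<longrightarrow> closed_cob \<Sigma> F \<longrightarrow>
      linform (\<lambda>c. eval_cob \<alpha> (cob_closure 0 (stack 2 (strand_cob (Bot 0) (Bot 1) K + F) c))) x = 0)"
    unfolding negligible_def
    by (auto simp: cobordism_pm_dual simp flip: numeral_2_eq_2)
  also have "\<dots> \<longleftrightarrow> ?x \<and> ?P"
    unfolding all_pm_cob by (auto simp: form)
  finally show ?thesis .
qed

text \<open>The closure of a stack of two endomorphisms of \<open>+\<close> uses one gluing to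
  compose and one to close, which is again the trace of the product after bending. So bending in
  either direction respects cosets.\<close>

lemma negligible_plus_plus_iff:
  "x \<in> negligible \<Sigma> \<alpha> [Plus] [Plus] \<longleftrightarrow> x \<in> lincobs \<Sigma> [Plus] [Plus] \<and>
    linmap (relabel unbend) x \<in> negligible \<Sigma> \<alpha> [] [Plus, Minus]"
  (is "_ \<longleftrightarrow> ?x \<and> _")
proof -
  have test: "eval_cob \<alpha> (cob_closure 1 (stack 1 (strand_cob (Bot 0) (Top 0) K + F) c)) =
      pm_trace \<alpha> (pm_mult (pm_strand K + F) (relabel unbend c))"
    if "cobordism \<Sigma> [Plus] [Plus] c" and K: "strand_in \<Sigma> K" "closed_cob \<Sigma> F" for c K F
  proof -
    obtain K' F' where c: "c = strand_cob (Bot 0) (Top 0) K' + F'" "strand_in \<Sigma> K'" "closed_cob \<Sigma> F'"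
      using \<open>cobordism \<Sigma> [Plus] [Plus] c\<close> unfolding cobordism_plus_plus by blast
    have "relabel unbend c = pm_strand K' + F'"
      using c by simp
    then show ?thesis
      by (simp only: c(1) test_plus_plus[OF K(2) c(3) K(1) c(2)] pm_trace_mult[OF K(2) c(3) K(1) c(2)])
  qed
  have form: "linform (\<lambda>c. eval_cob \<alpha> (cob_closure 1 (stack 1 (strand_cob (Bot 0) (Top 0) K + F) c))) x =
      linform (\<lambda>c. pm_trace \<alpha> (pm_mult (pm_strand K + F) c)) (linmap (relabel unbend) x)"
    if ?x "strand_in \<Sigma> K" "closed_cob \<Sigma> F" for K F
    unfolding linform_linmap using that(1) by (rule lincobs_cong) (rule test[OF _ that(2,3)])
  have "x \<in> negligible \<Sigma> \<alpha> [Plus] [Plus] \<longleftrightarrow> ?x \<and>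
    (\<forall>K F. strand_in \<Sigma> K \<longrightarrow> closed_cob \<Sigma> F \<longrightarrow>
      linform (\<lambda>c. eval_cob \<alpha> (cob_closure 1 (stack 1 (strand_cob (Bot 0) (Top 0) K + F) c))) x = 0)"
    unfolding negligible_def
    by (auto simp: cobordism_plus_plus simp flip: One_nat_def)
  also have "\<dots> \<longleftrightarrow> ?x \<and> (\<forall>d. cobordism \<Sigma> [] [Plus, Minus] d \<longrightarrow>
      linform (\<lambda>c. pm_trace \<alpha> (pm_mult d c)) (linmap (relabel unbend) x) = 0)"
    unfolding all_pm_cob by (auto simp: form simp del: linform_linmap)
  also have "\<dots> \<longleftrightarrow> ?x \<and> linmap (relabel unbend) x \<in> negligible \<Sigma> \<alpha> [] [Plus, Minus]"
  proof -
    have "linmap (relabel unbend) x \<in> lincobs \<Sigma> [] [Plus, Minus]" if ?x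
      using that by (rule lincobs_linmap) (rule relabel_unbend_cob(1))
    then show ?thesis
      by (auto simp only: negligible_pm_iff)
  qed
  finally show ?thesis .
qed

text \<open>Together with its counterpart for A(-), this says that the kernels of the pairing are
  exactly what the quotients divide out.\<close>

lemma negligible_plus_iff:
  "x \<in> negligible \<Sigma> \<alpha> [] [Plus] \<longleftrightarrow> x \<in> lincobs \<Sigma> [] [Plus] \<and>
    (\<forall>w. cobordism \<Sigma> [] [Minus] w \<longrightarrow> linform (cob_pairing \<alpha> w) x = 0)"
  (is "_ \<longleftrightarrow> ?x \<and> ?P")
proof -
  have test: "eval_cob \<alpha> (cob_closure 0 (stack 1 ({#Ival (Some (Bot 0)) v None#} + F) c)) =
      cob_pairing \<alpha> (tail_cob v + F) c"
    if "cobordism \<Sigma> [] [Plus] c" "closed_cob \<Sigma> F" for c v F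
    using that(1)
  proof (rule plus_cobE)
    fix u F' assume c: "c = head_cob u + F'" and F': "closed_cob \<Sigma> F'"
    show ?thesis
      unfolding c test_plus[OF that(2) F'] cob_pairing_strand[OF that(2) F'] ..
  qed
  have form: "linform (\<lambda>c. eval_cob \<alpha> (cob_closure 0 (stack 1 ({#Ival (Some (Bot 0)) v None#} + F) c))) x =
      linform (cob_pairing \<alpha> (tail_cob v + F)) x"
    if ?x "closed_cob \<Sigma> F" for v F
    using that(1) by (rule lincobs_cong) (rule test[OF _ that(2)])
  have "x \<in> negligible \<Sigma> \<alpha> [] [Plus] \<longleftrightarrow> ?x \<and>
    (\<forall>v F. v \<in> lists \<Sigma> \<longrightarrow> closed_cob \<Sigma> F \<longrightarrow>
      linform (\<lambda>c. eval_cob \<alpha> (cob_closure 0 (stack 1 ({#Ival (Some (Bot 0)) v None#} + F) c))) x = 0)"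
    unfolding negligible_def
    by (auto simp: cobordism_plus_dual simp del: union_mset_add_mset_left simp flip: One_nat_def)
  also have "\<dots> \<longleftrightarrow> ?x \<and> ?P"
    unfolding all_minus_cob by (auto simp: form simp del: union_mset_add_mset_left)
  finally show ?thesis .
qed

lemma negligible_minus_iff:
  "x \<in> negligible \<Sigma> \<alpha> [] [Minus] \<longleftrightarrow> x \<in> lincobs \<Sigma> [] [Minus] \<and>
    (\<forall>v. cobordism \<Sigma> [] [Plus] v \<longrightarrow> linform (\<lambda>w. cob_pairing \<alpha> w v) x = 0)"
  (is "_ \<longleftrightarrow> ?x \<and> ?P")
proof -
  have test: "eval_cob \<alpha> (cob_closure 0 (stack 1 ({#Ival None u (Some (Bot 0))#} + F) c)) =
      cob_pairing \<alpha> c (head_cob u + F)"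
    if "cobordism \<Sigma> [] [Minus] c" "closed_cob \<Sigma> F" for c u F
    using that(1)
  proof (rule minus_cobE)
    fix v F' assume c: "c = tail_cob v + F'" and F': "closed_cob \<Sigma> F'"
    show ?thesis
      unfolding c test_minus[OF F' that(2)] cob_pairing_strand[OF F' that(2)] ..
  qed
  have form: "linform (\<lambda>c. eval_cob \<alpha> (cob_closure 0 (stack 1 ({#Ival None u (Some (Bot 0))#} + F) c))) x =
      linform (\<lambda>w. cob_pairing \<alpha> w (head_cob u + F)) x"
    if ?x "closed_cob \<Sigma> F" for u F
    using that(1) by (rule lincobs_cong) (rule test[OF _ that(2)])
  have "x \<in> negligible \<Sigma> \<alpha> [] [Minus] \<longleftrightarrow> ?x \<and>
    (\<forall>u F. u \<in> lists \<Sigma> \<longrightarrow> closed_cob \<Sigma> F \<longrightarrow>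
      linform (\<lambda>c. eval_cob \<alpha> (cob_closure 0 (stack 1 ({#Ival None u (Some (Bot 0))#} + F) c))) x = 0)"
    unfolding negligible_def
    by (auto simp: cobordism_minus_dual simp del: union_mset_add_mset_left simp flip: One_nat_def)
  also have "\<dots> \<longleftrightarrow> ?x \<and> ?P"
    unfolding all_plus_cob by (auto simp: form simp del: union_mset_add_mset_left)
  finally show ?thesis .
qed

section \<open>Operations on cosets\<close>

text \<open>One argument is replaced at a time, so that each summand has a difference of
  representatives as a factor.\<close>

lemma bilinmap_diff:
  "bilinmap f x' y' - bilinmap f x y = bilinmap f (x' - x) y' + bilinmap f x (y' - y)"
proof -
  have "bilinmap f x' y' = bilinmap f (x' - x) y' + bilinmap f x y'"
    "bilinmap f x y' = bilinmap f x (y' - y) + bilinmap f x y"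
    by (simp_all flip: bilinmap_add_left bilinmap_add_right)
  then show ?thesis
    by simp
qed

lemma lincobs_of_coset:
  assumes "y - x \<in> negligible \<Sigma> \<alpha> \<epsilon> \<epsilon>'" "x \<in> lincobs \<Sigma> \<epsilon> \<epsilon>'"
  shows "y \<in> lincobs \<Sigma> \<epsilon> \<epsilon>'"
  using lincobs_add[OF negligible_lincobs[OF assms(1)] assms(2)] by simp

lemma hom_coset_bilinmap:
  assumes "\<And>n z. n \<in> negligible \<Sigma> \<alpha> \<epsilon> \<epsilon>' \<Longrightarrow> z \<in> lincobs \<Sigma> \<eta> \<eta>' \<Longrightarrow> bilinmap f n z \<in> negligible \<Sigma> \<alpha> \<delta> \<delta>'"
    and "\<And>n z. n \<in> negligible \<Sigma> \<alpha> \<eta> \<eta>' \<Longrightarrow> z \<in> lincobs \<Sigma> \<epsilon> \<epsilon>' \<Longrightarrow> bilinmap f z n \<in> negligible \<Sigma> \<alpha> \<delta> \<delta>'"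
    and x: "x \<in> lincobs \<Sigma> \<epsilon> \<epsilon>'" and y: "y \<in> lincobs \<Sigma> \<eta> \<eta>'"
  shows "(\<Union>x'\<in>hom_coset \<Sigma> \<alpha> \<epsilon> \<epsilon>' x. \<Union>y'\<in>hom_coset \<Sigma> \<alpha> \<eta> \<eta>' y.
    hom_coset \<Sigma> \<alpha> \<delta> \<delta>' (bilinmap f x' y')) = hom_coset \<Sigma> \<alpha> \<delta> \<delta>' (bilinmap f x y)"
proof (intro hom_coset_UN)
  fix x' y' assume x': "x' - x \<in> negligible \<Sigma> \<alpha> \<epsilon> \<epsilon>'" and y': "y' - y \<in> negligible \<Sigma> \<alpha> \<eta> \<eta>'"
  show "hom_coset \<Sigma> \<alpha> \<delta> \<delta>' (bilinmap f x' y') = hom_coset \<Sigma> \<alpha> \<delta> \<delta>' (bilinmap f x y)"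
    \<comment> \<open>The first mixed term still contains \<open>y'\<close>, which is a combination
      of cobordisms because it lies in the coset of \<open>y\<close>.\<close>
    unfolding hom_coset_eq_iff bilinmap_diff
    by (intro negligible_add assms(1)[OF x'] assms(2)[OF y'] lincobs_of_coset[OF y' y] x)
qed

section \<open>Bending, and absorption of negligible combinations\<close>

lemma lincob_keys: "x \<in> lincobs \<Sigma> \<epsilon> \<epsilon>' \<Longrightarrow> c \<in> Poly_Mapping.keys x \<Longrightarrow> cobordism \<Sigma> \<epsilon> \<epsilon>' c"
  by (simp add: lincobs_def)

lemma linmap_bend:
  "x \<in> lincobs \<Sigma> [] [Plus, Minus] \<Longrightarrow> linmap (relabel bend) x \<in> lincobs \<Sigma> [Plus] [Plus]"
  by (erule lincobs_linmap) (rule relabel_bend_cob(1))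

lemma linmap_unbend:
  "x \<in> lincobs \<Sigma> [Plus] [Plus] \<Longrightarrow> linmap (relabel unbend) x \<in> lincobs \<Sigma> [] [Plus, Minus]"
  by (erule lincobs_linmap) (rule relabel_unbend_cob(1))

lemma linmap_unbend_bend:
  assumes "x \<in> lincobs \<Sigma> [] [Plus, Minus]"
  shows "linmap (relabel unbend) (linmap (relabel bend) x) = x"
  by (rule lincob_eqI)
     (simp only: linform_linmap relabel_bend_cob(2) lincobs_cong[OF assms, of "\<lambda>c. g (relabel unbend (relabel bend c))" g for g])

lemma negligible_bend:
  assumes "x \<in> negligible \<Sigma> \<alpha> [] [Plus, Minus]"
  shows "linmap (relabel bend) x \<in> negligible \<Sigma> \<alpha> [Plus] [Plus]"
  unfolding negligible_plus_plus_iff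
  using assms linmap_bend[OF negligible_lincobs[OF assms]]
  by (simp only: linmap_unbend_bend[OF negligible_lincobs[OF assms]])

lemma negligible_unbend:
  "x \<in> negligible \<Sigma> \<alpha> [Plus] [Plus] \<Longrightarrow> linmap (relabel unbend) x \<in> negligible \<Sigma> \<alpha> [] [Plus, Minus]"
  by (simp only: negligible_plus_plus_iff)

lemma linmap_diff: "linmap f x - linmap f y = linmap f (x - y)"
  using linmap_add[of f "x - y" y] by simp

lemma bend_down_coset:
  "bend_down \<Sigma> \<alpha> (hom_coset \<Sigma> \<alpha> [] [Plus, Minus] x) =
    hom_coset \<Sigma> \<alpha> [Plus] [Plus] (linmap (relabel bend) x)"
  unfolding bend_down_def
  by (rule hom_coset_UN) (simp only: hom_coset_eq_iff linmap_diff negligible_bend)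

lemma bend_up_coset:
  "bend_up \<Sigma> \<alpha> (hom_coset \<Sigma> \<alpha> [Plus] [Plus] x) =
    hom_coset \<Sigma> \<alpha> [] [Plus, Minus] (linmap (relabel unbend) x)"
  unfolding bend_up_def
  by (rule hom_coset_UN) (simp only: hom_coset_eq_iff linmap_diff negligible_unbend)

text \<open>tr(d(nb)) = tr((bd)n): cyclicity moves \<open>b\<close> to the other side, and
  \<open>n\<close> is tested by \<open>pm_mult b d\<close>.\<close>

lemma negligible_pm_mult_left:
  assumes n: "n \<in> negligible \<Sigma> \<alpha> [] [Plus, Minus]" and z: "z \<in> lincobs \<Sigma> [] [Plus, Minus]"
  shows "bilinmap pm_mult n z \<in> negligible \<Sigma> \<alpha> [] [Plus, Minus]"
  unfolding negligible_pm_iff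
proof (intro conjI allI impI)
  note nl = negligible_lincobs[OF n]
  show "bilinmap pm_mult n z \<in> lincobs \<Sigma> [] [Plus, Minus]"
    using nl z by (rule lincobs_bilinmap) (rule pm_mult_closed)
  fix d assume d: "cobordism \<Sigma> [] [Plus, Minus] d"
  have "linform (\<lambda>a. pm_trace \<alpha> (pm_mult d (pm_mult a b))) n = 0" if b: "b \<in> Poly_Mapping.keys z" for b
  proof -
    note bc = lincob_keys[OF z b]
    have "linform (\<lambda>a. pm_trace \<alpha> (pm_mult d (pm_mult a b))) n =
        linform (\<lambda>a. pm_trace \<alpha> (pm_mult (pm_mult b d) a)) n"
    proof (rule lincobs_cong[OF nl])
      fix a assume a: "cobordism \<Sigma> [] [Plus, Minus] a"
      have "pm_mult d (pm_mult a b) = pm_mult (pm_mult d a) b"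
        by (rule pm_mult_assoc[OF d a bc, symmetric])
      moreover have "pm_trace \<alpha> (pm_mult (pm_mult d a) b) = pm_trace \<alpha> (pm_mult b (pm_mult d a))"
        by (rule pm_trace_commute[OF pm_mult_closed[OF d a] bc])
      moreover have "pm_mult b (pm_mult d a) = pm_mult (pm_mult b d) a"
        by (rule pm_mult_assoc[OF bc d a, symmetric])
      ultimately show "pm_trace \<alpha> (pm_mult d (pm_mult a b)) = pm_trace \<alpha> (pm_mult (pm_mult b d) a)"
        by simp
    qed
    also have "\<dots> = 0"
      using n pm_mult_closed[OF bc d] by (simp add: negligible_pm_iff)
    finally show ?thesis .
  qed
  then show "linform (\<lambda>c. pm_trace \<alpha> (pm_mult d c)) (bilinmap pm_mult n z) = 0"
    by (simp add: linform_swap[of _ z n] linform_eq_0)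
qed

text \<open>On this side associativity is enough: tr(d(bn)) = tr((db)n).\<close>

lemma negligible_pm_mult_right:
  assumes n: "n \<in> negligible \<Sigma> \<alpha> [] [Plus, Minus]" and z: "z \<in> lincobs \<Sigma> [] [Plus, Minus]"
  shows "bilinmap pm_mult z n \<in> negligible \<Sigma> \<alpha> [] [Plus, Minus]"
  unfolding negligible_pm_iff
proof (intro conjI allI impI)
  note nl = negligible_lincobs[OF n]
  show "bilinmap pm_mult z n \<in> lincobs \<Sigma> [] [Plus, Minus]"
    using z nl by (rule lincobs_bilinmap) (rule pm_mult_closed)
  fix d assume d: "cobordism \<Sigma> [] [Plus, Minus] d"
  have "linform (\<lambda>a. pm_trace \<alpha> (pm_mult d (pm_mult b a))) n = 0" if b: "b \<in> Poly_Mapping.keys z" for b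
  proof -
    note bc = lincob_keys[OF z b]
    have "linform (\<lambda>a. pm_trace \<alpha> (pm_mult d (pm_mult b a))) n =
        linform (\<lambda>a. pm_trace \<alpha> (pm_mult (pm_mult d b) a)) n"
      by (rule lincobs_cong[OF nl]) (simp only: pm_mult_assoc[OF d bc])
    also have "\<dots> = 0"
      using n pm_mult_closed[OF d bc] by (simp add: negligible_pm_iff)
    finally show ?thesis .
  qed
  then show "linform (\<lambda>c. pm_trace \<alpha> (pm_mult d c)) (bilinmap pm_mult z n) = 0"
    by (simp add: linform_eq_0)
qed

text \<open>Matrix coefficients of the action are traces against cut strands: tr(c(v \<otimes> w)) =
  tr((cv) \<otimes> w) = (w, cv).\<close>

lemma cob_pairing_act:
  assumes "cobordism \<Sigma> [] [Plus, Minus] c" "cobordism \<Sigma> [] [Plus] v" "cobordism \<Sigma> [] [Minus] w"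
  shows "pm_trace \<alpha> (pm_mult c (tensor 0 1 v w)) = cob_pairing \<alpha> w (pm_act c v)"
  by (simp only: pm_mult_tensor[OF assms] pm_trace_tensor[OF pm_act_closed[OF assms(1,2)] assms(3)])

lemma linform_pairing_act:
  assumes "n \<in> negligible \<Sigma> \<alpha> [] [Plus]" "cobordism \<Sigma> [] [Plus, Minus] c" "cobordism \<Sigma> [] [Minus] w"
  shows "linform (\<lambda>v. cob_pairing \<alpha> w (pm_act c v)) n = 0"
proof -
  obtain w' where w': "cobordism \<Sigma> [] [Minus] w'"
    "\<And>v. cobordism \<Sigma> [] [Plus] v \<Longrightarrow> cob_pairing \<alpha> w (pm_act c v) = cob_pairing \<alpha> w' v"
    using cob_pairing_pm_act[OF assms(2,3)] by metis
  have "linform (\<lambda>v. cob_pairing \<alpha> w (pm_act c v)) n = linform (cob_pairing \<alpha> w') n"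
    by (rule lincobs_cong[OF negligible_lincobs[OF assms(1)]]) (rule w'(2))
  also have "\<dots> = 0"
    using assms(1) w'(1) by (simp add: negligible_plus_iff)
  finally show ?thesis .
qed

text \<open>(w, nb) = tr((b \<otimes> w)n), and b \<otimes> w is one of the tests that
  \<open>n\<close> passes.\<close>

lemma negligible_pm_act_left:
  assumes n: "n \<in> negligible \<Sigma> \<alpha> [] [Plus, Minus]" and z: "z \<in> lincobs \<Sigma> [] [Plus]"
  shows "bilinmap pm_act n z \<in> negligible \<Sigma> \<alpha> [] [Plus]"
  unfolding negligible_plus_iff
proof (intro conjI allI impI)
  note nl = negligible_lincobs[OF n]
  show "bilinmap pm_act n z \<in> lincobs \<Sigma> [] [Plus]"
    using nl z by (rule lincobs_bilinmap) (rule pm_act_closed)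
  fix w assume w: "cobordism \<Sigma> [] [Minus] w"
  have "linform (\<lambda>a. cob_pairing \<alpha> w (pm_act a b)) n = 0" if b: "b \<in> Poly_Mapping.keys z" for b
  proof -
    note bc = lincob_keys[OF z b]
    have "linform (\<lambda>a. cob_pairing \<alpha> w (pm_act a b)) n =
        linform (\<lambda>a. pm_trace \<alpha> (pm_mult (tensor 0 1 b w) a)) n"
    proof (rule lincobs_cong[OF nl])
      fix a assume a: "cobordism \<Sigma> [] [Plus, Minus] a"
      show "cob_pairing \<alpha> w (pm_act a b) = pm_trace \<alpha> (pm_mult (tensor 0 1 b w) a)"
        unfolding cob_pairing_act[OF a bc w, symmetric]
        by (rule pm_trace_commute[OF a tensor_closed[OF bc w]])
    qed
    also have "\<dots> = 0"
      using n tensor_closed[OF bc w] by (simp add: negligible_pm_iff)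
    finally show ?thesis .
  qed
  then show "linform (cob_pairing \<alpha> w) (bilinmap pm_act n z) = 0"
    by (simp add: linform_swap[of _ z n] linform_eq_0)
qed

lemma negligible_pm_act_right:
  assumes n: "n \<in> negligible \<Sigma> \<alpha> [] [Plus]" and z: "z \<in> lincobs \<Sigma> [] [Plus, Minus]"
  shows "bilinmap pm_act z n \<in> negligible \<Sigma> \<alpha> [] [Plus]"
  unfolding negligible_plus_iff
proof (intro conjI allI impI)
  show "bilinmap pm_act z n \<in> lincobs \<Sigma> [] [Plus]"
    using z negligible_lincobs[OF n] by (rule lincobs_bilinmap) (rule pm_act_closed)
  fix w assume w: "cobordism \<Sigma> [] [Minus] w"
  show "linform (cob_pairing \<alpha> w) (bilinmap pm_act z n) = 0"
    unfolding linform_bilinmap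
    by (rule linform_eq_0) (rule linform_pairing_act[OF n lincob_keys[OF z] w])
qed

text \<open>tr(d(n \<otimes> b)) = (b, dn), which vanishes by the adjoint of the action of
  \<open>d\<close>.\<close>

lemma negligible_tensor_left:
  assumes n: "n \<in> negligible \<Sigma> \<alpha> [] [Plus]" and z: "z \<in> lincobs \<Sigma> [] [Minus]"
  shows "bilinmap (tensor 0 1) n z \<in> negligible \<Sigma> \<alpha> [] [Plus, Minus]"
  unfolding negligible_pm_iff
proof (intro conjI allI impI)
  note nl = negligible_lincobs[OF n]
  show "bilinmap (tensor 0 1) n z \<in> lincobs \<Sigma> [] [Plus, Minus]"
    using nl z by (rule lincobs_bilinmap) (rule tensor_closed)
  fix d assume d: "cobordism \<Sigma> [] [Plus, Minus] d"
  have "linform (\<lambda>a. pm_trace \<alpha> (pm_mult d (tensor 0 1 a b))) n = 0" if b: "b \<in> Poly_Mapping.keys z" for b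
  proof -
    note bc = lincob_keys[OF z b]
    have "linform (\<lambda>a. pm_trace \<alpha> (pm_mult d (tensor 0 1 a b))) n =
        linform (\<lambda>a. cob_pairing \<alpha> b (pm_act d a)) n"
      by (rule lincobs_cong[OF nl]) (rule cob_pairing_act[OF d _ bc])
    then show ?thesis
      using linform_pairing_act[OF n d bc] by simp
  qed
  then show "linform (\<lambda>c. pm_trace \<alpha> (pm_mult d c)) (bilinmap (tensor 0 1) n z) = 0"
    by (simp add: linform_swap[of _ z n] linform_eq_0)
qed

text \<open>tr(d(b \<otimes> n)) = (n, db), and \<open>pm_act d b\<close> is a test for
  A(-).\<close>

lemma negligible_tensor_right:
  assumes n: "n \<in> negligible \<Sigma> \<alpha> [] [Minus]" and z: "z \<in> lincobs \<Sigma> [] [Plus]"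
  shows "bilinmap (tensor 0 1) z n \<in> negligible \<Sigma> \<alpha> [] [Plus, Minus]"
  unfolding negligible_pm_iff
proof (intro conjI allI impI)
  note nl = negligible_lincobs[OF n]
  show "bilinmap (tensor 0 1) z n \<in> lincobs \<Sigma> [] [Plus, Minus]"
    using z nl by (rule lincobs_bilinmap) (rule tensor_closed)
  fix d assume d: "cobordism \<Sigma> [] [Plus, Minus] d"
  have "linform (\<lambda>a. pm_trace \<alpha> (pm_mult d (tensor 0 1 b a))) n = 0" if b: "b \<in> Poly_Mapping.keys z" for b
  proof -
    note bc = lincob_keys[OF z b]
    have "linform (\<lambda>a. pm_trace \<alpha> (pm_mult d (tensor 0 1 b a))) n =
        linform (\<lambda>a. cob_pairing \<alpha> a (pm_act d b)) n"
      by (rule lincobs_cong[OF nl]) (rule cob_pairing_act[OF d bc])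
    then show ?thesis
      using n pm_act_closed[OF d bc] by (simp add: negligible_minus_iff)
  qed
  then show "linform (\<lambda>c. pm_trace \<alpha> (pm_mult d c)) (bilinmap (tensor 0 1) z n) = 0"
    by (simp add: linform_eq_0)
qed

lemma stack_plus_plus_closed:
  assumes "cobordism \<Sigma> [Plus] [Plus] c" "cobordism \<Sigma> [Plus] [Plus] d"
  shows "cobordism \<Sigma> [Plus] [Plus] (stack 1 c d)"
proof -
  obtain K F where c: "c = strand_cob (Bot 0) (Top 0) K + F" "strand_in \<Sigma> K" and F: "closed_cob \<Sigma> F"
    using assms(1) unfolding cobordism_plus_plus by blast
  obtain K' F' where d: "d = strand_cob (Bot 0) (Top 0) K' + F'" "strand_in \<Sigma> K'" and F': "closed_cob \<Sigma> F'"
    using assms(2) unfolding cobordism_plus_plus by blast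
  have "strand_in \<Sigma> (strand_mult K K')" "closed_cob \<Sigma> (strand_float K K' + F + F')"
    using c d F F' by simp_all
  then show ?thesis
    unfolding c(1) d(1) stack_plus_plus[OF F F'] cobordism_plus_plus by blast
qed

text \<open>Unbending turns composition in End(+) into \<open>pm_mult\<close>, so absorption for
  endomorphisms of \<open>+\<close> is inherited from A(+-).\<close>

lemma bilinmap_stack_unbend:
  assumes x: "x \<in> lincobs \<Sigma> [Plus] [Plus]" and y: "y \<in> lincobs \<Sigma> [Plus] [Plus]"
  shows "linmap (relabel unbend) (bilinmap (stack 1) x y) =
    bilinmap pm_mult (linmap (relabel unbend) x) (linmap (relabel unbend) y)"
proof (rule lincob_eqI)
  fix g :: "'a cob \<Rightarrow> 'b"
  show "linform g (linmap (relabel unbend) (bilinmap (stack 1) x y)) =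
    linform g (bilinmap pm_mult (linmap (relabel unbend) x) (linmap (relabel unbend) y))"
    unfolding linform_linmap linform_bilinmap pm_mult_def
    by (rule lincobs_cong[OF x], rule lincobs_cong[OF y]) (simp only: relabel_unbend_cob(2))
qed

lemma negligible_stack:
  assumes n: "n \<in> negligible \<Sigma> \<alpha> [Plus] [Plus]" and z: "z \<in> lincobs \<Sigma> [Plus] [Plus]"
  shows "bilinmap (stack 1) n z \<in> negligible \<Sigma> \<alpha> [Plus] [Plus]"
    and "bilinmap (stack 1) z n \<in> negligible \<Sigma> \<alpha> [Plus] [Plus]"
proof -
  note nl = negligible_lincobs[OF n]
  have "bilinmap (stack 1) n z \<in> lincobs \<Sigma> [Plus] [Plus]"
    using nl z stack_plus_plus_closed by (rule lincobs_bilinmap)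
  moreover have "bilinmap (stack 1) z n \<in> lincobs \<Sigma> [Plus] [Plus]"
    using z nl stack_plus_plus_closed by (rule lincobs_bilinmap)
  moreover note negligible_pm_mult_left[OF negligible_unbend[OF n] linmap_unbend[OF z]]
    negligible_pm_mult_right[OF negligible_unbend[OF n] linmap_unbend[OF z]]
  ultimately show "bilinmap (stack 1) n z \<in> negligible \<Sigma> \<alpha> [Plus] [Plus]"
    "bilinmap (stack 1) z n \<in> negligible \<Sigma> \<alpha> [Plus] [Plus]"
    unfolding negligible_plus_plus_iff bilinmap_stack_unbend[OF nl z] bilinmap_stack_unbend[OF z nl]
    by simp_all
qed

lemma bilinmap_stack_act:
  assumes x: "x \<in> lincobs \<Sigma> [Plus] [Plus]"
  shows "bilinmap (stack 1) x v = bilinmap pm_act (linmap (relabel unbend) x) v"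
proof (rule lincob_eqI)
  fix g :: "'a cob \<Rightarrow> 'b"
  show "linform g (bilinmap (stack 1) x v) = linform g (bilinmap pm_act (linmap (relabel unbend) x) v)"
    unfolding linform_linmap linform_bilinmap pm_act_def
    by (rule lincobs_cong[OF x]) (simp only: relabel_unbend_cob(2))
qed

lemma act_coset:
  assumes x: "x \<in> lincobs \<Sigma> [] [Plus, Minus]" and v: "v \<in> lincobs \<Sigma> [] [Plus]"
  shows "act \<Sigma> \<alpha> (hom_coset \<Sigma> \<alpha> [] [Plus, Minus] x) (hom_coset \<Sigma> \<alpha> [] [Plus] v) =
    hom_coset \<Sigma> \<alpha> [] [Plus] (bilinmap pm_act x v)"
proof -
  \<comment> \<open>\<open>hom_comp\<close> glues along the length of the middle sequence; the
    lemmas on stacking expect the literal \<open>1\<close>.\<close>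
  have "length [Plus] = 1" by simp
  then have "act \<Sigma> \<alpha> (hom_coset \<Sigma> \<alpha> [] [Plus, Minus] x) (hom_coset \<Sigma> \<alpha> [] [Plus] v) =
    hom_coset \<Sigma> \<alpha> [] [Plus] (bilinmap (stack 1) (linmap (relabel bend) x) v)"
    unfolding act_def bend_down_coset hom_comp_def
  proof (simp only:, intro hom_coset_bilinmap)
    fix n z :: "('a, 'b) lincob" assume n: "n \<in> negligible \<Sigma> \<alpha> [Plus] [Plus]" "z \<in> lincobs \<Sigma> [] [Plus]"
    show "bilinmap (stack 1) n z \<in> negligible \<Sigma> \<alpha> [] [Plus]"
      unfolding bilinmap_stack_act[OF negligible_lincobs[OF n(1)]]
      by (rule negligible_pm_act_left[OF negligible_unbend[OF n(1)] n(2)])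
  next
    fix n z :: "('a, 'b) lincob" assume n: "n \<in> negligible \<Sigma> \<alpha> [] [Plus]" "z \<in> lincobs \<Sigma> [Plus] [Plus]"
    show "bilinmap (stack 1) z n \<in> negligible \<Sigma> \<alpha> [] [Plus]"
      unfolding bilinmap_stack_act[OF n(2)]
      by (rule negligible_pm_act_right[OF n(1) linmap_unbend[OF n(2)]])
  qed (rule linmap_bend[OF x] v)+
  then show ?thesis
    by (simp only: bilinmap_stack_act[OF linmap_bend[OF x]] linmap_unbend_bend[OF x])
qed

lemma mult_coset:
  assumes x: "x \<in> lincobs \<Sigma> [] [Plus, Minus]" and y: "y \<in> lincobs \<Sigma> [] [Plus, Minus]"
  shows "hom_coset \<Sigma> \<alpha> [] [Plus, Minus] x \<otimes>\<^bsub>A_pm \<Sigma> \<alpha>\<^esub> hom_coset \<Sigma> \<alpha> [] [Plus, Minus] y =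
    hom_coset \<Sigma> \<alpha> [] [Plus, Minus] (bilinmap pm_mult x y)"
proof -
  have "length [Plus] = 1" by simp
  then have "hom_comp \<Sigma> \<alpha> [Plus] [Plus] [Plus]
        (hom_coset \<Sigma> \<alpha> [Plus] [Plus] (linmap (relabel bend) x))
        (hom_coset \<Sigma> \<alpha> [Plus] [Plus] (linmap (relabel bend) y)) =
      hom_coset \<Sigma> \<alpha> [Plus] [Plus] (bilinmap (stack 1) (linmap (relabel bend) x) (linmap (relabel bend) y))"
    unfolding hom_comp_def
    by (simp only:, intro hom_coset_bilinmap) (assumption | rule negligible_stack linmap_bend[OF x] linmap_bend[OF y])+
  then show ?thesis
    unfolding A_pm_def
    by (simp add: bend_down_coset bend_up_coset bilinmap_stack_unbend[OF linmap_bend[OF x] linmap_bend[OF y]]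
        linmap_unbend_bend[OF x] linmap_unbend_bend[OF y])
qed

lemma tens_coset:
  assumes v: "v \<in> lincobs \<Sigma> [] [Plus]" and w: "w \<in> lincobs \<Sigma> [] [Minus]"
  shows "tens \<Sigma> \<alpha> (hom_coset \<Sigma> \<alpha> [] [Plus] v) (hom_coset \<Sigma> \<alpha> [] [Minus] w) =
    hom_coset \<Sigma> \<alpha> [] [Plus, Minus] (bilinmap (tensor 0 1) v w)"
  unfolding tens_def
  using negligible_tensor_left negligible_tensor_right v w by (rule hom_coset_bilinmap)

lemma pairing_coset:
  assumes v: "v \<in> lincobs \<Sigma> [] [Plus]" and w: "w \<in> lincobs \<Sigma> [] [Minus]"
  shows "pairing \<alpha> (hom_coset \<Sigma> \<alpha> [] [Minus] w) (hom_coset \<Sigma> \<alpha> [] [Plus] v) =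
    linform (\<lambda>d. linform (cob_pairing \<alpha> d) v) w"
proof -
  have eq: "linform (\<lambda>d. linform (cob_pairing \<alpha> d) v') w' = linform (\<lambda>d. linform (cob_pairing \<alpha> d) v) w"
    if w': "w' - w \<in> negligible \<Sigma> \<alpha> [] [Minus]" and v': "v' - v \<in> negligible \<Sigma> \<alpha> [] [Plus]" for v' w'
  proof -
    \<comment> \<open>The representative of the vector is exchanged with \<open>w'\<close> held
      fixed; after interchanging the sums the same is done for \<open>w'\<close>.\<close>
    have "linform (\<lambda>d. linform (cob_pairing \<alpha> d) v') w' = linform (\<lambda>d. linform (cob_pairing \<alpha> d) v) w'"
    proof (rule lincobs_cong[OF lincobs_of_coset[OF w' w]])
      fix d assume "cobordism \<Sigma> [] [Minus] d"
      then have "linform (cob_pairing \<alpha> d) (v' - v) = 0"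
        using v' by (simp only: negligible_plus_iff)
      then show "linform (cob_pairing \<alpha> d) v' = linform (cob_pairing \<alpha> d) v"
        by simp
    qed
    also have "\<dots> = linform (\<lambda>c. linform (\<lambda>d. cob_pairing \<alpha> d c) w') v"
      by (rule linform_swap)
    also have "\<dots> = linform (\<lambda>c. linform (\<lambda>d. cob_pairing \<alpha> d c) w) v"
    proof (rule lincobs_cong[OF v])
      fix c assume "cobordism \<Sigma> [] [Plus] c"
      then have "linform (\<lambda>d. cob_pairing \<alpha> d c) (w' - w) = 0"
        using w' by (simp only: negligible_minus_iff)
      then show "linform (\<lambda>d. cob_pairing \<alpha> d c) w' = linform (\<lambda>d. cob_pairing \<alpha> d c) w"
        by simp
    qed
    also have "\<dots> = linform (\<lambda>d. linform (cob_pairing \<alpha> d) v) w"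
      by (rule linform_swap)
    finally show ?thesis .
  qed
  have "(\<Union>w'\<in>hom_coset \<Sigma> \<alpha> [] [Minus] w. \<Union>v'\<in>hom_coset \<Sigma> \<alpha> [] [Plus] v.
      {linform (\<lambda>d. linform (cob_pairing \<alpha> d) v') w'}) = {linform (\<lambda>d. linform (cob_pairing \<alpha> d) v) w}"
    by (rule hom_coset_UN)+ (rule arg_cong[where f = "\<lambda>a. {a}"], rule eq)
  then show ?thesis
    by (simp only: pairing_def linform_bilinmap the_elem_eq flip: cob_pairing_def)
qed

lemma cobordism_unit: "cobordism \<Sigma> [] [Plus, Minus] (pm_strand (Arc []))"
  using cobordism_pm_strand[of \<Sigma> "Arc []" "{#}"] by (simp add: closed_cob_def)

text \<open>tr(x) = tr(1x), so the undecorated arc is the test that makes the trace vanish on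
  negligible combinations.\<close>

lemma circ_tr_coset:
  assumes x: "x \<in> lincobs \<Sigma> [] [Plus, Minus]"
  shows "circ_tr \<alpha> (hom_coset \<Sigma> \<alpha> [] [Plus, Minus] x) = linform (pm_trace \<alpha>) x"
proof -
  have eq: "linform (pm_trace \<alpha>) x' = linform (pm_trace \<alpha>) x"
    if x': "x' - x \<in> negligible \<Sigma> \<alpha> [] [Plus, Minus]" for x'
  proof -
    have "linform (pm_trace \<alpha>) (x' - x) = linform (\<lambda>c. pm_trace \<alpha> (pm_mult (pm_strand (Arc [])) c)) (x' - x)"
      by (rule lincobs_cong[OF negligible_lincobs[OF x']]) (simp only: pm_mult_one_left)
    also have "\<dots> = 0"
      using x' by (simp only: negligible_pm_iff cobordism_unit)
    finally show ?thesis
      by simp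
  qed
  have "(\<Union>x'\<in>hom_coset \<Sigma> \<alpha> [] [Plus, Minus] x. {linform (pm_trace \<alpha>) x'}) = {linform (pm_trace \<alpha>) x}"
    by (rule hom_coset_UN)+ (rule arg_cong[where f = "\<lambda>a. {a}"], rule eq)
  then have "(\<lambda>x'. linform (pm_trace \<alpha>) x') ` hom_coset \<Sigma> \<alpha> [] [Plus, Minus] x = {linform (pm_trace \<alpha>) x}"
    by (simp only: UNION_singleton_eq_range)
  then show ?thesis
    by (simp only: circ_tr_def the_elem_eq flip: pm_trace_def)
qed

section \<open>A corner of a symmetric Frobenius algebra\<close>

lemma finsum_hom:
  assumes "abelian_monoid G" "abelian_monoid H"
    and h: "\<And>x. x \<in> carrier G \<Longrightarrow> h x \<in> carrier H" "h \<zero>\<^bsub>G\<^esub> = \<zero>\<^bsub>H\<^esub>"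
      "\<And>x y. x \<in> carrier G \<Longrightarrow> y \<in> carrier G \<Longrightarrow> h (x \<oplus>\<^bsub>G\<^esub> y) = h x \<oplus>\<^bsub>H\<^esub> h y"
    and "finite I" "\<And>i. i \<in> I \<Longrightarrow> f i \<in> carrier G"
  shows "h (\<Oplus>\<^bsub>G\<^esub>i\<in>I. f i) = (\<Oplus>\<^bsub>H\<^esub>i\<in>I. h (f i))"
proof -
  interpret G: abelian_monoid G by fact
  interpret H: abelian_monoid H by fact
  show ?thesis
    using assms(6,7)
  proof (induction I)
    case empty
    then show ?case by (simp add: h)
  next
    case (insert i I)
    then have "f \<in> I \<rightarrow> carrier G" "(\<lambda>i. h (f i)) \<in> I \<rightarrow> carrier H" "f i \<in> carrier G"
      using h(1) by auto
    with insert show ?case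
      by (simp add: h G.finsum_insert H.finsum_insert)
  qed
qed

text \<open>\<open>f\<close> may repeat a vector, whereas the coefficients in \<open>fin_dim\<close>
  are indexed by the vectors themselves. Coefficients of equal vectors have to be added up.\<close>

lemma finsum_image_span:
  fixes V :: "('k::field, 'b, 'm) module_scheme"
  assumes "Module.module (scalars :: 'k ring) V" "finite I" "\<And>i. i \<in> I \<Longrightarrow> f i \<in> carrier V"
  shows "\<exists>a'. (\<Oplus>\<^bsub>V\<^esub>i\<in>I. a i \<odot>\<^bsub>V\<^esub> f i) = (\<Oplus>\<^bsub>V\<^esub>c\<in>f ` I. a' c \<odot>\<^bsub>V\<^esub> c)"
proof -
  interpret Module.module "scalars :: 'k ring" V by fact
  have sc: "a \<in> carrier (scalars :: 'k ring)" for a :: 'k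
    by (simp add: scalars_def)
  have add_smult: "(a + b) \<odot>\<^bsub>V\<^esub> x = a \<odot>\<^bsub>V\<^esub> x \<oplus>\<^bsub>V\<^esub> b \<odot>\<^bsub>V\<^esub> x"
    if "x \<in> carrier V" for a b :: 'k and x
    using smult_l_distr[OF sc sc that, of a b] by (simp add: scalars_def)
  have upd: "(\<Oplus>\<^bsub>V\<^esub>c\<in>C. (a'(y := z)) c \<odot>\<^bsub>V\<^esub> c) = (\<Oplus>\<^bsub>V\<^esub>c\<in>C. a' c \<odot>\<^bsub>V\<^esub> c)"
    if "C \<subseteq> carrier V" "y \<notin> C" for C a' y and z :: 'k
    using that by (intro finsum_cong') (auto simp: sc)
  show ?thesis
    using assms(2,3)
  proof (induction I)
    case empty
    then show ?case by simp
  next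
    case (insert i I)
    then obtain a' where a': "(\<Oplus>\<^bsub>V\<^esub>i\<in>I. a i \<odot>\<^bsub>V\<^esub> f i) = (\<Oplus>\<^bsub>V\<^esub>c\<in>f ` I. a' c \<odot>\<^bsub>V\<^esub> c)"
      by auto
    have fi: "f i \<in> carrier V" and fI: "f ` I \<subseteq> carrier V"
      using insert by auto
    define C where "C = f ` I - {f i}"
    have C: "finite C" "C \<subseteq> carrier V" "f i \<notin> C" "f ` insert i I = insert (f i) C"
      using insert fI by (auto simp: C_def)
    have ins: "(\<Oplus>\<^bsub>V\<^esub>c\<in>insert (f i) C. b c \<odot>\<^bsub>V\<^esub> c) = b (f i) \<odot>\<^bsub>V\<^esub> f i \<oplus>\<^bsub>V\<^esub> (\<Oplus>\<^bsub>V\<^esub>c\<in>C. b c \<odot>\<^bsub>V\<^esub> c)"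
      for b :: "'b \<Rightarrow> 'k"
      using C fi by (intro finsum_insert) (auto simp: sc)
    have "(\<lambda>i. a i \<odot>\<^bsub>V\<^esub> f i) \<in> I \<rightarrow> carrier V"
      using insert by (auto simp: sc)
    then have eq: "(\<Oplus>\<^bsub>V\<^esub>i\<in>insert i I. a i \<odot>\<^bsub>V\<^esub> f i) =
        a i \<odot>\<^bsub>V\<^esub> f i \<oplus>\<^bsub>V\<^esub> (\<Oplus>\<^bsub>V\<^esub>c\<in>f ` I. a' c \<odot>\<^bsub>V\<^esub> c)"
      using insert fi by (simp add: finsum_insert sc flip: a')
    have cC: "(\<Oplus>\<^bsub>V\<^esub>c\<in>C. a' c \<odot>\<^bsub>V\<^esub> c) \<in> carrier V"
      using C by (intro finsum_closed) (auto simp: sc)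
    show ?case
    \<comment> \<open>If the vector \<open>f i\<close> has occurred before, its old coefficient is
      increased by \<open>a i\<close>; otherwise a new coefficient is set. The terms over
      \<open>C\<close> are unaffected in both cases.\<close>
    proof (cases "f i \<in> f ` I")
      case True
      then have "f ` I = insert (f i) C"
        by (auto simp: C_def)
      then have "(\<Oplus>\<^bsub>V\<^esub>i\<in>insert i I. a i \<odot>\<^bsub>V\<^esub> f i) =
          (a i + a' (f i)) \<odot>\<^bsub>V\<^esub> f i \<oplus>\<^bsub>V\<^esub> (\<Oplus>\<^bsub>V\<^esub>c\<in>C. a' c \<odot>\<^bsub>V\<^esub> c)"
        using fi cC by (simp add: eq ins sc a_assoc add_smult)
      also have "\<dots> = (\<Oplus>\<^bsub>V\<^esub>c\<in>f ` insert i I. (a'(f i := a i + a' (f i))) c \<odot>\<^bsub>V\<^esub> c)"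
        unfolding C(4) ins upd[OF C(2,3)] by simp
      finally show ?thesis by blast
    next
      case False
      then have "f ` I = C"
        by (auto simp: C_def)
      then have "(\<Oplus>\<^bsub>V\<^esub>i\<in>insert i I. a i \<odot>\<^bsub>V\<^esub> f i) =
          (\<Oplus>\<^bsub>V\<^esub>c\<in>f ` insert i I. (a'(f i := a i)) c \<odot>\<^bsub>V\<^esub> c)"
        unfolding C(4) ins upd[OF C(2,3)] eq by simp
      then show ?thesis by blast
    qed
  qed
qed

text \<open>The hypothesis makes \<open>e\<close> a left identity of the left ideal Ae; y = 1 shows
  that \<open>e\<close> is idempotent. Once ex = 0 is known for x in the right annihilator of
  \<open>e\<close>, that annihilator is the corner (1 - e)A(1 - e), which explains the unit.\<close>

lemma symmetric_frobenius_corner: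
  fixes A :: "('k::field, 'b) module"
  assumes frob: "symmetric_frobenius_algebra A t"
    and e: "e \<in> carrier A"
    and left_unit: "\<And>y. y \<in> carrier A \<Longrightarrow> e \<otimes>\<^bsub>A\<^esub> (y \<otimes>\<^bsub>A\<^esub> e) = y \<otimes>\<^bsub>A\<^esub> e"
  shows "symmetric_frobenius_algebra
    (A\<lparr>carrier := {x \<in> carrier A. x \<otimes>\<^bsub>A\<^esub> e = \<zero>\<^bsub>A\<^esub>}, one := \<one>\<^bsub>A\<^esub> \<ominus>\<^bsub>A\<^esub> e\<rparr>) t"
proof -
  interpret ring A
    using frob by (simp add: symmetric_frobenius_algebra_def unital_algebra_def)
  interpret M: Module.module "scalars :: 'k ring" A
    using frob by (simp add: symmetric_frobenius_algebra_def unital_algebra_def)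
  have sc: "a \<in> carrier (scalars :: 'k ring)" for a :: 'k
    by (simp add: scalars_def)
  have smult_mult: "(a \<odot>\<^bsub>A\<^esub> x) \<otimes>\<^bsub>A\<^esub> y = a \<odot>\<^bsub>A\<^esub> (x \<otimes>\<^bsub>A\<^esub> y)" "x \<otimes>\<^bsub>A\<^esub> (a \<odot>\<^bsub>A\<^esub> y) = a \<odot>\<^bsub>A\<^esub> (x \<otimes>\<^bsub>A\<^esub> y)"
    if "x \<in> carrier A" "y \<in> carrier A" for a x y
    using frob that by (simp_all add: symmetric_frobenius_algebra_def unital_algebra_def)
  have t_add: "t (x \<oplus>\<^bsub>A\<^esub> y) = t x + t y" and t_comm: "t (x \<otimes>\<^bsub>A\<^esub> y) = t (y \<otimes>\<^bsub>A\<^esub> x)"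
    if "x \<in> carrier A" "y \<in> carrier A" for x y
    using frob that by (simp_all add: symmetric_frobenius_algebra_def linear_form_def)
  have t_smult: "t (a \<odot>\<^bsub>A\<^esub> x) = a * t x" if "x \<in> carrier A" for a x
    using frob that by (simp add: symmetric_frobenius_algebra_def linear_form_def)
  have t_nondeg: "x = \<zero>\<^bsub>A\<^esub>" if "x \<in> carrier A" "\<And>y. y \<in> carrier A \<Longrightarrow> t (x \<otimes>\<^bsub>A\<^esub> y) = 0" for x
    using frob that by (simp add: symmetric_frobenius_algebra_def nondegenerate_def)
  have t_zero: "t \<zero>\<^bsub>A\<^esub> = 0"
    using t_smult[of "\<zero>\<^bsub>A\<^esub>" 0] by (simp add: M.smult_r_null sc)
  have ee: "e \<otimes>\<^bsub>A\<^esub> e = e"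
    using left_unit[of "\<one>\<^bsub>A\<^esub>"] e by simp
  define K where "K = {x \<in> carrier A. x \<otimes>\<^bsub>A\<^esub> e = \<zero>\<^bsub>A\<^esub>}"
  define B where "B = A\<lparr>carrier := K, one := \<one>\<^bsub>A\<^esub> \<ominus>\<^bsub>A\<^esub> e\<rparr>"
  have KA: "x \<in> carrier A" and Ke: "x \<otimes>\<^bsub>A\<^esub> e = \<zero>\<^bsub>A\<^esub>" if "x \<in> K" for x
    using that by (simp_all add: K_def)
  have eK: "e \<otimes>\<^bsub>A\<^esub> x = \<zero>\<^bsub>A\<^esub>" if x: "x \<in> K" for x
  proof (rule t_nondeg)
    fix y assume y: "y \<in> carrier A"
    have "t (e \<otimes>\<^bsub>A\<^esub> x \<otimes>\<^bsub>A\<^esub> y) = t (e \<otimes>\<^bsub>A\<^esub> (x \<otimes>\<^bsub>A\<^esub> y))"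
      using e y KA[OF x] by (simp add: m_assoc)
    also have "\<dots> = t (x \<otimes>\<^bsub>A\<^esub> y \<otimes>\<^bsub>A\<^esub> e)"
      using e y KA[OF x] by (intro t_comm) simp_all
    also have "\<dots> = t (x \<otimes>\<^bsub>A\<^esub> (e \<otimes>\<^bsub>A\<^esub> (y \<otimes>\<^bsub>A\<^esub> e)))"
      using e y KA[OF x] by (simp add: left_unit m_assoc)
    also have "\<dots> = t (x \<otimes>\<^bsub>A\<^esub> e \<otimes>\<^bsub>A\<^esub> (y \<otimes>\<^bsub>A\<^esub> e))"
      using e y KA[OF x] by (simp add: m_assoc)
    also have "\<dots> = 0"
      using e y by (simp add: Ke[OF x] t_zero)
    finally show "t (e \<otimes>\<^bsub>A\<^esub> x \<otimes>\<^bsub>A\<^esub> y) = 0" .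
  qed (use e KA[OF x] in simp)
  have K_zero: "\<zero>\<^bsub>A\<^esub> \<in> K" and K_one: "\<one>\<^bsub>A\<^esub> \<ominus>\<^bsub>A\<^esub> e \<in> K"
    using e by (simp_all add: K_def minus_eq l_distr l_minus ee r_neg)
  have K_add: "x \<oplus>\<^bsub>A\<^esub> y \<in> K" and K_mult: "x \<otimes>\<^bsub>A\<^esub> y \<in> K" if "x \<in> K" "y \<in> K" for x y
    using that e by (simp_all add: K_def l_distr m_assoc)
  have K_minus: "\<ominus>\<^bsub>A\<^esub> x \<in> K" and K_smult: "a \<odot>\<^bsub>A\<^esub> x \<in> K" if "x \<in> K" for a x
    using that e by (simp_all add: K_def l_minus smult_mult sc)
  have one_l: "(\<one>\<^bsub>A\<^esub> \<ominus>\<^bsub>A\<^esub> e) \<otimes>\<^bsub>A\<^esub> x = x" and one_r: "x \<otimes>\<^bsub>A\<^esub> (\<one>\<^bsub>A\<^esub> \<ominus>\<^bsub>A\<^esub> e) = x" if "x \<in> K" for x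
    using KA[OF that] Ke[OF that] eK[OF that] e
    by (simp_all add: minus_eq l_distr r_distr l_minus r_minus)
  have B_simps: "carrier B = K" "add B = add A" "mult B = mult A" "zero B = zero A"
      "one B = \<one>\<^bsub>A\<^esub> \<ominus>\<^bsub>A\<^esub> e" "smult B = smult A"
    by (simp_all add: B_def)
  have B_group: "abelian_group B"
  proof (rule abelian_groupI; unfold B_simps)
    fix x assume "x \<in> K"
    then show "\<exists>y\<in>K. y \<oplus>\<^bsub>A\<^esub> x = \<zero>\<^bsub>A\<^esub>"
      by (intro bexI[of _ "\<ominus>\<^bsub>A\<^esub> x"]) (simp_all add: KA K_minus l_neg)
  qed (simp_all add: KA K_add K_zero a_ac)
  have B_ring: "ring B"
  proof (rule ringI[OF B_group])
    show "monoid B"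
      by (rule monoidI; unfold B_simps) (simp_all add: KA K_mult K_one one_l one_r m_assoc)
  qed (simp_all add: B_simps KA l_distr r_distr)
  have B_module: "Module.module (scalars :: 'k ring) B"
  proof (rule module.intro[OF cring_scalars B_group])
    show "module_axioms (scalars :: 'k ring) B"
      by (rule module_axioms.intro; unfold B_simps)
         (simp_all add: KA K_smult M.smult_l_distr M.smult_r_distr M.smult_assoc1)
  qed
  \<comment> \<open>Right multiplication by 1 - e: a linear projection of the algebra onto
    \<open>K\<close>, which carries spanning sets to spanning sets.\<close>
  define p where "p z = z \<ominus>\<^bsub>A\<^esub> z \<otimes>\<^bsub>A\<^esub> e" for z
  have p_K: "p z \<in> K" if "z \<in> carrier A" for z
    using that e by (simp add: p_def K_def minus_eq l_distr l_minus m_assoc ee r_neg)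
  have p_id: "p z = z" if "z \<in> K" for z
    using KA[OF that] by (simp add: p_def Ke[OF that] minus_eq)
  have p_add: "p (x \<oplus>\<^bsub>A\<^esub> y) = p x \<oplus>\<^bsub>A\<^esub> p y" if "x \<in> carrier A" "y \<in> carrier A" for x y
    using that e by (simp add: p_def minus_eq l_distr minus_add a_ac)
  have p_smult: "p (a \<odot>\<^bsub>A\<^esub> x) = a \<odot>\<^bsub>A\<^esub> p x" if "x \<in> carrier A" for a x
    using that e by (simp add: p_def minus_eq smult_mult sc M.smult_r_distr M.smult_r_minus)
  have B_fin_dim: "fin_dim B"
  proof -
    from frob have "fin_dim A"
      by (simp only: symmetric_frobenius_algebra_def)
    then obtain S where S: "finite S" "S \<subseteq> carrier A"
      "\<forall>x \<in> carrier A. \<exists>a. x = (\<Oplus>\<^bsub>A\<^esub>b\<in>S. a b \<odot>\<^bsub>A\<^esub> b)"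
      unfolding fin_dim_def by (elim exE conjE) (rule that)
    have "\<exists>a. x = (\<Oplus>\<^bsub>B\<^esub>b\<in>p ` S. a b \<odot>\<^bsub>B\<^esub> b)" if x: "x \<in> K" for x
    proof -
      obtain a where a: "x = (\<Oplus>\<^bsub>A\<^esub>b\<in>S. a b \<odot>\<^bsub>A\<^esub> b)"
        using bspec[OF S(3) KA[OF x]] by (elim exE) (rule that)
      have "p (\<Oplus>\<^bsub>A\<^esub>b\<in>S. a b \<odot>\<^bsub>A\<^esub> b) = (\<Oplus>\<^bsub>B\<^esub>b\<in>S. p (a b \<odot>\<^bsub>A\<^esub> b))"
        using S(1,2) p_id[OF K_zero] B_group
        by (intro finsum_hom) (auto simp: B_simps p_K p_add sc abelian_group_def intro: abelian_monoid_axioms)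
      also have "\<dots> = (\<Oplus>\<^bsub>B\<^esub>b\<in>S. a b \<odot>\<^bsub>B\<^esub> p b)"
        using S(2) by (intro abelian_monoid.finsum_cong'[OF abelian_group.axioms(1)[OF B_group]])
          (auto simp: B_simps p_smult K_smult p_K)
      finally have "x = (\<Oplus>\<^bsub>B\<^esub>b\<in>S. a b \<odot>\<^bsub>B\<^esub> p b)"
        using p_id[OF x] by (simp flip: a)
      \<comment> \<open>\<open>p\<close> may identify members of \<open>S\<close>, so the sum over
        \<open>S\<close> is regrouped over the image.\<close>
      moreover have "\<exists>a'. (\<Oplus>\<^bsub>B\<^esub>b\<in>S. a b \<odot>\<^bsub>B\<^esub> p b) = (\<Oplus>\<^bsub>B\<^esub>c\<in>p ` S. a' c \<odot>\<^bsub>B\<^esub> c)"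
        using B_module S(1) by (rule finsum_image_span) (use S(2) p_K in \<open>auto simp: B_simps\<close>)
      ultimately show ?thesis
        by simp
    qed
    moreover have "finite (p ` S)" "p ` S \<subseteq> carrier B"
      using S p_K by (auto simp: B_simps)
    ultimately show ?thesis
      unfolding fin_dim_def B_simps(1) by blast
  qed
  have K_nondeg: "x = \<zero>\<^bsub>A\<^esub>" if x: "x \<in> K" and 0: "\<And>y. y \<in> K \<Longrightarrow> t (x \<otimes>\<^bsub>A\<^esub> y) = 0" for x
  proof (rule t_nondeg[OF KA[OF x]])
    fix z assume z: "z \<in> carrier A"
    note xA = KA[OF x]
    \<comment> \<open>Cyclicity turns this into t(z(ex)), so it is the derived relation ex = 0, and
      not the defining one xe = 0, that makes it vanish.\<close>
    have "t (x \<otimes>\<^bsub>A\<^esub> (z \<otimes>\<^bsub>A\<^esub> e)) = t (z \<otimes>\<^bsub>A\<^esub> e \<otimes>\<^bsub>A\<^esub> x)"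
      using xA z e by (intro t_comm) simp_all
    also have "\<dots> = 0"
      using xA z e by (simp add: m_assoc eK[OF x] t_zero)
    finally have ze: "t (x \<otimes>\<^bsub>A\<^esub> (z \<otimes>\<^bsub>A\<^esub> e)) = 0" .
    have "z = p z \<oplus>\<^bsub>A\<^esub> z \<otimes>\<^bsub>A\<^esub> e"
      using z e by (simp add: p_def minus_eq a_assoc l_neg)
    then have "t (x \<otimes>\<^bsub>A\<^esub> z) = t (x \<otimes>\<^bsub>A\<^esub> p z \<oplus>\<^bsub>A\<^esub> x \<otimes>\<^bsub>A\<^esub> (z \<otimes>\<^bsub>A\<^esub> e))"
      using xA z e KA[OF p_K[OF z]] by (metis r_distr m_closed)
    then show "t (x \<otimes>\<^bsub>A\<^esub> z) = 0"
      using xA z e KA[OF p_K[OF z]] by (simp add: t_add ze 0 p_K)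
  qed
  have "symmetric_frobenius_algebra B t"
    unfolding symmetric_frobenius_algebra_def unital_algebra_def linear_form_def nondegenerate_def
  proof (intro conjI ballI allI impI B_ring B_module B_fin_dim; unfold B_simps)
    fix y assume y: "y \<in> K" "\<forall>x\<in>K. t (x \<otimes>\<^bsub>A\<^esub> y) = 0"
    show "y = \<zero>\<^bsub>A\<^esub>"
      by (rule K_nondeg[OF y(1)]) (use y in \<open>simp add: KA t_comm[of y]\<close>)
  qed (auto simp: KA smult_mult t_add t_smult intro: t_comm K_nondeg)
  then show ?thesis
    by (simp add: B_def K_def)
qed

section \<open>The algebra \<open>A(+-)\<close> and its action\<close>

abbreviation pm_coset where
  "pm_coset \<Sigma> \<alpha> \<equiv> hom_coset \<Sigma> \<alpha> [] [Plus, Minus]"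

abbreviation plus_coset where
  "plus_coset \<Sigma> \<alpha> \<equiv> hom_coset \<Sigma> \<alpha> [] [Plus]"

abbreviation minus_coset where
  "minus_coset \<Sigma> \<alpha> \<equiv> hom_coset \<Sigma> \<alpha> [] [Minus]"

lemma A_pm_simps:
  fixes x y :: "('s, 'k::field) lincob"
  shows "carrier (A_pm \<Sigma> \<alpha>) = pm_coset \<Sigma> \<alpha> ` lincobs \<Sigma> [] [Plus, Minus]"
  "\<zero>\<^bsub>A_pm \<Sigma> \<alpha>\<^esub> = pm_coset \<Sigma> \<alpha> 0"
  "pm_coset \<Sigma> \<alpha> x \<oplus>\<^bsub>A_pm \<Sigma> \<alpha>\<^esub> pm_coset \<Sigma> \<alpha> y = pm_coset \<Sigma> \<alpha> (x + y)"
  "a \<odot>\<^bsub>A_pm \<Sigma> \<alpha>\<^esub> pm_coset \<Sigma> \<alpha> x = pm_coset \<Sigma> \<alpha> (scale a x)"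
  "\<one>\<^bsub>A_pm \<Sigma> \<alpha>\<^esub> = pm_coset \<Sigma> \<alpha> (Poly_Mapping.single (pm_strand (Arc [])) 1)"
  using Hom_add[of \<Sigma> \<alpha> "[]" "[Plus, Minus]" x y] Hom_smult[of \<Sigma> \<alpha> "[]" "[Plus, Minus]" a x]
  by (simp_all add: A_pm_def Hom_carrier Hom_zero)

text \<open>\<open>A_pm\<close> differs from the hom space in multiplication and unit only, and the
  module axioms mention neither.\<close>

lemma module_A_pm: "Module.module scalars (A_pm \<Sigma> \<alpha>)"
  using module_Hom[of \<Sigma> \<alpha> "[]" "[Plus, Minus]"]
  by (simp add: A_pm_def module_def module_axioms_def abelian_group_def abelian_monoid_def
      abelian_group_axioms_def)

lemma fin_dim_A_pm: "fin_dim (A_pm \<Sigma> \<alpha>) \<longleftrightarrow> rational \<Sigma> \<alpha>"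
  by (simp add: rational_def fin_dim_def A_pm_def finsum_def)

lemma lincobs_pm_mult:
  "x \<in> lincobs \<Sigma> [] [Plus, Minus] \<Longrightarrow> y \<in> lincobs \<Sigma> [] [Plus, Minus] \<Longrightarrow>
    bilinmap pm_mult x y \<in> lincobs \<Sigma> [] [Plus, Minus]"
  by (erule (1) lincobs_bilinmap) (rule pm_mult_closed)

lemma lincobs_pm_act:
  "x \<in> lincobs \<Sigma> [] [Plus, Minus] \<Longrightarrow> v \<in> lincobs \<Sigma> [] [Plus] \<Longrightarrow>
    bilinmap pm_act x v \<in> lincobs \<Sigma> [] [Plus]"
  by (erule (1) lincobs_bilinmap) (rule pm_act_closed)

lemma lincobs_tensor:
  "v \<in> lincobs \<Sigma> [] [Plus] \<Longrightarrow> w \<in> lincobs \<Sigma> [] [Minus] \<Longrightarrow>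
    bilinmap (tensor 0 1) v w \<in> lincobs \<Sigma> [] [Plus, Minus]"
  by (erule (1) lincobs_bilinmap) (rule tensor_closed)

lemma bilinmap_pm_mult_assoc:
  assumes "x \<in> lincobs \<Sigma> [] [Plus, Minus]" "y \<in> lincobs \<Sigma> [] [Plus, Minus]" "z \<in> lincobs \<Sigma> [] [Plus, Minus]"
  shows "bilinmap pm_mult (bilinmap pm_mult x y) z = bilinmap pm_mult x (bilinmap pm_mult y z)"
  by (rule lincob_eqI, unfold linform_bilinmap,
      rule lincobs_cong[OF assms(1)], rule lincobs_cong[OF assms(2)], rule lincobs_cong[OF assms(3)])
     (simp only: pm_mult_assoc)

lemma bilinmap_pm_act_mult:
  assumes "x \<in> lincobs \<Sigma> [] [Plus, Minus]" "y \<in> lincobs \<Sigma> [] [Plus, Minus]" "z \<in> lincobs \<Sigma> [] [Plus]"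
  shows "bilinmap pm_act (bilinmap pm_mult x y) z = bilinmap pm_act x (bilinmap pm_act y z)"
  by (rule lincob_eqI, unfold linform_bilinmap,
      rule lincobs_cong[OF assms(1)], rule lincobs_cong[OF assms(2)], rule lincobs_cong[OF assms(3)])
     (simp only: pm_act_mult)

lemma bilinmap_pm_mult_tensor:
  assumes "x \<in> lincobs \<Sigma> [] [Plus, Minus]" "y \<in> lincobs \<Sigma> [] [Plus]" "z \<in> lincobs \<Sigma> [] [Minus]"
  shows "bilinmap pm_mult x (bilinmap (tensor 0 1) y z) = bilinmap (tensor 0 1) (bilinmap pm_act x y) z"
  by (rule lincob_eqI, unfold linform_bilinmap,
      rule lincobs_cong[OF assms(1)], rule lincobs_cong[OF assms(2)], rule lincobs_cong[OF assms(3)])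
     (simp only: pm_mult_tensor)

lemma bilinmap_pm_mult_one:
  assumes "x \<in> lincobs \<Sigma> [] [Plus, Minus]"
  shows "bilinmap pm_mult (Poly_Mapping.single (pm_strand (Arc [])) 1) x = x"
    and "bilinmap pm_mult x (Poly_Mapping.single (pm_strand (Arc [])) 1) = x"
  by (rule lincob_eqI, unfold linform_bilinmap linform_single mult_1_left,
      rule lincobs_cong[OF assms], simp only: pm_mult_one_left pm_mult_one_right)+

lemma lincobs_unit: "Poly_Mapping.single (pm_strand (Arc [])) 1 \<in> lincobs \<Sigma> [] [Plus, Minus]"
  by (rule lincobs_single) (rule cobordism_unit)

lemma unital_algebra_A_pm: "unital_algebra (A_pm \<Sigma> \<alpha>)"
proof -
  have "abelian_group (A_pm \<Sigma> \<alpha>)"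
    by (rule Module.module.axioms(2)[OF module_A_pm])
  moreover have "monoid (A_pm \<Sigma> \<alpha>)"
    by (rule monoidI)
       (auto simp: A_pm_simps(1,5) mult_coset lincobs_pm_mult lincobs_unit bilinmap_pm_mult_one
         bilinmap_pm_mult_assoc simp del: strand_cob.simps)
  ultimately have "ring (A_pm \<Sigma> \<alpha>)"
    by (rule ringI)
       (auto simp: A_pm_simps(1,3) mult_coset lincobs_pm_mult lincobs_add bilinmap_add_left bilinmap_add_right)
  moreover have "(a \<odot>\<^bsub>A_pm \<Sigma> \<alpha>\<^esub> x) \<otimes>\<^bsub>A_pm \<Sigma> \<alpha>\<^esub> y = a \<odot>\<^bsub>A_pm \<Sigma> \<alpha>\<^esub> (x \<otimes>\<^bsub>A_pm \<Sigma> \<alpha>\<^esub> y) \<and>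
      x \<otimes>\<^bsub>A_pm \<Sigma> \<alpha>\<^esub> (a \<odot>\<^bsub>A_pm \<Sigma> \<alpha>\<^esub> y) = a \<odot>\<^bsub>A_pm \<Sigma> \<alpha>\<^esub> (x \<otimes>\<^bsub>A_pm \<Sigma> \<alpha>\<^esub> y)"
    if "x \<in> carrier (A_pm \<Sigma> \<alpha>)" "y \<in> carrier (A_pm \<Sigma> \<alpha>)" for a x y
    using that by (auto simp: A_pm_simps(1,4) mult_coset lincobs_scale bilinmap_scale_left bilinmap_scale_right)
  ultimately show ?thesis
    by (simp add: unital_algebra_def module_A_pm)
qed

section \<open>The trace form on A(+-)\<close>

lemma linform_trace_commute:
  assumes "x \<in> lincobs \<Sigma> [] [Plus, Minus]" "y \<in> lincobs \<Sigma> [] [Plus, Minus]"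
  shows "linform (pm_trace \<alpha>) (bilinmap pm_mult x y) = linform (pm_trace \<alpha>) (bilinmap pm_mult y x)"
  unfolding linform_bilinmap linform_swap[of _ x y]
  by (rule lincobs_cong[OF assms(1)], rule lincobs_cong[OF assms(2)]) (rule pm_trace_commute)

lemma circ_tr_commute:
  assumes "x \<in> carrier (A_pm \<Sigma> \<alpha>)" "y \<in> carrier (A_pm \<Sigma> \<alpha>)"
  shows "circ_tr \<alpha> (x \<otimes>\<^bsub>A_pm \<Sigma> \<alpha>\<^esub> y) = circ_tr \<alpha> (y \<otimes>\<^bsub>A_pm \<Sigma> \<alpha>\<^esub> x)"
  using assms by (auto simp only: A_pm_simps(1) mult_coset circ_tr_coset lincobs_pm_mult
      elim!: imageE intro: linform_trace_commute)

text \<open>Each single cobordism represents an element of A(+-), so vanishing against all elements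
  includes every test in \<open>negligible_pm_iff\<close>.\<close>

lemma circ_tr_nondegenerate:
  fixes \<alpha> :: "('s, 'k::field) evaluation"
  assumes x: "x \<in> carrier (A_pm \<Sigma> \<alpha>)"
    and 0: "\<And>y. y \<in> carrier (A_pm \<Sigma> \<alpha>) \<Longrightarrow> circ_tr \<alpha> (y \<otimes>\<^bsub>A_pm \<Sigma> \<alpha>\<^esub> x) = 0"
  shows "x = \<zero>\<^bsub>A_pm \<Sigma> \<alpha>\<^esub>"
proof -
  obtain z where z: "z \<in> lincobs \<Sigma> [] [Plus, Minus]" and xz: "x = pm_coset \<Sigma> \<alpha> z"
    using x by (auto simp: A_pm_simps(1))
  have "linform (\<lambda>c. pm_trace \<alpha> (pm_mult d c)) z = 0" if d: "cobordism \<Sigma> [] [Plus, Minus] d" for d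
  proof -
    note dl = lincobs_single[OF d, of "1 :: 'k"]
    have "circ_tr \<alpha> (pm_coset \<Sigma> \<alpha> (Poly_Mapping.single d 1) \<otimes>\<^bsub>A_pm \<Sigma> \<alpha>\<^esub> x) = 0"
      by (rule 0) (use dl in \<open>simp add: A_pm_simps(1)\<close>)
    then show ?thesis
      by (simp add: xz mult_coset[OF dl z] circ_tr_coset[OF lincobs_pm_mult[OF dl z]])
  qed
  then have "z \<in> negligible \<Sigma> \<alpha> [] [Plus, Minus]"
    using z by (simp add: negligible_pm_iff)
  then show ?thesis
    by (simp add: xz A_pm_simps(2) hom_coset_eq_iff)
qed

lemma symmetric_frobenius_A_pm:
  assumes "rational \<Sigma> \<alpha>"
  shows "symmetric_frobenius_algebra (A_pm \<Sigma> \<alpha>) (circ_tr \<alpha>)"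
  unfolding symmetric_frobenius_algebra_def
proof (intro conjI unital_algebra_A_pm ballI)
  show "fin_dim (A_pm \<Sigma> \<alpha>)"
    using assms by (simp add: fin_dim_A_pm)
  show "linear_form (A_pm \<Sigma> \<alpha>) (circ_tr \<alpha>)"
    by (auto simp: linear_form_def A_pm_simps(1,3,4) circ_tr_coset lincobs_add lincobs_scale)
  show "nondegenerate (A_pm \<Sigma> \<alpha>) (\<lambda>x y. circ_tr \<alpha> (x \<otimes>\<^bsub>A_pm \<Sigma> \<alpha>\<^esub> y))"
    unfolding nondegenerate_def
  proof (intro conjI ballI impI; rule circ_tr_nondegenerate)
    \<comment> \<open>Only the other half of nondegeneracy matches
      \<open>circ_tr_nondegenerate\<close> directly; this half is reduced to it by the symmetry of
      the trace.\<close>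
    fix x y assume "x \<in> carrier (A_pm \<Sigma> \<alpha>)" "y \<in> carrier (A_pm \<Sigma> \<alpha>)"
      "\<forall>y\<in>carrier (A_pm \<Sigma> \<alpha>). circ_tr \<alpha> (x \<otimes>\<^bsub>A_pm \<Sigma> \<alpha>\<^esub> y) = 0"
    then show "circ_tr \<alpha> (y \<otimes>\<^bsub>A_pm \<Sigma> \<alpha>\<^esub> x) = 0"
      by (simp add: circ_tr_commute[of y])
  qed simp_all
qed (rule circ_tr_commute)

section \<open>The action on A(+) and the elements v \<otimes> w\<close>

lemma act_closed:
  "x \<in> carrier (A_pm \<Sigma> \<alpha>) \<Longrightarrow> v \<in> carrier (A_plus \<Sigma> \<alpha>) \<Longrightarrow> act \<Sigma> \<alpha> x v \<in> carrier (A_plus \<Sigma> \<alpha>)"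
  by (auto simp: A_pm_simps(1) Hom_carrier act_coset lincobs_pm_act)

lemma act_add_left:
  "x \<in> carrier (A_pm \<Sigma> \<alpha>) \<Longrightarrow> y \<in> carrier (A_pm \<Sigma> \<alpha>) \<Longrightarrow> v \<in> carrier (A_plus \<Sigma> \<alpha>) \<Longrightarrow>
    act \<Sigma> \<alpha> (x \<oplus>\<^bsub>A_pm \<Sigma> \<alpha>\<^esub> y) v = act \<Sigma> \<alpha> x v \<oplus>\<^bsub>A_plus \<Sigma> \<alpha>\<^esub> act \<Sigma> \<alpha> y v"
  by (auto simp: A_pm_simps(1,3) Hom_carrier Hom_add act_coset lincobs_add bilinmap_add_left)

lemma act_add_right:
  "x \<in> carrier (A_pm \<Sigma> \<alpha>) \<Longrightarrow> v \<in> carrier (A_plus \<Sigma> \<alpha>) \<Longrightarrow> w \<in> carrier (A_plus \<Sigma> \<alpha>) \<Longrightarrow>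
    act \<Sigma> \<alpha> x (v \<oplus>\<^bsub>A_plus \<Sigma> \<alpha>\<^esub> w) = act \<Sigma> \<alpha> x v \<oplus>\<^bsub>A_plus \<Sigma> \<alpha>\<^esub> act \<Sigma> \<alpha> x w"
  by (auto simp: A_pm_simps(1) Hom_carrier Hom_add act_coset lincobs_add bilinmap_add_right)

lemma act_smult:
  "x \<in> carrier (A_pm \<Sigma> \<alpha>) \<Longrightarrow> v \<in> carrier (A_plus \<Sigma> \<alpha>) \<Longrightarrow>
    act \<Sigma> \<alpha> x (a \<odot>\<^bsub>A_plus \<Sigma> \<alpha>\<^esub> v) = a \<odot>\<^bsub>A_plus \<Sigma> \<alpha>\<^esub> act \<Sigma> \<alpha> x v"
  by (auto simp: A_pm_simps(1) Hom_carrier Hom_smult act_coset lincobs_scale bilinmap_scale_right)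

lemma bilinmap_0 [simp]: "bilinmap f 0 y = 0" "bilinmap f x 0 = 0"
  by (simp_all add: bilinmap_def)

lemma act_zero_left: "v \<in> carrier (A_plus \<Sigma> \<alpha>) \<Longrightarrow> act \<Sigma> \<alpha> \<zero>\<^bsub>A_pm \<Sigma> \<alpha>\<^esub> v = \<zero>\<^bsub>A_plus \<Sigma> \<alpha>\<^esub>"
  by (auto simp: A_pm_simps(2) Hom_carrier Hom_zero act_coset)

lemma act_zero_right: "x \<in> carrier (A_pm \<Sigma> \<alpha>) \<Longrightarrow> act \<Sigma> \<alpha> x \<zero>\<^bsub>A_plus \<Sigma> \<alpha>\<^esub> = \<zero>\<^bsub>A_plus \<Sigma> \<alpha>\<^esub>"
  by (auto simp: A_pm_simps(1) Hom_zero act_coset)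

lemma act_mult:
  "x \<in> carrier (A_pm \<Sigma> \<alpha>) \<Longrightarrow> y \<in> carrier (A_pm \<Sigma> \<alpha>) \<Longrightarrow> v \<in> carrier (A_plus \<Sigma> \<alpha>) \<Longrightarrow>
    act \<Sigma> \<alpha> (x \<otimes>\<^bsub>A_pm \<Sigma> \<alpha>\<^esub> y) v = act \<Sigma> \<alpha> x (act \<Sigma> \<alpha> y v)"
  by (auto simp: A_pm_simps(1) Hom_carrier mult_coset act_coset lincobs_pm_mult lincobs_pm_act
      bilinmap_pm_act_mult)

lemma tens_closed:
  "v \<in> carrier (A_plus \<Sigma> \<alpha>) \<Longrightarrow> w \<in> carrier (A_minus \<Sigma> \<alpha>) \<Longrightarrow> tens \<Sigma> \<alpha> v w \<in> carrier (A_pm \<Sigma> \<alpha>)"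
  by (auto simp: A_pm_simps(1) Hom_carrier tens_coset lincobs_tensor)

lemma tens_zero_left: "w \<in> carrier (A_minus \<Sigma> \<alpha>) \<Longrightarrow> tens \<Sigma> \<alpha> \<zero>\<^bsub>A_plus \<Sigma> \<alpha>\<^esub> w = \<zero>\<^bsub>A_pm \<Sigma> \<alpha>\<^esub>"
  by (auto simp: A_pm_simps(2) Hom_carrier Hom_zero tens_coset)

lemma mult_tens:
  "x \<in> carrier (A_pm \<Sigma> \<alpha>) \<Longrightarrow> v \<in> carrier (A_plus \<Sigma> \<alpha>) \<Longrightarrow> w \<in> carrier (A_minus \<Sigma> \<alpha>) \<Longrightarrow>
    x \<otimes>\<^bsub>A_pm \<Sigma> \<alpha>\<^esub> tens \<Sigma> \<alpha> v w = tens \<Sigma> \<alpha> (act \<Sigma> \<alpha> x v) w"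
  by (auto simp: A_pm_simps(1) Hom_carrier mult_coset act_coset tens_coset lincobs_tensor lincobs_pm_act
      bilinmap_pm_mult_tensor)

text \<open>On representatives the sides differ: the left one carries a floating interval where the
  right one carries its value as a scalar. They agree modulo negligible combinations because
  evaluation is multiplicative.\<close>

lemma act_tens:
  assumes "v \<in> carrier (A_plus \<Sigma> \<alpha>)" "w \<in> carrier (A_minus \<Sigma> \<alpha>)" "v' \<in> carrier (A_plus \<Sigma> \<alpha>)"
  shows "act \<Sigma> \<alpha> (tens \<Sigma> \<alpha> v w) v' = pairing \<alpha> w v' \<odot>\<^bsub>A_plus \<Sigma> \<alpha>\<^esub> v"
proof -
  obtain x where x: "x \<in> lincobs \<Sigma> [] [Plus]" "v = plus_coset \<Sigma> \<alpha> x"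
    using assms(1) by (auto simp: Hom_carrier)
  obtain y where y: "y \<in> lincobs \<Sigma> [] [Minus]" "w = minus_coset \<Sigma> \<alpha> y"
    using assms(2) by (auto simp: Hom_carrier)
  obtain x' where x': "x' \<in> lincobs \<Sigma> [] [Plus]" "v' = plus_coset \<Sigma> \<alpha> x'"
    using assms(3) by (auto simp: Hom_carrier)
  define a where "a = linform (\<lambda>d. linform (cob_pairing \<alpha> d) x') y"
  let ?z = "bilinmap pm_act (bilinmap (tensor 0 1) x y) x' - scale a x"
  have "bilinmap pm_act (bilinmap (tensor 0 1) x y) x' + - scale a x \<in> lincobs \<Sigma> [] [Plus]"
    using x y x' by (intro lincobs_add lincobs_uminus lincobs_scale lincobs_pm_act lincobs_tensor)
  moreover have "linform (cob_pairing \<alpha> w') ?z = 0" if w': "cobordism \<Sigma> [] [Minus] w'" for w'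
  proof -
    have "linform (cob_pairing \<alpha> w') (bilinmap pm_act (bilinmap (tensor 0 1) x y) x') =
        linform (\<lambda>c. linform (\<lambda>d. linform (\<lambda>c'. cob_pairing \<alpha> d c' * cob_pairing \<alpha> w' c) x') y) x"
      unfolding linform_bilinmap
      by (rule lincobs_cong[OF x(1)], rule lincobs_cong[OF y(1)], rule lincobs_cong[OF x'(1)])
         (rule cob_pairing_tensor_act[OF _ _ _ w'])
    then show ?thesis
      by (simp add: linform_mult_right linform_mult_left a_def)
  qed
  ultimately have "?z \<in> negligible \<Sigma> \<alpha> [] [Plus]"
    by (simp add: negligible_plus_iff)
  then show ?thesis
    using x y x' by (simp add: tens_coset act_coset lincobs_tensor pairing_coset Hom_smult hom_coset_eq_iff
        flip: a_def)
qed

text \<open>For a basis and its dual basis this is the identity operator of A(+) written as a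
  tensor, as \<open>act_coev\<close> confirms.\<close>

definition coevaluation ::
    "'s set \<Rightarrow> ('s, 'k::field) evaluation \<Rightarrow> nat \<Rightarrow> (nat \<Rightarrow> ('s, 'k) lincob set) \<Rightarrow>
     (nat \<Rightarrow> ('s, 'k) lincob set) \<Rightarrow> ('s, 'k) lincob set" where
  "coevaluation \<Sigma> \<alpha> k v v' = (\<Oplus>\<^bsub>A_pm \<Sigma> \<alpha>\<^esub>i\<in>{..<k}. tens \<Sigma> \<alpha> (v i) (v' i))"

context
  fixes \<Sigma> :: "'s set" and \<alpha> :: "('s, 'k::field) evaluation"
    and k :: nat and v v' :: "nat \<Rightarrow> ('s, 'k) lincob set"
  assumes basis: "basis (A_plus \<Sigma> \<alpha>) k v"
    and v'_closed: "\<And>i. i < k \<Longrightarrow> v' i \<in> carrier (A_minus \<Sigma> \<alpha>)"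
    and dual: "\<forall>i<k. \<forall>j<k. pairing \<alpha> (v' j) (v i) = (if i = j then 1 else 0)"
begin

abbreviation "coev \<equiv> coevaluation \<Sigma> \<alpha> k v v'"

lemma v_closed: "i < k \<Longrightarrow> v i \<in> carrier (A_plus \<Sigma> \<alpha>)"
  using basis by (simp add: basis_def)

interpretation P: Module.module "scalars :: 'k ring" "A_plus \<Sigma> \<alpha>"
  by (rule module_Hom)

interpretation A: ring "A_pm \<Sigma> \<alpha>"
  using unital_algebra_A_pm[of \<Sigma> \<alpha>] by (simp add: unital_algebra_def)

lemma scalar_closed: "a \<in> carrier (scalars :: 'k ring)"
  by (simp add: scalars_def)

lemma tens_basis_closed: "i < k \<Longrightarrow> tens \<Sigma> \<alpha> (v i) (v' i) \<in> carrier (A_pm \<Sigma> \<alpha>)"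
  by (simp add: tens_closed v_closed v'_closed)

lemma coev_closed: "coev \<in> carrier (A_pm \<Sigma> \<alpha>)"
  unfolding coevaluation_def by (rule A.finsum_closed) (auto intro: tens_basis_closed)

text \<open>By \<open>act_tens\<close> the i-th summand sends \<open>v j\<close> to the multiple of
  \<open>v i\<close> by the pairing of \<open>v' i\<close> with \<open>v j\<close>, so only i = j
  contributes.\<close>

lemma act_coev_basis:
  assumes j: "j < k"
  shows "act \<Sigma> \<alpha> coev (v j) = v j"
proof -
  have "act \<Sigma> \<alpha> coev (v j) = (\<Oplus>\<^bsub>A_plus \<Sigma> \<alpha>\<^esub>i\<in>{..<k}. act \<Sigma> \<alpha> (tens \<Sigma> \<alpha> (v i) (v' i)) (v j))"
    unfolding coevaluation_def
    by (rule finsum_hom[OF A.abelian_monoid_axioms P.abelian_monoid_axioms, where h = "\<lambda>x. act \<Sigma> \<alpha> x (v j)"])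
       (simp_all add: act_closed act_zero_left act_add_left v_closed[OF j] tens_basis_closed)
  also have "\<dots> = (\<Oplus>\<^bsub>A_plus \<Sigma> \<alpha>\<^esub>i\<in>{..<k}. if j = i then v i else \<zero>\<^bsub>A_plus \<Sigma> \<alpha>\<^esub>)"
  proof (rule P.finsum_cong')
    fix i assume "i \<in> {..<k}"
    then have "act \<Sigma> \<alpha> (tens \<Sigma> \<alpha> (v i) (v' i)) (v j) = (if j = i then 1 else 0) \<odot>\<^bsub>A_plus \<Sigma> \<alpha>\<^esub> v i"
      using j dual by (simp add: act_tens v_closed v'_closed)
    moreover have "1 \<odot>\<^bsub>A_plus \<Sigma> \<alpha>\<^esub> v i = v i" "0 \<odot>\<^bsub>A_plus \<Sigma> \<alpha>\<^esub> v i = \<zero>\<^bsub>A_plus \<Sigma> \<alpha>\<^esub>"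
      using P.smult_one[OF v_closed[of i]] P.smult_l_null[OF v_closed[of i]] \<open>i \<in> {..<k}\<close>
      by (simp_all add: scalars_def)
    ultimately show "act \<Sigma> \<alpha> (tens \<Sigma> \<alpha> (v i) (v' i)) (v j) = (if j = i then v i else \<zero>\<^bsub>A_plus \<Sigma> \<alpha>\<^esub>)"
      by simp
  qed (auto simp: v_closed)
  also have "\<dots> = v j"
    using j by (intro P.finsum_singleton) (auto simp: v_closed)
  finally show ?thesis .
qed

lemma act_coev:
  assumes "w \<in> carrier (A_plus \<Sigma> \<alpha>)"
  shows "act \<Sigma> \<alpha> coev w = w"
proof -
  have "\<forall>x \<in> carrier (A_plus \<Sigma> \<alpha>). \<exists>a. x = (\<Oplus>\<^bsub>A_plus \<Sigma> \<alpha>\<^esub>i\<in>{..<k}. a i \<odot>\<^bsub>A_plus \<Sigma> \<alpha>\<^esub> v i)"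
    using basis unfolding basis_def by (elim conjE)
  from bspec[OF this assms] obtain a where
    a: "w = (\<Oplus>\<^bsub>A_plus \<Sigma> \<alpha>\<^esub>i\<in>{..<k}. a i \<odot>\<^bsub>A_plus \<Sigma> \<alpha>\<^esub> v i)"
    by (elim exE) (rule that)
  have "act \<Sigma> \<alpha> coev w = (\<Oplus>\<^bsub>A_plus \<Sigma> \<alpha>\<^esub>i\<in>{..<k}. act \<Sigma> \<alpha> coev (a i \<odot>\<^bsub>A_plus \<Sigma> \<alpha>\<^esub> v i))"
    unfolding a
    by (rule finsum_hom[OF P.abelian_monoid_axioms P.abelian_monoid_axioms])
       (simp_all add: act_closed act_zero_right act_add_right coev_closed v_closed scalar_closed)
  also have "\<dots> = w"
    unfolding a
    by (rule P.finsum_cong')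
       (auto simp: act_smult act_coev_basis coev_closed v_closed scalar_closed)
  finally show ?thesis .
qed

text \<open>The product of \<open>x\<close> with \<open>coev\<close> depends only on the operator by
  which \<open>x\<close> acts on A(+). Equal operators therefore give equal products.\<close>

lemma mult_coev:
  assumes x: "x \<in> carrier (A_pm \<Sigma> \<alpha>)"
  shows "x \<otimes>\<^bsub>A_pm \<Sigma> \<alpha>\<^esub> coev = (\<Oplus>\<^bsub>A_pm \<Sigma> \<alpha>\<^esub>i\<in>{..<k}. tens \<Sigma> \<alpha> (act \<Sigma> \<alpha> x (v i)) (v' i))"
proof -
  have "x \<otimes>\<^bsub>A_pm \<Sigma> \<alpha>\<^esub> coev = (\<Oplus>\<^bsub>A_pm \<Sigma> \<alpha>\<^esub>i\<in>{..<k}. x \<otimes>\<^bsub>A_pm \<Sigma> \<alpha>\<^esub> tens \<Sigma> \<alpha> (v i) (v' i))"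
    unfolding coevaluation_def
    by (rule finsum_hom[OF A.abelian_monoid_axioms A.abelian_monoid_axioms])
       (simp_all add: x tens_basis_closed A.r_distr)
  also have "\<dots> = (\<Oplus>\<^bsub>A_pm \<Sigma> \<alpha>\<^esub>i\<in>{..<k}. tens \<Sigma> \<alpha> (act \<Sigma> \<alpha> x (v i)) (v' i))"
    by (rule A.finsum_cong') (auto simp: mult_tens x v_closed v'_closed tens_closed act_closed)
  finally show ?thesis .
qed

text \<open>Since \<open>coev\<close> acts as the identity, the product of \<open>coev\<close> and
  \<open>x\<close> acts like \<open>x\<close> itself, and \<open>mult_coev\<close> applies to
  both.\<close>

lemma coev_mult_coev:
  assumes x: "x \<in> carrier (A_pm \<Sigma> \<alpha>)"
  shows "coev \<otimes>\<^bsub>A_pm \<Sigma> \<alpha>\<^esub> (x \<otimes>\<^bsub>A_pm \<Sigma> \<alpha>\<^esub> coev) = x \<otimes>\<^bsub>A_pm \<Sigma> \<alpha>\<^esub> coev"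
proof -
  have "coev \<otimes>\<^bsub>A_pm \<Sigma> \<alpha>\<^esub> (x \<otimes>\<^bsub>A_pm \<Sigma> \<alpha>\<^esub> coev) = coev \<otimes>\<^bsub>A_pm \<Sigma> \<alpha>\<^esub> x \<otimes>\<^bsub>A_pm \<Sigma> \<alpha>\<^esub> coev"
    using x by (simp add: A.m_assoc coev_closed)
  also have "\<dots> = x \<otimes>\<^bsub>A_pm \<Sigma> \<alpha>\<^esub> coev"
    unfolding mult_coev[OF x] mult_coev[OF A.m_closed[OF coev_closed x]]
    by (rule A.finsum_cong')
       (auto simp: act_mult act_coev x v_closed v'_closed tens_closed act_closed coev_closed)
  finally show ?thesis .
qed

lemma ker_act_eq:
  "ker_act \<Sigma> \<alpha> = {x \<in> carrier (A_pm \<Sigma> \<alpha>). x \<otimes>\<^bsub>A_pm \<Sigma> \<alpha>\<^esub> coev = \<zero>\<^bsub>A_pm \<Sigma> \<alpha>\<^esub>}"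
proof (intro equalityI subsetI)
  fix x assume "x \<in> ker_act \<Sigma> \<alpha>"
  then have x: "x \<in> carrier (A_pm \<Sigma> \<alpha>)"
    and 0: "\<And>w. w \<in> carrier (A_plus \<Sigma> \<alpha>) \<Longrightarrow> act \<Sigma> \<alpha> x w = \<zero>\<^bsub>A_plus \<Sigma> \<alpha>\<^esub>"
    by (simp_all add: ker_act_def)
  have "x \<otimes>\<^bsub>A_pm \<Sigma> \<alpha>\<^esub> coev = (\<Oplus>\<^bsub>A_pm \<Sigma> \<alpha>\<^esub>i\<in>{..<k}. \<zero>\<^bsub>A_pm \<Sigma> \<alpha>\<^esub>)"
    unfolding mult_coev[OF x]
    by (rule A.finsum_cong') (auto simp: 0 v_closed v'_closed tens_zero_left)
  then show "x \<in> {x \<in> carrier (A_pm \<Sigma> \<alpha>). x \<otimes>\<^bsub>A_pm \<Sigma> \<alpha>\<^esub> coev = \<zero>\<^bsub>A_pm \<Sigma> \<alpha>\<^esub>}"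
    using x by simp
next
  fix x assume "x \<in> {x \<in> carrier (A_pm \<Sigma> \<alpha>). x \<otimes>\<^bsub>A_pm \<Sigma> \<alpha>\<^esub> coev = \<zero>\<^bsub>A_pm \<Sigma> \<alpha>\<^esub>}"
  then have x: "x \<in> carrier (A_pm \<Sigma> \<alpha>)" and 0: "x \<otimes>\<^bsub>A_pm \<Sigma> \<alpha>\<^esub> coev = \<zero>\<^bsub>A_pm \<Sigma> \<alpha>\<^esub>"
    by simp_all
  \<comment> \<open>xw = x(ew) = (xe)w = 0, with e standing for \<open>coev\<close>.\<close>
  have "act \<Sigma> \<alpha> x w = \<zero>\<^bsub>A_plus \<Sigma> \<alpha>\<^esub>" if w: "w \<in> carrier (A_plus \<Sigma> \<alpha>)" for w
    using act_mult[OF x coev_closed w] by (simp add: 0 act_coev[OF w] act_zero_left[OF w])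
  then show "x \<in> ker_act \<Sigma> \<alpha>"
    using x by (simp add: ker_act_def)
qed

lemma symmetric_frobenius_ker_act:
  assumes "rational \<Sigma> \<alpha>"
  shows "symmetric_frobenius_algebra
    ((A_pm \<Sigma> \<alpha>) \<lparr> carrier := ker_act \<Sigma> \<alpha>, one := \<one>\<^bsub>A_pm \<Sigma> \<alpha>\<^esub> \<ominus>\<^bsub>A_pm \<Sigma> \<alpha>\<^esub> coev \<rparr>) (circ_tr \<alpha>)"
  unfolding ker_act_eq
  by (rule symmetric_frobenius_corner[OF symmetric_frobenius_A_pm[OF assms] coev_closed coev_mult_coev])

end

theorem proposition2p8:
  fixes \<Sigma> :: "'s set" and \<alpha> :: "('s, 'k::field) evaluation"
    and k :: nat and v v' :: "nat \<Rightarrow> ('s, 'k) lincob set"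
  assumes "finite \<Sigma>"
    and "rational \<Sigma> \<alpha>"
    and "basis (A_plus \<Sigma> \<alpha>) k v"
    and "basis (A_minus \<Sigma> \<alpha>) k v'"
    and "\<forall>i<k. \<forall>j<k. pairing \<alpha> (v' j) (v i) = (if i = j then 1 else 0)"
  shows "symmetric_frobenius_algebra
    ((A_pm \<Sigma> \<alpha>)
      \<lparr> carrier := ker_act \<Sigma> \<alpha>,
        one := \<one>\<^bsub>A_pm \<Sigma> \<alpha>\<^esub> \<ominus>\<^bsub>A_pm \<Sigma> \<alpha>\<^esub> (\<Oplus>\<^bsub>A_pm \<Sigma> \<alpha>\<^esub>i\<in>{..<k}. tens \<Sigma> \<alpha> (v i) (v' i)) \<rparr>)
    (circ_tr \<alpha>)"
proof -
  have "v' i \<in> carrier (A_minus \<Sigma> \<alpha>)" if "i < k" for i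
    using assms(4) that by (simp add: basis_def)
  from symmetric_frobenius_ker_act[OF assms(3) this assms(5,2)] show ?thesis
    by (simp only: coevaluation_def)
qed

end
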